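(* Let $\mathcal{O}$ be a complete discrete valuation ring with finite residue field, and assume that $\mathrm{char}\,\mathcal{O}=2$ (so $\mathcal{O}\cong\mathbb{F}_q[[t]]$ with $q$ a power of $2$). Then the abscissa of convergence of $\zeta_{\mathrm{SL}_2(\mathcal{O})}(s)$ lies in the interval $[1,\,5/2]$.
   Context: $\mathrm{SL}_2(\mathcal{O})$ carries its profinite topology. $r_i(G)$ is the number of isomorphism classes of continuous irreducible complex representations of $G$ of dimension $i$, and $\zeta_G(s)=\sum_{i\ge1}r_i(G)i^{-s}$ is the representation zeta function. The abscissa of convergence is the infimum of the real $s$ for which the series converges. *)

theory Defs
  imports
    "HOL-Analysis.Analysis"
    "HOL-Algebra.Algebra"
    "Jordan_Normal_Form.VS_Connect"
begin

section \<open>Complete discrete valuation rings\<close>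

text \<open>A discrete valuation ring is a principal ideal domain with exactly one nonzero prime
  ideal; this excludes fields.\<close>

locale discrete_valuation_ring = principal_domain R for R (structure) +
  assumes ex1_nonzero_prime: "\<exists>!P. primeideal P R \<and> P \<noteq> {\<zero>}"

definition dvr_ideal :: "('a, 'b) ring_scheme \<Rightarrow> 'a set" where
  "dvr_ideal R = (THE P. primeideal P R \<and> P \<noteq> {\<zero>\<^bsub>R\<^esub>})"

definition dvr_ideal_power :: "('a, 'b) ring_scheme \<Rightarrow> nat \<Rightarrow> 'a set" where
  "dvr_ideal_power R k = dvr_ideal R [^]\<^bsub>ideals_set R\<^esub> k"

locale complete_discrete_valuation_ring = discrete_valuation_ring R for R (structure) +
  assumes complete:
    "\<lbrakk>\<And>n :: nat. x n \<in> carrier R;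
      \<And>k. \<exists>N. \<forall>m\<ge>N. \<forall>n\<ge>N. x m \<ominus> x n \<in> dvr_ideal_power R k\<rbrakk>
     \<Longrightarrow> \<exists>l\<in>carrier R. \<forall>k. \<exists>N. \<forall>n\<ge>N. x n \<ominus> l \<in> dvr_ideal_power R k"

definition residue_field :: "('a, 'b) ring_scheme \<Rightarrow> 'a set ring" where
  "residue_field R = R Quot dvr_ideal R"


section \<open>The profinite group of matrices of determinant one\<close>

definition SL :: "nat \<Rightarrow> 'a::comm_ring_1 mat monoid" where
  "SL n = \<lparr>carrier = {A \<in> carrier_mat n n. Determinant.det A = 1}, mult = (*), one = 1\<^sub>m n\<rparr>"

text \<open>The profinite topology of \<open>SL n\<close> over a complete discrete valuation ring with finite
  residue field and maximal ideal \<open>\<mm>\<close>, i.e. the topology of the inverse limit of the groups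
  \<open>SL n\<close> over the finite rings \<open>R / \<mm>^k\<close>.  It is generated by the fibres of reduction
  modulo \<open>\<mm>^k\<close>.\<close>

definition SL_topology :: "nat \<Rightarrow> 'a::idom mat topology" where
  "SL_topology n = topology_generated_by
     {{B \<in> carrier (SL n). \<forall>i<n. \<forall>j<n.
         B $$ (i, j) - A $$ (i, j) \<in> dvr_ideal_power class_ring k}
      | A k. A \<in> carrier (SL n)}"


lemma group_SL: "group (SL n :: 'a::comm_ring_1 mat monoid)"
proof (rule groupI)
  fix A :: "'a mat" assume "A \<in> carrier (SL n)"
  then have A: "A \<in> carrier_mat n n" "Determinant.det A = 1"
    by (auto simp: SL_def)
  have "Determinant.det (adj_mat A) * Determinant.det A = 1"
    using Determinant.det_mult[OF adj_mat(1)[OF A(1)] A(1)] adj_mat(3)[OF A(1)] A(2) by simp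
  then show "\<exists>B\<in>carrier (SL n). B \<otimes>\<^bsub>SL n\<^esub> A = \<one>\<^bsub>SL n\<^esub>"
    using adj_mat[OF A(1)] A(2) by (intro bexI[of _ "adj_mat A"]) (auto simp: SL_def)
qed (auto simp: SL_def Determinant.det_mult)

lemma topspace_SL_topology: "topspace (SL_topology n :: 'a::idom mat topology) = carrier (SL n)"
proof -
  have "dvr_ideal_power (class_ring :: 'a ring) 0 = UNIV"
    by (simp add: dvr_ideal_power_def nat_pow_def ideals_set_def)
  then show ?thesis
    unfolding SL_topology_def topology_generated_by_topspace by blast
qed


section \<open>Representation zeta functions\<close>

text \<open>In the following, \<open>T\<close> is the topology of the group \<open>G\<close>. A representation of dimension
  \<open>n\<close> is a homomorphism into the invertible complex \<open>n \<times> n\<close> matrices; its values outside the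
  carrier of \<open>G\<close> are irrelevant, and \<open>isomorphic_reps\<close> ignores them.\<close>

definition continuous_reps ::
    "('g, 'b) monoid_scheme \<Rightarrow> 'g topology \<Rightarrow> nat \<Rightarrow> ('g \<Rightarrow> complex mat) set" where
  "continuous_reps G T n =
     {\<rho> \<in> hom G (units_of (ring_mat TYPE(complex) n ())).
        \<forall>i<n. \<forall>j<n. continuous_map T euclidean (\<lambda>g. \<rho> g $$ (i, j))}"

definition irreducible_rep ::
    "('g, 'b) monoid_scheme \<Rightarrow> nat \<Rightarrow> ('g \<Rightarrow> complex mat) \<Rightarrow> bool" where
  "irreducible_rep G n \<rho> \<longleftrightarrow> n > 0 \<and>
     (\<forall>W. VectorSpace.subspace class_ring W (module_vec TYPE(complex) n) \<and>
          (\<forall>g\<in>carrier G. \<forall>w\<in>W. \<rho> g *\<^sub>v w \<in> W)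
        \<longrightarrow> W = {0\<^sub>v n} \<or> W = carrier_vec n)"

definition continuous_irreps ::
    "('g, 'b) monoid_scheme \<Rightarrow> 'g topology \<Rightarrow> nat \<Rightarrow> ('g \<Rightarrow> complex mat) set" where
  "continuous_irreps G T n = {\<rho> \<in> continuous_reps G T n. irreducible_rep G n \<rho>}"

definition isomorphic_reps ::
    "('g, 'b) monoid_scheme \<Rightarrow> nat \<Rightarrow> ('g \<Rightarrow> complex mat) \<Rightarrow> ('g \<Rightarrow> complex mat) \<Rightarrow> bool" where
  "isomorphic_reps G n \<rho> \<sigma> \<longleftrightarrow>
     (\<exists>P \<in> Units (ring_mat TYPE(complex) n ()). \<forall>g\<in>carrier G. P * \<rho> g = \<sigma> g * P)"

definition irrep_classes ::
    "('g, 'b) monoid_scheme \<Rightarrow> 'g topology \<Rightarrow> nat \<Rightarrow> ('g \<Rightarrow> complex mat) set set" where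
  "irrep_classes G T n = continuous_irreps G T n //
     {(\<rho>, \<sigma>). \<rho> \<in> continuous_irreps G T n \<and> \<sigma> \<in> continuous_irreps G T n \<and>
               isomorphic_reps G n \<rho> \<sigma>}"

definition irrep_count :: "('g, 'b) monoid_scheme \<Rightarrow> 'g topology \<Rightarrow> nat \<Rightarrow> enat" where
  "irrep_count G T n =
     (if finite (irrep_classes G T n) then enat (card (irrep_classes G T n)) else \<infinity>)"

text \<open>The series has nonnegative terms at real \<open>s\<close>, so it converges exactly if its value as an
  extended nonnegative real is finite. Infinitely many classes in one dimension make it diverge.\<close>

definition rep_zeta :: "('g, 'b) monoid_scheme \<Rightarrow> 'g topology \<Rightarrow> real \<Rightarrow> ennreal" where
  "rep_zeta G T s =
     suminf (\<lambda>i. ennreal_of_enat (irrep_count G T (Suc i)) * ennreal (real (Suc i) powr - s))"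

definition rep_zeta_abscissa :: "('g, 'b) monoid_scheme \<Rightarrow> 'g topology \<Rightarrow> ereal" where
  "rep_zeta_abscissa G T = Inf (ereal ` {s. rep_zeta G T s < \<infinity>})"

end

theory Submission
  imports Defs "Jordan_Normal_Form.Spectral_Radius" "HOL-Real_Asymp.Real_Asymp"
begin

text \<open>
  Write \<open>G\<close> for the group of \<open>2 \<times> 2\<close> matrices of determinant one over the ring, \<open>t\<close> for a
  generator of the maximal ideal, \<open>q\<close> for the order of the residue field and \<open>G\<^sub>k\<close> for the quotient of
  \<open>G\<close> by the subgroup of matrices that are congruent to the identity modulo \<open>t\<^sup>k\<close>.  The group \<open>G\<^sub>k\<close> has order
  about \<open>q\<^sup>3\<^sup>k\<close>.  Small neighbourhoods of the identity matrix contain no nontrivial subgroup, so a continuous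
  complex representation factors through some \<open>G\<^sub>k\<close> (\<open>continuous_rep_trivial\<close>).  The zeta function is thus governed by two numbers: how many
  irreducible representations \<open>G\<^sub>k\<close> has, and how large those are that do not factor through \<open>G\<^sub>k\<^sub>-\<^sub>1\<close>.

  The number of irreducible representations of a finite group is its number of conjugacy classes,
  and the squares of their dimensions sum to at most the group order.  Both facts follow from Schur's
  lemma and from the completeness of the matrix coefficients (\<open>card_noniso_le\<close>, \<open>sum_squares_le\<close>,
  \<open>exists_noniso_card_conj_classes\<close>).

  The class number of \<open>G\<^sub>k\<close> is the number of commuting pairs divided by the order.  In characteristic
  two, \<open>a \<mapsto> a\<^sup>2 + \<alpha> a\<close> is additive with a kernel that is controlled by the valuation of \<open>\<alpha>\<close>.  A count
  of commuting pairs by valuations of entries and traces then bounds the class number by a constant times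
  \<open>(k + 1)\<^sup>3 q\<^sup>k\<close> (\<open>class_number_le\<close>); traces show that it is at least \<open>q\<^sup>k\<close> (\<open>class_number_ge\<close>).

  For the dimensions, consider a representation of \<open>G\<^sub>k\<close> that does not factor through \<open>G\<^sub>k\<^sub>-\<^sub>1\<close>, where \<open>k \<ge> 2\<close>.
  It is nontrivial on the upper unipotent matrices with entry in the ideal of \<open>t\<^sup>k\<^sup>-\<^sup>1\<close>, and so it contains a
  character of the unipotent subgroup that is nontrivial there.  The diagonal matrices permute such characters
  through squares of units.  There are at least \<open>Q / 2\<close> of these modulo \<open>t\<^sup>k\<close>, where \<open>Q\<close> is \<open>q\<close> to the
  power \<open>k div 2\<close>, and the dimension is at least \<open>Q / 2\<close> (\<open>dimension_bound\<close>).

  The representations of level \<open>k\<close> therefore contribute at most a constant times \<open>(k + 1)\<^sup>3 q\<^sup>k Q\<^sup>-\<^sup>s\<close> to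
  the zeta function at \<open>s > 0\<close>.  At \<open>s = 5/2\<close> this is summable over \<open>k\<close> (\<open>rep_zeta_finite\<close>), so the abscissa is
  at most \<open>5/2\<close>.

  Conversely, \<open>G\<^sub>k\<close> has at least \<open>q\<^sup>k\<close> irreducible representations whose squared dimensions sum to
  at most \<open>2 q\<^sup>3\<^sup>k\<close>, so at least \<open>q\<^sup>k / 2\<close> of them have dimension at most \<open>2 q\<^sup>k\<close>.  For \<open>0 \<le> s < 1\<close> they
  contribute at least a constant times \<open>q\<^sup>k\<^sup>(\<^sup>1\<^sup>-\<^sup>s\<^sup>)\<close>, which is unbounded in \<open>k\<close> (\<open>rep_zeta_infinite\<close>).  Hence the
  abscissa is at least \<open>1\<close>.\<close>

unbundle no vec_syntax
unbundle no inner_syntax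

section \<open>Linear independence of functions\<close>

text \<open>Gaussian elimination on one point of \<open>D\<close> at a time: if some function does not vanish at the
  point, it serves as a pivot that clears the others there and is then dropped together with the
  point.  Every dimension count below reduces to this statement.\<close>

lemma independent_functions_card_le:
  fixes F :: "'i \<Rightarrow> 'x \<Rightarrow> complex"
  assumes "finite D" "finite I"
    and "\<And>c. (\<And>x. x \<in> D \<Longrightarrow> (\<Sum>i\<in>I. c i * F i x) = 0) \<Longrightarrow> \<forall>i\<in>I. c i = 0"
  shows "card I \<le> card D"
  using assms
proof (induction D arbitrary: I F rule: finite_induct)
  case empty
  have "\<forall>i\<in>I. (\<lambda>_. 1::complex) i = 0" by (rule empty.prems(2)) auto
  then have "I = {}" by auto
  then show ?case by simp
next
  case (insert x D)
  show ?case
  proof (cases "\<exists>j\<in>I. F j x \<noteq> 0")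
    case False
    have "card I \<le> card D"
    proof (rule insert.IH[OF insert.prems(1), of F])
      fix c assume c: "\<And>y. y \<in> D \<Longrightarrow> (\<Sum>i\<in>I. c i * F i y) = 0"
      show "\<forall>i\<in>I. c i = 0"
        by (rule insert.prems(2)) (use False c in auto)
    qed
    then show ?thesis using insert.hyps by simp
  next
    case True
    then obtain j where j: "j \<in> I" "F j x \<noteq> 0" by blast
    define I' where "I' = I - {j}"
    have I: "I = insert j I'" "j \<notin> I'" "finite I'" using j insert.prems by (auto simp: I'_def)
    define F' where "F' = (\<lambda>i y. F i y - F i x / F j x * F j y)"
    have "card I' \<le> card D"
    proof (rule insert.IH[OF I(3), of F'])
      fix c assume c: "\<And>y. y \<in> D \<Longrightarrow> (\<Sum>i\<in>I'. c i * F' i y) = 0"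
      \<comment> \<open>The coefficient of the pivot is chosen so that the relation also holds at \<open>x\<close>.\<close>
      define d where "d = c(j := - (\<Sum>i\<in>I'. c i * F i x / F j x))"
      have d: "(\<Sum>i\<in>I. d i * F i y) = (\<Sum>i\<in>I'. c i * F' i y)" for y
      proof -
        have "(\<Sum>i\<in>I'. d i * F i y) = (\<Sum>i\<in>I'. c i * F i y)"
          by (rule sum.cong) (use I in \<open>auto simp: d_def\<close>)
        then show ?thesis using I
          by (simp add: d_def F'_def algebra_simps sum_subtractf sum_distrib_left sum_distrib_right)
      qed
      have "\<forall>i\<in>I. d i = 0"
      proof (rule insert.prems(2))
        fix y assume "y \<in> insert x D"
        then show "(\<Sum>i\<in>I. d i * F i y) = 0"
          unfolding d using c j by (auto simp: F'_def)
      qed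
      then show "\<forall>i\<in>I'. c i = 0" using I by (metis d_def fun_upd_other insertCI)
    qed
    then show ?thesis using insert.hyps I by simp
  qed
qed

lemma linear_relation_exists:
  fixes F :: "'i \<Rightarrow> 'x \<Rightarrow> complex"
  assumes "finite D" "finite I" "card D < card I"
  obtains c i where "i \<in> I" "c i \<noteq> 0" "\<And>x. x \<in> D \<Longrightarrow> (\<Sum>i\<in>I. c i * F i x) = 0"
proof (rule ccontr)
  assume n: "\<not> thesis"
  have "card I \<le> card D"
    by (rule independent_functions_card_le[OF assms(1,2), of F]) (use n that in blast)
  then show False using assms(3) by simp
qed

section \<open>Irreducible representations and Schur's lemma\<close>

abbreviation GL :: "nat \<Rightarrow> complex mat monoid" where
  "GL n \<equiv> units_of (ring_mat TYPE(complex) n ())"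

text \<open>Irreducibility without a topology.  It is the notion for finite quotients; for continuous
  representations continuity is added separately.\<close>

definition irrep :: "('g, 'b) monoid_scheme \<Rightarrow> nat \<Rightarrow> ('g \<Rightarrow> complex mat) \<Rightarrow> bool" where
  "irrep G n \<rho> \<longleftrightarrow> \<rho> \<in> hom G (GL n) \<and> irreducible_rep G n \<rho>"

lemma GL_simps [simp]:
  "carrier (GL n) = {A \<in> carrier_mat n n. \<exists>B\<in>carrier_mat n n. B * A = 1\<^sub>m n \<and> A * B = 1\<^sub>m n}"
  "mult (GL n) = (*)" "one (GL n) = 1\<^sub>m n"
  by (auto simp: units_of_def Units_def ring_mat_def)

lemma Units_ring_mat:
  "Units (ring_mat TYPE(complex) n ()) =
    {A \<in> carrier_mat n n. \<exists>B\<in>carrier_mat n n. B * A = 1\<^sub>m n \<and> A * B = 1\<^sub>m n}"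
  by (auto simp: Units_def ring_mat_def)

lemma subspace_vec_iff:
  "VectorSpace.subspace class_ring W (module_vec TYPE(complex) n) \<longleftrightarrow>
     W \<subseteq> carrier_vec n \<and> 0\<^sub>v n \<in> W \<and> (\<forall>v\<in>W. \<forall>w\<in>W. v + w \<in> W) \<and> (\<forall>c. \<forall>v\<in>W. c \<cdot>\<^sub>v v \<in> W)"
proof -
  interpret vec_space "TYPE(complex)" n .
  have "vectorspace class_ring (module_vec TYPE(complex) n)" "Module.module class_ring (module_vec TYPE(complex) n)"
    by unfold_locales
  then show ?thesis
    by (auto simp: VectorSpace.subspace_def submodule_def module_vec_def)
qed

lemma group_GL: "Group.group (GL n)"
proof -
  interpret semiring "ring_mat TYPE(complex) n ()" by (rule semiring_mat)
  show ?thesis by (rule units_group)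
qed

lemma rep_carrier: "\<rho> \<in> hom G (GL n) \<Longrightarrow> g \<in> carrier G \<Longrightarrow> \<rho> g \<in> carrier_mat n n"
  by (auto simp: hom_def Pi_def)

lemma rep_mult: "\<rho> \<in> hom G (GL n) \<Longrightarrow> g \<in> carrier G \<Longrightarrow> h \<in> carrier G \<Longrightarrow>
    \<rho> (g \<otimes>\<^bsub>G\<^esub> h) = \<rho> g * \<rho> h"
  by (auto simp: hom_def)

lemma rep_one: "Group.group G \<Longrightarrow> \<rho> \<in> hom G (GL n) \<Longrightarrow> \<rho> \<one>\<^bsub>G\<^esub> = 1\<^sub>m n"
  using hom_one[of \<rho> G "GL n"] group_GL by simp

lemma isomorphic_repsI:
  assumes "P \<in> carrier_mat n n" "Determinant.det P \<noteq> 0"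
    "\<And>g. g \<in> carrier G \<Longrightarrow> P * \<rho> g = \<sigma> g * P"
  shows "isomorphic_reps G n \<rho> \<sigma>"
  unfolding isomorphic_reps_def
  by (rule bexI[of _ P]) (use assms(3) det_non_zero_imp_unit[OF assms(1,2)] in simp_all)

lemma mat_eq_zeroI:
  fixes T :: "complex mat"
  assumes "T \<in> carrier_mat m n" "\<And>v. v \<in> carrier_vec n \<Longrightarrow> T *\<^sub>v v = 0\<^sub>v m"
  shows "T = 0\<^sub>m m n" 
proof (rule eq_matI)
  fix i j assume ij: "i < dim_row (0\<^sub>m m n)" "j < dim_col (0\<^sub>m m n)"
  then have "(T *\<^sub>v unit_vec n j) $ i = 0\<^sub>v m $ i" using assms by simp
  then show "T $$ (i, j) = 0\<^sub>m m n $$ (i, j)" using ij assms(1) by simp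
qed (use assms in auto)

lemma smult_mat_vec:
  assumes "T \<in> carrier_mat m n" "v \<in> carrier_vec n"
  shows "T *\<^sub>v (c \<cdot>\<^sub>v v) = (c::complex) \<cdot>\<^sub>v (T *\<^sub>v v)"
  using mult_mat_vec[OF assms] .

text \<open>The kernel of an intertwiner is an invariant subspace of its source.\<close>

lemma intertwiner_zero_or_injective:
  fixes T :: "complex mat"
  assumes T: "T \<in> carrier_mat m n" and \<rho>: "irrep G n \<rho>" and \<sigma>: "\<sigma> \<in> hom G (GL m)"
    and int: "\<And>g. g \<in> carrier G \<Longrightarrow> T * \<rho> g = \<sigma> g * T"
  shows "T = 0\<^sub>m m n \<or> (\<forall>v\<in>carrier_vec n. T *\<^sub>v v = 0\<^sub>v m \<longrightarrow> v = 0\<^sub>v n)"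
proof -
  have h: "\<rho> \<in> hom G (GL n)" and irr: "irreducible_rep G n \<rho>" using \<rho> by (auto simp: irrep_def)
  define W where "W = {v\<in>carrier_vec n. T *\<^sub>v v = 0\<^sub>v m}"
  have "VectorSpace.subspace class_ring W (module_vec TYPE(complex) n)"
    unfolding subspace_vec_iff using T
    by (auto simp: W_def mult_add_distrib_mat_vec smult_mat_vec)
  moreover have "\<rho> g *\<^sub>v w \<in> W" if g: "g \<in> carrier G" and w: "w \<in> W" for g w
  proof -
    have "T *\<^sub>v (\<rho> g *\<^sub>v w) = (T * \<rho> g) *\<^sub>v w"
      using T w rep_carrier[OF h g] by (auto simp: W_def intro!: assoc_mult_mat_vec[symmetric])
    also have "\<dots> = \<sigma> g *\<^sub>v (T *\<^sub>v w)"
      unfolding int[OF g] using T w rep_carrier[OF \<sigma> g]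
      by (auto simp: W_def intro!: assoc_mult_mat_vec)
    also have "\<dots> = 0\<^sub>v m" using w rep_carrier[OF \<sigma> g] by (auto simp: W_def)
    finally show ?thesis using w rep_carrier[OF h g] by (auto simp: W_def)
  qed
  ultimately have "W = {0\<^sub>v n} \<or> W = carrier_vec n" using irr unfolding irreducible_rep_def by blast
  then show ?thesis
  proof
    assume "W = {0\<^sub>v n}" then show ?thesis by (auto simp: W_def)
  next
    assume "W = carrier_vec n"
    then have "T = 0\<^sub>m m n" by (intro mat_eq_zeroI[OF T]) (auto simp: W_def)
    then show ?thesis ..
  qed
qed

text \<open>The image of an intertwiner is an invariant subspace of its target.\<close>

lemma intertwiner_zero_or_surjective:
  fixes T :: "complex mat"
  assumes T: "T \<in> carrier_mat m n" and \<rho>: "\<rho> \<in> hom G (GL n)" and \<sigma>: "irrep G m \<sigma>"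
    and int: "\<And>g. g \<in> carrier G \<Longrightarrow> T * \<rho> g = \<sigma> g * T"
  shows "T = 0\<^sub>m m n \<or> (\<forall>w\<in>carrier_vec m. \<exists>v\<in>carrier_vec n. T *\<^sub>v v = w)"
proof -
  have h: "\<sigma> \<in> hom G (GL m)" and irr: "irreducible_rep G m \<sigma>" using \<sigma> by (auto simp: irrep_def)
  define W where "W = {T *\<^sub>v v | v. v \<in> carrier_vec n}"
  have "VectorSpace.subspace class_ring W (module_vec TYPE(complex) m)"
    unfolding subspace_vec_iff
  proof (intro conjI ballI allI)
    show "W \<subseteq> carrier_vec m" using T by (auto simp: W_def)
    show "0\<^sub>v m \<in> W" using T by (auto simp: W_def intro!: exI[of _ "0\<^sub>v n"])
  next
    fix v w assume "v \<in> W" "w \<in> W"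
    then obtain a b where "a \<in> carrier_vec n" "b \<in> carrier_vec n" "v = T *\<^sub>v a" "w = T *\<^sub>v b" 
      by (auto simp: W_def)
    then show "v + w \<in> W" using T by (auto simp: W_def mult_add_distrib_mat_vec intro!: exI[of _ "a+b"])
  next
    fix c v assume "v \<in> W"
    then obtain a where "a \<in> carrier_vec n" "v = T *\<^sub>v a" by (auto simp: W_def)
    then show "c \<cdot>\<^sub>v v \<in> W" using T by (auto simp: W_def smult_mat_vec intro!: exI[of _ "c \<cdot>\<^sub>v a"])
  qed
  moreover have "\<sigma> g *\<^sub>v w \<in> W" if g: "g \<in> carrier G" and w: "w \<in> W" for g w
  proof -
    obtain a where a: "a \<in> carrier_vec n" "w = T *\<^sub>v a" using w by (auto simp: W_def)
    have "\<sigma> g *\<^sub>v (T *\<^sub>v a) = (\<sigma> g * T) *\<^sub>v a"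
      using T a rep_carrier[OF h g] by (auto intro!: assoc_mult_mat_vec[symmetric])
    also have "\<dots> = T *\<^sub>v (\<rho> g *\<^sub>v a)"
      unfolding int[OF g, symmetric] using T a rep_carrier[OF \<rho> g]
      by (auto intro!: assoc_mult_mat_vec)
    finally show ?thesis using a rep_carrier[OF \<rho> g] by (auto simp: W_def)
  qed
  ultimately have "W = {0\<^sub>v m} \<or> W = carrier_vec m" using irr unfolding irreducible_rep_def by blast
  then show ?thesis
  proof
    assume "W = {0\<^sub>v m}"
    then have "T = 0\<^sub>m m n" by (intro mat_eq_zeroI[OF T]) (auto simp: W_def)
    then show ?thesis ..
  next
    assume W: "W = carrier_vec m"
    have "\<exists>v\<in>carrier_vec n. T *\<^sub>v v = w" if "w \<in> carrier_vec m" for w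
      using that unfolding W[symmetric] by (auto simp: W_def)
    then show ?thesis by blast
  qed
qed

lemma injective_mat_le:
  fixes T :: "complex mat"
  assumes T: "T \<in> carrier_mat m n" and "\<And>v. v \<in> carrier_vec n \<Longrightarrow> T *\<^sub>v v = 0\<^sub>v m \<Longrightarrow> v = 0\<^sub>v n"
  shows "n \<le> m"
proof -
  have "card {..<n} \<le> card {..<m}"
  proof (rule independent_functions_card_le[where F = "\<lambda>i x. T $$ (x, i)"])
    fix c assume c: "\<And>x. x \<in> {..<m} \<Longrightarrow> (\<Sum>i<n. c i * T $$ (x, i)) = 0"
    have "T *\<^sub>v vec n c = 0\<^sub>v m"
      by (rule eq_vecI) (use T c in \<open>auto simp: scalar_prod_def mult.commute atLeast0LessThan\<close>)
    then have "vec n c = 0\<^sub>v n" using assms(2) by auto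
    then show "\<forall>i\<in>{..<n}. c i = 0" by (metis index_vec index_zero_vec(1) lessThan_iff)
  qed auto
  then show ?thesis by simp
qed

lemma surjective_mat_ge:
  fixes T :: "complex mat"
  assumes T: "T \<in> carrier_mat m n" and "\<And>w. w \<in> carrier_vec m \<Longrightarrow> \<exists>v\<in>carrier_vec n. T *\<^sub>v v = w"
  shows "m \<le> n"
proof (rule injective_mat_le[of "T\<^sup>T"])
  fix y assume y: "y \<in> carrier_vec m" and z: "T\<^sup>T *\<^sub>v y = 0\<^sub>v n"
  show "y = 0\<^sub>v m"
  proof (rule eq_vecI)
    fix i assume "i < dim_vec (0\<^sub>v m)"
    then have i: "i < m" by simp
    obtain v where v: "v \<in> carrier_vec n" "T *\<^sub>v v = unit_vec m i" using assms(2)[of "unit_vec m i"] by auto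
    have "y $ i = y \<bullet> (T *\<^sub>v v)" using v y i by simp
    also have "\<dots> = (T\<^sup>T *\<^sub>v y) \<bullet> v"
      using transpose_vec_mult_scalar[OF T v(1) y] by simp
    also have "\<dots> = 0" using z v by simp
    finally show "y $ i = 0\<^sub>v m $ i" using i by simp
  qed (use y in auto)
qed (use T in auto)

lemma Schur_distinct:
  fixes T :: "complex mat"
  assumes T: "T \<in> carrier_mat m n" and \<rho>: "irrep G n \<rho>" and \<sigma>: "irrep G m \<sigma>"
    and int: "\<And>g. g \<in> carrier G \<Longrightarrow> T * \<rho> g = \<sigma> g * T"
    and non: "\<not> (n = m \<and> isomorphic_reps G n \<rho> \<sigma>)"
  shows "T = 0\<^sub>m m n"
proof (rule ccontr)
  assume "T \<noteq> 0\<^sub>m m n"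
  then have inj: "\<And>v. v\<in>carrier_vec n \<Longrightarrow> T *\<^sub>v v = 0\<^sub>v m \<Longrightarrow> v = 0\<^sub>v n"
    and surj: "\<And>w. w\<in>carrier_vec m \<Longrightarrow> \<exists>v\<in>carrier_vec n. T *\<^sub>v v = w"
    using intertwiner_zero_or_injective[OF T \<rho> _ int] intertwiner_zero_or_surjective[OF T _ \<sigma> int] \<rho> \<sigma> by (auto simp: irrep_def)
  have nm: "n = m" using injective_mat_le[OF T inj] surjective_mat_ge[OF T surj] by simp
  then have "Determinant.det T \<noteq> 0" using T inj det_0_iff_vec_prod_zero_field[of T n] by auto
  then have "isomorphic_reps G n \<rho> \<sigma>" using T nm int by (intro isomorphic_repsI[of T]) auto
  then show False using nm non by simp
qed

text \<open>Subtracting an eigenvalue from \<open>T\<close> leaves an intertwiner that is not injective and hence zero.\<close>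

lemma Schur_same:
  fixes T :: "complex mat"
  assumes T: "T \<in> carrier_mat n n" and \<rho>: "irrep G n \<rho>"
    and int: "\<And>g. g \<in> carrier G \<Longrightarrow> T * \<rho> g = \<rho> g * T"
  obtains c where "T = c \<cdot>\<^sub>m 1\<^sub>m n"
proof -
  have n: "n > 0" and h: "\<rho> \<in> hom G (GL n)" using \<rho> by (auto simp: irrep_def irreducible_rep_def)
  obtain c where "eigenvalue T c" using spectrum_non_empty[OF T n] by (auto simp: spectrum_def)
  then obtain v where v: "v \<in> carrier_vec n" "v \<noteq> 0\<^sub>v n" "T *\<^sub>v v = c \<cdot>\<^sub>v v"
    using T by (auto simp: eigenvalue_def eigenvector_def)
  define S where "S = T - c \<cdot>\<^sub>m 1\<^sub>m n"
  have S: "S \<in> carrier_mat n n" using T by (auto simp: S_def)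
  have "S * \<rho> g = \<rho> g * S" if g: "g \<in> carrier G" for g
  proof -
    have r: "\<rho> g \<in> carrier_mat n n" by (rule rep_carrier[OF h g])
    have "c \<cdot>\<^sub>m 1\<^sub>m n * \<rho> g = \<rho> g * (c \<cdot>\<^sub>m 1\<^sub>m n)"
      using r mult_smult_assoc_mat[of "1\<^sub>m n" n n "\<rho> g" n c] mult_smult_distrib[OF r, of "1\<^sub>m n" n c]
      by simp
    then show ?thesis
      unfolding S_def using T r int[OF g]
      by (simp add: minus_mult_distrib_mat[OF T _ r] mult_minus_distrib_mat[OF r T])
  qed
  moreover have "S *\<^sub>v v = 0\<^sub>v n"
  proof -
    have "(c \<cdot>\<^sub>m 1\<^sub>m n) *\<^sub>v v = c \<cdot>\<^sub>v v"
      using v by (intro eq_vecI) auto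
    then show ?thesis
      unfolding S_def using T v by (simp add: minus_mult_distrib_mat_vec[OF T])
  qed
  ultimately have "S = 0\<^sub>m n n" using intertwiner_zero_or_injective[OF S \<rho> h] v by blast
  then have "T = c \<cdot>\<^sub>m 1\<^sub>m n"
    unfolding S_def using T by (auto simp: mat_eq_iff)
  then show thesis by (rule that)
qed

section \<open>Orthogonality relations\<close>

lemma rep_mult_entry:
  assumes "\<rho> \<in> hom G (GL n)" "g \<in> carrier G" "h \<in> carrier G" "i < n" "j < n"
  shows "\<rho> (g \<otimes>\<^bsub>G\<^esub> h) $$ (i, j) = (\<Sum>l<n. \<rho> g $$ (i, l) * \<rho> h $$ (l, j))"
  using rep_carrier[OF assms(1,2)] rep_carrier[OF assms(1,3)] rep_mult[OF assms(1-3)] assms(4,5)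
  by (simp add: scalar_prod_def atLeast0LessThan)

lemma isomorphic_reps_sym:
  assumes "\<rho> \<in> hom G (GL n)" "\<sigma> \<in> hom G (GL n)" "isomorphic_reps G n \<rho> \<sigma>"
  shows "isomorphic_reps G n \<sigma> \<rho>"
proof -
  obtain P Q where P: "P \<in> carrier_mat n n" "Q \<in> carrier_mat n n" "Q * P = 1\<^sub>m n" "P * Q = 1\<^sub>m n"
    "\<And>g. g \<in> carrier G \<Longrightarrow> P * \<rho> g = \<sigma> g * P"
    using assms(3) unfolding isomorphic_reps_def Units_ring_mat by blast
  have "Q * \<sigma> g = \<rho> g * Q" if g: "g \<in> carrier G" for g
  proof -
    note c = P(1,2) rep_carrier[OF assms(1) g] rep_carrier[OF assms(2) g]
    have "Q * \<sigma> g = Q * (\<sigma> g * (P * Q))" using c P(4) by simp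
    also have "\<dots> = Q * ((\<sigma> g * P) * Q)" using assoc_mult_mat[OF c(4) c(1) c(2)] by simp
    also have "\<dots> = Q * (P * (\<rho> g * Q))" using assoc_mult_mat[OF c(1) c(3) c(2)] P(5)[OF g] by simp
    also have "\<dots> = (Q * P) * (\<rho> g * Q)"
      using assoc_mult_mat[OF c(2) c(1) mult_carrier_mat[OF c(3) c(2)]] by simp
    also have "\<dots> = \<rho> g * Q" using c P(3) by simp
    finally show ?thesis .
  qed
  then show ?thesis
    unfolding isomorphic_reps_def Units_ring_mat using P(1-4) by blast
qed

definition character :: "nat \<Rightarrow> ('g \<Rightarrow> complex mat) \<Rightarrow> 'g \<Rightarrow> complex" where
  "character n \<rho> g = (\<Sum>i<n. \<rho> g $$ (i, i))"

text \<open>Representations of different dimensions occur together, so a representation is stored with its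
  dimension.  Finite sets of this kind replace sets of isomorphism classes: they support sums
  without a choice of representatives.\<close>

definition noniso :: "('g, 'b) monoid_scheme \<Rightarrow> (nat \<times> ('g \<Rightarrow> complex mat)) set \<Rightarrow> bool" where
  "noniso G R \<longleftrightarrow> (\<forall>(n, \<rho>)\<in>R. irrep G n \<rho>) \<and>
    (\<forall>(n, \<rho>)\<in>R. \<forall>(m, \<sigma>)\<in>R. (n, \<rho>) \<noteq> (m, \<sigma>) \<longrightarrow> \<not> (n = m \<and> isomorphic_reps G n \<rho> \<sigma>))"

locale finite_group = Group.group G for G (structure) +
  assumes finite_carrier [simp]: "finite (carrier G)"
begin

definition conj_class :: "'a \<Rightarrow> 'a set" where
  "conj_class g = {h \<otimes> g \<otimes> inv h | h. h \<in> carrier G}"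

definition conj_classes :: "'a set set" where
  "conj_classes = conj_class ` carrier G"

lemma sum_left_translate:
  assumes "h \<in> carrier G"
  shows "(\<Sum>g\<in>carrier G. f (h \<otimes> g)) = (\<Sum>g\<in>carrier G. f g)"
proof (rule sum.reindex_bij_betw)
  show "bij_betw ((\<otimes>) h) (carrier G) (carrier G)"
    by (rule bij_betwI[where g = "(\<otimes>) (inv h)"]) (use assms in \<open>auto simp flip: m_assoc\<close>)
qed

lemma sum_right_translate:
  assumes "h \<in> carrier G"
  shows "(\<Sum>g\<in>carrier G. f (g \<otimes> h)) = (\<Sum>g\<in>carrier G. f g)"
proof (rule sum.reindex_bij_betw)
  show "bij_betw (\<lambda>g. g \<otimes> h) (carrier G) (carrier G)"
    by (rule bij_betwI[where g = "\<lambda>g. g \<otimes> inv h"]) (use assms in \<open>auto simp: m_assoc\<close>)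
qed

text \<open>This is the average of \<open>\<sigma>(g) E \<rho>(g\<^sup>-\<^sup>1)\<close> over the group, where \<open>E\<close> is the matrix unit at
  \<open>(a, b)\<close>; translating the summation variable by \<open>h\<close> gives the intertwining property.  With Schur's lemma it
  yields the orthogonality relations for matrix coefficients.\<close>

lemma averaged_intertwiner:
  assumes \<rho>: "\<rho> \<in> hom G (GL n)" and \<sigma>: "\<sigma> \<in> hom G (GL m)" and ab: "a < m" "b < n"
    and h: "h \<in> carrier G"
  defines "T \<equiv> Matrix.mat m n (\<lambda>(i, j). \<Sum>g\<in>carrier G. \<sigma> g $$ (i, a) * \<rho> (inv g) $$ (b, j))"
  shows "T * \<rho> h = \<sigma> h * T"
proof (rule eq_matI)
  note c = rep_carrier[OF \<rho> h] rep_carrier[OF \<sigma> h]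
  fix i j assume "i < dim_row (\<sigma> h * T)" "j < dim_col (\<sigma> h * T)"
  then have ij: "i < m" "j < n" using c by (auto simp: T_def)
  have "(T * \<rho> h) $$ (i, j) = (\<Sum>l<n. (\<Sum>g\<in>carrier G. \<sigma> g $$ (i, a) * \<rho> (inv g) $$ (b, l)) * \<rho> h $$ (l, j))"
    using ij c by (simp add: T_def scalar_prod_def atLeast0LessThan)
  also have "\<dots> = (\<Sum>l<n. \<Sum>g\<in>carrier G. \<sigma> g $$ (i, a) * (\<rho> (inv g) $$ (b, l) * \<rho> h $$ (l, j)))"
    by (simp add: sum_distrib_right mult.assoc)
  also have "\<dots> = (\<Sum>g\<in>carrier G. \<sigma> g $$ (i, a) * (\<Sum>l<n. \<rho> (inv g) $$ (b, l) * \<rho> h $$ (l, j)))"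
    by (subst sum.swap) (simp add: sum_distrib_left)
  also have "\<dots> = (\<Sum>g\<in>carrier G. \<sigma> g $$ (i, a) * \<rho> (inv g \<otimes> h) $$ (b, j))"
    by (rule sum.cong) (use rep_mult_entry[OF \<rho>] h ij ab in auto)
  also have "\<dots> = (\<Sum>g\<in>carrier G. \<sigma> (h \<otimes> g) $$ (i, a) * \<rho> (inv (h \<otimes> g) \<otimes> h) $$ (b, j))"
    by (subst sum_left_translate[OF h, symmetric]) simp
  also have "\<dots> = (\<Sum>g\<in>carrier G. (\<Sum>l<m. \<sigma> h $$ (i, l) * \<sigma> g $$ (l, a)) * \<rho> (inv g) $$ (b, j))"
    by (rule sum.cong) (use rep_mult_entry[OF \<sigma>] h ij ab in \<open>auto simp: inv_mult_group m_assoc\<close>)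
  also have "\<dots> = (\<Sum>g\<in>carrier G. \<Sum>l<m. \<sigma> h $$ (i, l) * (\<sigma> g $$ (l, a) * \<rho> (inv g) $$ (b, j)))"
    by (simp add: sum_distrib_right mult.assoc)
  also have "\<dots> = (\<Sum>l<m. \<sigma> h $$ (i, l) * (\<Sum>g\<in>carrier G. \<sigma> g $$ (l, a) * \<rho> (inv g) $$ (b, j)))"
    by (subst sum.swap) (simp add: sum_distrib_left)
  also have "\<dots> = (\<sigma> h * T) $$ (i, j)"
    using ij c by (simp add: T_def scalar_prod_def atLeast0LessThan)
  finally show "(T * \<rho> h) $$ (i, j) = (\<sigma> h * T) $$ (i, j)" .
qed (use rep_carrier[OF \<rho> h] rep_carrier[OF \<sigma> h] in \<open>auto simp: T_def\<close>)

lemma orthogonality_distinct: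
  assumes \<rho>: "irrep G n \<rho>" and \<sigma>: "irrep G m \<sigma>"
    and non: "\<not> (n = m \<and> isomorphic_reps G n \<rho> \<sigma>)"
    and b: "i < m" "a < m" "b < n" "j < n"
  shows "(\<Sum>g\<in>carrier G. \<sigma> g $$ (i, a) * \<rho> (inv g) $$ (b, j)) = 0"
proof -
  define T where "T = Matrix.mat m n (\<lambda>(i, j). \<Sum>g\<in>carrier G. \<sigma> g $$ (i, a) * \<rho> (inv g) $$ (b, j))"
  have "T * \<rho> h = \<sigma> h * T" if "h \<in> carrier G" for h
    unfolding T_def by (rule averaged_intertwiner) (use \<rho> \<sigma> that b in \<open>auto simp: irrep_def\<close>)
  then have "T = 0\<^sub>m m n"
    by (intro Schur_distinct[OF _ \<rho> \<sigma> _ non]) (auto simp: T_def)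
  then have "T $$ (i, j) = 0" using b by simp
  then show ?thesis using b by (simp add: T_def)
qed

lemma orthogonality_same:
  assumes \<rho>: "irrep G n \<rho>" and b: "i < n" "a < n" "b < n" "j < n"
  shows "(\<Sum>g\<in>carrier G. \<rho> g $$ (i, a) * \<rho> (inv g) $$ (b, j)) =
    (if i = j \<and> a = b then of_nat (order G) / of_nat n else 0)"
proof -
  have h: "\<rho> \<in> hom G (GL n)" using \<rho> by (auto simp: irrep_def)
  define T where "T = Matrix.mat n n (\<lambda>(i, j). \<Sum>g\<in>carrier G. \<rho> g $$ (i, a) * \<rho> (inv g) $$ (b, j))"
  have "T * \<rho> h = \<rho> h * T" if "h \<in> carrier G" for h
    unfolding T_def by (rule averaged_intertwiner) (use \<rho> that b in \<open>auto simp: irrep_def\<close>)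
  then obtain c where c: "T = c \<cdot>\<^sub>m 1\<^sub>m n"
    using Schur_same[OF _ \<rho>, of T] by (auto simp: T_def)
  have e: "(\<Sum>g\<in>carrier G. \<rho> g $$ (i, a) * \<rho> (inv g) $$ (b, j)) = (if i = j then c else 0)"
    if "i < n" "j < n" for i j
  proof -
    have "T $$ (i, j) = (if i = j then c else 0)" using that c by auto
    then show ?thesis using that by (simp add: T_def)
  qed
  have "of_nat n * c = (\<Sum>i<n. \<Sum>g\<in>carrier G. \<rho> g $$ (i, a) * \<rho> (inv g) $$ (b, i))"
    using e by simp
  also have "\<dots> = (\<Sum>g\<in>carrier G. \<Sum>i<n. \<rho> (inv g) $$ (b, i) * \<rho> g $$ (i, a))"
    by (subst sum.swap) (simp add: mult.commute)
  also have "\<dots> = (\<Sum>g\<in>carrier G. \<rho> (inv g \<otimes> g) $$ (b, a))"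
  proof (rule sum.cong[OF refl])
    fix g assume g: "g \<in> carrier G"
    show "(\<Sum>i<n. \<rho> (inv g) $$ (b, i) * \<rho> g $$ (i, a)) = \<rho> (inv g \<otimes> g) $$ (b, a)"
      using rep_mult_entry[OF h _ g, of "inv g" b a] g b by (simp del: l_inv)
  qed
  also have "\<dots> = (if a = b then of_nat (order G) else 0)"
    using b rep_one[OF is_group h] by (auto simp: order_def)
  finally have "c = (if a = b then of_nat (order G) / of_nat n else 0)"
    using b by (auto simp: field_simps split: if_splits)
  then show ?thesis using e b by auto
qed

lemma order_pos: "order G > 0"
  using finite_carrier one_closed by (auto simp: order_def card_gt_0_iff)

text \<open>Pairing a linear relation with the coefficient \<open>(b, j)\<close> of \<open>s\<close> at inverse elements isolates
  one term, by orthogonality.\<close>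

lemma coefficients_independent:
  assumes R: "noniso G R" "finite R"
    and z: "\<And>g. g \<in> carrier G \<Longrightarrow>
      (\<Sum>(r, i, a)\<in>Sigma R (\<lambda>r. {..<fst r} \<times> {..<fst r}). c r i a * snd r g $$ (i, a)) = 0"
    and s: "s \<in> R" "j < fst s" "b < fst s"
  shows "c s j b = 0"
proof -
  let ?I = "Sigma R (\<lambda>r. {..<fst r} \<times> {..<fst r})"
  have irr: "irrep G (fst r) (snd r)" if "r \<in> R" for r
    using R that by (auto simp: noniso_def)
  have fin: "finite ?I" using R by auto
  have n: "fst s > 0" using s by auto
  have orth: "(\<Sum>g\<in>carrier G. snd r g $$ (i, a) * snd s (inv g) $$ (b, j)) =
     (if (r, i, a) = (s, j, b) then of_nat (order G) / of_nat (fst s) else 0)"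
    if "(r, i, a) \<in> ?I" for r i a
  proof (cases "r = s")
    case True
    then show ?thesis using orthogonality_same[OF irr[OF s(1)]] s that by auto
  next
    case False
    have "\<not> (fst s = fst r \<and> isomorphic_reps G (fst s) (snd s) (snd r))"
      using R(1) s that False unfolding noniso_def by (cases s; cases r) fastforce
    from orthogonality_distinct[OF irr[OF s(1)] irr this, of i a b j] show ?thesis
      using that s False by auto
  qed
  have "0 = (\<Sum>g\<in>carrier G. (\<Sum>(r, i, a)\<in>?I. c r i a * snd r g $$ (i, a)) * snd s (inv g) $$ (b, j))"
    using z by simp
  also have "\<dots> = (\<Sum>g\<in>carrier G. \<Sum>(r, i, a)\<in>?I. c r i a * (snd r g $$ (i, a) * snd s (inv g) $$ (b, j)))"
    by (simp add: sum_distrib_right mult.assoc case_prod_unfold)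
  also have "\<dots> = (\<Sum>(r, i, a)\<in>?I. c r i a * (\<Sum>g\<in>carrier G. snd r g $$ (i, a) * snd s (inv g) $$ (b, j)))"
    by (subst sum.swap) (simp add: sum_distrib_left case_prod_unfold)
  also have "\<dots> = (\<Sum>x\<in>?I. if x = (s, j, b) then c s j b * (of_nat (order G) / of_nat (fst s)) else 0)"
    by (rule sum.cong) (use orth in \<open>auto split: if_splits\<close>)
  also have "\<dots> = c s j b * (of_nat (order G) / of_nat (fst s))"
    using fin s by simp
  finally show ?thesis using n order_pos by simp
qed

lemma sum_squares_le:
  assumes R: "noniso G R" "finite R"
  shows "(\<Sum>r\<in>R. fst r ^ 2) \<le> order G"
proof -
  let ?I = "Sigma R (\<lambda>r. {..<fst r} \<times> {..<fst r})"
  have "card ?I \<le> card (carrier G)"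
  proof (rule independent_functions_card_le[where F = "\<lambda>(r, i, a) g. snd r g $$ (i, a)"])
    fix c assume c: "\<And>g. g \<in> carrier G \<Longrightarrow> (\<Sum>i\<in>?I. c i * (case i of (r, i, a) \<Rightarrow> \<lambda>g. snd r g $$ (i, a)) g) = 0"
    show "\<forall>i\<in>?I. c i = 0"
    proof
      fix x assume "x \<in> ?I"
      moreover obtain s j b where x: "x = (s, j, b)" by (cases x)
      ultimately have "s \<in> R" "j < fst s" "b < fst s" by auto
      then show "c x = 0" unfolding x
        by (rule coefficients_independent[OF R, rotated, of s j b "\<lambda>r i a. c (r, i, a)"])
          (use c in \<open>simp add: case_prod_unfold\<close>)
    qed
  qed (use R in auto)
  moreover have "card ?I = (\<Sum>r\<in>R. fst r ^ 2)"
    using R by (simp add: power2_eq_square)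
  ultimately show ?thesis by (simp add: order_def)
qed

lemma character_conj:
  assumes \<rho>: "\<rho> \<in> hom G (GL n)" and g: "g \<in> carrier G" and h: "h \<in> carrier G"
  shows "character n \<rho> (h \<otimes> g \<otimes> inv h) = character n \<rho> g"
proof -
  have "character n \<rho> (h \<otimes> g \<otimes> inv h) = (\<Sum>i<n. \<Sum>l<n. \<rho> (h \<otimes> g) $$ (i, l) * \<rho> (inv h) $$ (l, i))"
    unfolding character_def using rep_mult_entry[OF \<rho>] g h by simp
  also have "\<dots> = (\<Sum>l<n. \<Sum>i<n. \<rho> (inv h) $$ (l, i) * \<rho> (h \<otimes> g) $$ (i, l))"
    by (subst sum.swap) (simp add: mult.commute)
  also have "\<dots> = (\<Sum>l<n. \<rho> (inv h \<otimes> (h \<otimes> g)) $$ (l, l))"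
    using rep_mult_entry[OF \<rho>, of "inv h" "h \<otimes> g"] g h by simp
  also have "inv h \<otimes> (h \<otimes> g) = g" using g h by (simp flip: m_assoc)
  finally show ?thesis by (simp add: character_def)
qed

lemma conj_class_self: "g \<in> carrier G \<Longrightarrow> g \<in> conj_class g"
  by (auto simp: conj_class_def intro!: exI[of _ \<one>])

lemma conj_class_eq:
  assumes g: "g \<in> carrier G" and x: "x \<in> conj_class g"
  shows "conj_class x = conj_class g"
proof -
  obtain h where h: "h \<in> carrier G" "x = h \<otimes> g \<otimes> inv h" using x by (auto simp: conj_class_def)
  have g': "g = inv h \<otimes> x \<otimes> h" using h g by (simp add: m_assoc inv_solve_left)
  have xc: "x \<in> carrier G" using h g by simp
  have "\<exists>k'\<in>carrier G. k \<otimes> x \<otimes> inv k = k' \<otimes> g \<otimes> inv k'" if "k \<in> carrier G" for k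
    by (rule bexI[of _ "k \<otimes> h"]) (use that h g in \<open>simp_all add: m_assoc inv_mult_group\<close>)
  moreover have "\<exists>k'\<in>carrier G. k \<otimes> g \<otimes> inv k = k' \<otimes> x \<otimes> inv k'" if "k \<in> carrier G" for k
    by (rule bexI[of _ "k \<otimes> inv h"]) (use that h(1) xc in \<open>simp_all add: g' m_assoc inv_mult_group\<close>)
  ultimately show ?thesis by (auto simp: conj_class_def)
qed

lemma finite_conj_classes [simp]: "finite conj_classes"
  by (simp add: conj_classes_def)

text \<open>Characters are class functions, and they are linearly independent because they are sums of
  distinct matrix coefficients.\<close>

lemma card_noniso_le:
  assumes R: "noniso G R" "finite R"
  shows "card R \<le> card conj_classes"
proof -
  have irr: "irrep G (fst r) (snd r)" if "r \<in> R" for r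
    using R that by (auto simp: noniso_def)
  define rp where "rp C = (SOME g. g \<in> C \<and> g \<in> carrier G)" for C :: "'a set"
  show ?thesis
  proof (rule independent_functions_card_le[where F = "\<lambda>r C. character (fst r) (snd r) (rp C)"])
    fix c assume c: "\<And>C. C \<in> conj_classes \<Longrightarrow> (\<Sum>r\<in>R. c r * character (fst r) (snd r) (rp C)) = 0"
    have z: "(\<Sum>r\<in>R. c r * character (fst r) (snd r) g) = 0" if g: "g \<in> carrier G" for g
    proof -
      have "rp (conj_class g) \<in> conj_class g"
        unfolding rp_def using conj_class_self[OF g] g by (rule someI2[where a = g, OF conjI]) auto
      then obtain h where h: "h \<in> carrier G" "rp (conj_class g) = h \<otimes> g \<otimes> inv h"
        by (auto simp: conj_class_def)
      have "(\<Sum>r\<in>R. c r * character (fst r) (snd r) g) =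
            (\<Sum>r\<in>R. c r * character (fst r) (snd r) (rp (conj_class g)))"
        by (rule sum.cong) (use character_conj[OF _ g h(1)] irr h in \<open>auto simp: irrep_def\<close>)
      also have "\<dots> = 0" using c g by (simp add: conj_classes_def)
      finally show ?thesis .
    qed
    show "\<forall>r\<in>R. c r = 0"
    proof
      fix s assume s: "s \<in> R"
      have "0 < fst s" using irr[OF s] by (auto simp: irrep_def irreducible_rep_def)
      \<comment> \<open>The relation between characters is a relation between diagonal matrix coefficients.\<close>
      then have "(if (0::nat) = 0 then c s else 0) = 0"
      proof (intro coefficients_independent[OF R _ s, of "\<lambda>r i a. if i = a then c r else 0" 0 0])
        fix g assume g: "g \<in> carrier G"
        have "(\<Sum>(r, i, a)\<in>Sigma R (\<lambda>r. {..<fst r} \<times> {..<fst r}). (if i = a then c r else 0) * snd r g $$ (i, a))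
          = (\<Sum>r\<in>R. \<Sum>(i, a)\<in>{..<fst r} \<times> {..<fst r}. (if i = a then c r else 0) * snd r g $$ (i, a))"
          using R by (subst sum.Sigma[symmetric]) (auto simp: case_prod_unfold)
        also have "\<dots> = (\<Sum>r\<in>R. c r * character (fst r) (snd r) g)"
        proof (rule sum.cong[OF refl])
          fix r
          have "(\<Sum>(i, a)\<in>{..<fst r} \<times> {..<fst r}. (if i = a then c r else 0) * snd r g $$ (i, a))
            = (\<Sum>i<fst r. \<Sum>a<fst r. if a = i then c r * snd r g $$ (i, i) else 0)"
            unfolding sum.cartesian_product[symmetric] by (intro sum.cong) auto
          also have "\<dots> = c r * character (fst r) (snd r) g"
            by (simp add: character_def sum_distrib_left)
          finally show "(\<Sum>(i, a)\<in>{..<fst r} \<times> {..<fst r}. (if i = a then c r else 0) * snd r g $$ (i, a)) = c r * character (fst r) (snd r) g" .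
        qed
        finally show "(\<Sum>(r, i, a)\<in>Sigma R (\<lambda>r. {..<fst r} \<times> {..<fst r}). (if i = a then c r else 0) * snd r g $$ (i, a)) = 0"
          using z[OF g] by simp
      qed auto
      then show "c s = 0" by simp
    qed
  qed (use R in auto)
qed

end

section \<open>Completeness of the matrix coefficients\<close>

text \<open>Families are indexed by an initial segment of the natural numbers, so that they can be
  extended by one member and compared by length.\<close>

definition independent_on :: "'x set \<Rightarrow> nat \<Rightarrow> (nat \<Rightarrow> 'x \<Rightarrow> complex) \<Rightarrow> bool" where
  "independent_on D n w \<longleftrightarrow> (\<forall>c. (\<forall>x\<in>D. (\<Sum>j<n. c j * w j x) = 0) \<longrightarrow> (\<forall>j<n. c j = 0))"

lemma independent_onI:
  assumes "\<And>c j. (\<And>x. x \<in> D \<Longrightarrow> (\<Sum>j<n. c j * w j x) = 0) \<Longrightarrow> j < n \<Longrightarrow> c j = 0"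
  shows "independent_on D n w"
  unfolding independent_on_def using assms by blast

lemma independent_onD:
  assumes "independent_on D n w" "\<And>x. x \<in> D \<Longrightarrow> (\<Sum>j<n. c j * w j x) = 0"
  shows "\<forall>j<n. c j = 0"
  using assms unfolding independent_on_def by blast

text \<open>A longest independent family exists because its length is at most \<open>card D\<close>, and it spans
  \<open>Z\<close> because no member of \<open>Z\<close> can be appended.\<close>

lemma maximal_independent_family:
  fixes Z :: "('x \<Rightarrow> complex) set"
  assumes D: "finite D"
  obtains n w where "n \<le> card D" "\<And>j. j < n \<Longrightarrow> w j \<in> Z" "independent_on D n w"
    "\<And>f. f \<in> Z \<Longrightarrow> \<exists>c. \<forall>x\<in>D. f x = (\<Sum>j<n. c j * w j x)"
proof -
  define P where "P n \<longleftrightarrow> (\<exists>w. (\<forall>j<n. w j \<in> Z) \<and> independent_on D n w)" for n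
  have bound: "n \<le> card D" if Pn: "P n" for n
  proof -
    obtain w where w: "independent_on D n w" using Pn by (auto simp: P_def)
    have "card {..<n} \<le> card D"
    proof (rule independent_functions_card_le[OF D, of _ w])
      fix c assume "\<And>x. x \<in> D \<Longrightarrow> (\<Sum>i<n. c i * w i x) = 0"
      then have "\<forall>i<n. c i = 0" by (rule independent_onD[OF w])
      then show "\<forall>i\<in>{..<n}. c i = 0" by blast
    qed simp
    then show ?thesis by simp
  qed
  define n where "n = (GREATEST n. P n)"
  have "P 0" by (simp add: P_def independent_on_def)
  then have Pn: "P n"
    unfolding n_def by (rule GreatestI_nat[of P 0 "card D"]) (rule bound)
  then obtain w where wZ: "\<And>j. j < n \<Longrightarrow> w j \<in> Z" and w: "independent_on D n w" by (auto simp: P_def)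
  have span: "\<exists>c. \<forall>x\<in>D. f x = (\<Sum>j<n. c j * w j x)" if f: "f \<in> Z" for f
  proof -
    have "\<not> P (Suc n)"
    proof
      assume "P (Suc n)"
      then have "Suc n \<le> n" unfolding n_def by (rule Greatest_le_nat[of P]) (rule bound)
      then show False by simp
    qed
    moreover have "\<forall>j<Suc n. (w(n := f)) j \<in> Z" using wZ f by (simp add: less_Suc_eq)
    ultimately have "\<not> independent_on D (Suc n) (w(n := f))" unfolding P_def by blast
    from this[unfolded independent_on_def not_all not_imp] obtain c
      where c': "\<forall>x\<in>D. (\<Sum>j<Suc n. c j * (w(n := f)) j x) = 0" and nz: "\<exists>j. j < Suc n \<and> c j \<noteq> 0"
      by blast
    have c: "(\<Sum>j<n. c j * w j x) + c n * f x = 0" if "x \<in> D" for x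
      using c'[rule_format, OF that] by simp
    have "c n \<noteq> 0"
    proof
      assume "c n = 0"
      then have "\<forall>j<n. c j = 0" using c by (intro independent_onD[OF w]) simp
      then show False using nz \<open>c n = 0\<close> by (auto simp: less_Suc_eq)
    qed
    have "f x = (\<Sum>j<n. (- 1 / c n * c j) * w j x)" if "x \<in> D" for x
    proof -
      have "f x = - 1 / c n * (- (c n * f x))" using \<open>c n \<noteq> 0\<close> by simp
      also have "- (c n * f x) = (\<Sum>j<n. c j * w j x)"
        using c[OF that] by (metis eq_neg_iff_add_eq_0)
      finally show ?thesis by (simp only: sum_distrib_left mult.assoc)
    qed
    then show ?thesis by (intro exI[of _ "\<lambda>j. - 1 / c n * c j"] ballI)
  qed
  show thesis by (rule that[OF bound[OF Pn] wZ w span])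
qed

lemma subspace_lincomb:
  fixes m :: nat
  assumes "VectorSpace.subspace class_ring W (module_vec TYPE(complex) n)"
    and "\<And>i. i < m \<Longrightarrow> b i \<in> W"
  shows "Matrix.vec n (\<lambda>x. \<Sum>i<m. c i * b i $ x) \<in> W"
  using assms(2)
proof (induction m)
  case 0
  have "Matrix.vec n (\<lambda>x. \<Sum>i<0::nat. c i * b i $ x) = 0\<^sub>v n" by (rule eq_vecI) simp_all
  moreover have "0\<^sub>v n \<in> W" using assms(1) unfolding subspace_vec_iff by blast
  ultimately show ?case by simp
next
  case (Suc m)
  have W: "W \<subseteq> carrier_vec n" "\<And>v w. v \<in> W \<Longrightarrow> w \<in> W \<Longrightarrow> v + w \<in> W" "\<And>c v. v \<in> W \<Longrightarrow> c \<cdot>\<^sub>v v \<in> W"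
    using assms(1) unfolding subspace_vec_iff by blast+
  have "b m \<in> carrier_vec n" using W Suc.prems by auto
  then have "Matrix.vec n (\<lambda>x. \<Sum>i<Suc m. c i * b i $ x) = 
     Matrix.vec n (\<lambda>x. \<Sum>i<m. c i * b i $ x) + c m \<cdot>\<^sub>v b m"
    by (intro eq_vecI) simp_all
  moreover have "Matrix.vec n (\<lambda>x. \<Sum>i<m. c i * b i $ x) \<in> W"
    by (rule Suc.IH) (simp add: Suc.prems)
  ultimately show ?case using W(2,3) Suc.prems[of m] by simp
qed

lemma subspace_basis:
  assumes W: "VectorSpace.subspace class_ring W (module_vec TYPE(complex) n)"
  obtains m b where "m \<le> n" "\<And>j. j < m \<Longrightarrow> b j \<in> W" "independent_on {..<n} m (\<lambda>j. ($) (b j))"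
    "\<And>v. v \<in> W \<Longrightarrow> \<exists>c. \<forall>x<n. v $ x = (\<Sum>j<m. c j * b j $ x)"
    "m = n \<Longrightarrow> W = carrier_vec n"
proof -
  obtain m w where w: "m \<le> card {..<n}" "\<And>j. j < m \<Longrightarrow> w j \<in> ($) ` W"
    "independent_on {..<n} m w"
    "\<And>f. f \<in> ($) ` W \<Longrightarrow> \<exists>c. \<forall>x\<in>{..<n}. f x = (\<Sum>j<m. c j * w j x)"
    by (rule maximal_independent_family[of "{..<n}" "($) ` W", OF finite_lessThan]) (rule that)
  define b where "b j = (SOME v. v \<in> W \<and> w j = ($) v)" for j
  have b: "b j \<in> W" "w j = ($) (b j)" if "j < m" for j
  proof -
    have "\<exists>v. v \<in> W \<and> w j = ($) v" using w(2)[OF that] by auto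
    then have "b j \<in> W \<and> w j = ($) (b j)" unfolding b_def by (rule someI_ex)
    then show "b j \<in> W" "w j = ($) (b j)" by auto
  qed
  have e: "(\<Sum>j<m. c j * b j $ x) = (\<Sum>j<m. c j * w j x)" for c x
    using b by simp
  have Wc: "W \<subseteq> carrier_vec n" using W unfolding subspace_vec_iff by auto
  have "v \<in> W" if mn: "m = n" and v: "v \<in> carrier_vec n" for v
  proof -
    \<comment> \<open>An independent family of length \<open>n\<close> cannot be extended by \<open>v\<close>, so \<open>v\<close> is a combination of it.\<close>
    define F where "F = w(n := ($) v)"
    have "\<not> (\<forall>c. (\<forall>x<n. (\<Sum>i<Suc n. c i * F i x) = 0) \<longrightarrow> (\<forall>i<Suc n. c i = 0))"
    proof
      assume *: "\<forall>c. (\<forall>x<n. (\<Sum>i<Suc n. c i * F i x) = 0) \<longrightarrow> (\<forall>i<Suc n. c i = 0)"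
      have "card {..<Suc n} \<le> card {..<n}"
        by (rule independent_functions_card_le[where F = F]) (use * in blast)+
      then show False by simp
    qed
    from this[unfolded not_all not_imp] obtain c
      where c': "\<forall>x<n. (\<Sum>i<Suc n. c i * F i x) = 0" and nz: "\<exists>i. i < Suc n \<and> c i \<noteq> 0"
      by blast
    have c: "(\<Sum>i<n. c i * w i x) + c n * v $ x = 0" if "x < n" for x
      using c'[rule_format, OF that] by (simp add: F_def)
    have cn: "c n \<noteq> 0"
    proof
      assume "c n = 0"
      then have "\<forall>j<m. c j = 0" using c mn by (intro independent_onD[OF w(3)]) simp
      then show False using nz \<open>c n = 0\<close> mn by (auto simp: less_Suc_eq)
    qed
    have "v = Matrix.vec n (\<lambda>x. \<Sum>i<m. (- 1 / c n * c i) * b i $ x)"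
    proof (rule eq_vecI)
      fix x assume "x < dim_vec (Matrix.vec n (\<lambda>x. \<Sum>i<m. (- 1 / c n * c i) * b i $ x))"
      then have x: "x < n" by simp
      have "v $ x = - 1 / c n * (- (c n * v $ x))" using cn by simp
      also have "- (c n * v $ x) = (\<Sum>i<n. c i * w i x)"
        using c[OF x] by (metis eq_neg_iff_add_eq_0)
      also have "(\<Sum>i<n. c i * w i x) = (\<Sum>i<m. c i * b i $ x)" by (simp only: mn[symmetric] e)
      finally have "v $ x = (\<Sum>i<m. (- 1 / c n * c i) * b i $ x)"
        by (simp only: sum_distrib_left mult.assoc)
      then show "v $ x = Matrix.vec n (\<lambda>x. \<Sum>i<m. (- 1 / c n * c i) * b i $ x) $ x"
        using x by simp
    qed (use v in auto)
    also have "\<dots> \<in> W" by (rule subspace_lincomb[OF W b(1)])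
    finally show ?thesis .
  qed
  then have "m = n \<Longrightarrow> W = carrier_vec n" using Wc by blast
  moreover have "\<exists>c. \<forall>x<n. v $ x = (\<Sum>j<m. c j * b j $ x)" if "v \<in> W" for v
    using w(4)[of "($) v"] that by (auto simp: e)
  moreover have "independent_on {..<n} m (\<lambda>j. ($) (b j))"
    using w(3) unfolding independent_on_def e .
  moreover have "m \<le> n" using w(1) by simp
  ultimately show thesis by (intro that[of m b]) (use b(1) in auto)
qed

context finite_group
begin

text \<open>Take an invariant subspace of \<open>Z\<close> of least positive dimension \<open>n\<close>, with basis \<open>w\<close>.  Right
  translation acts on it through matrices \<open>\<rho>\<close>, and minimality makes \<open>\<rho>\<close> irreducible.  Since
  \<open>w j x\<close> is the value at the neutral element of the translate of \<open>w j\<close> by \<open>x\<close>, each basis function is a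
  combination of matrix coefficients of \<open>\<rho>\<close>.\<close>

lemma invariant_functions_contain_irrep:
  fixes Z :: "('a \<Rightarrow> complex) set"
  assumes lin: "\<And>I c w. finite I \<Longrightarrow> (\<And>i. i \<in> I \<Longrightarrow> w i \<in> Z) \<Longrightarrow> (\<lambda>x. \<Sum>i\<in>(I::nat set). c i * w i x) \<in> Z"
    and inv: "\<And>f h. f \<in> Z \<Longrightarrow> h \<in> carrier G \<Longrightarrow> (\<lambda>x. f (x \<otimes> h)) \<in> Z"
    and nz: "f0 \<in> Z" "x0 \<in> carrier G" "f0 x0 \<noteq> 0"
  obtains n \<rho> w x c j where "irrep G n \<rho>" "w \<in> Z" "x \<in> carrier G" "w x \<noteq> 0" "j < n"
    "\<And>x. x \<in> carrier G \<Longrightarrow> w x = (\<Sum>i<n. c i * \<rho> x $$ (i, j))"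
proof -
  define P where "P n \<longleftrightarrow> n > 0 \<and> (\<exists>w. (\<forall>j<n. w j \<in> Z) \<and> independent_on (carrier G) n w \<and>
    (\<forall>h\<in>carrier G. \<forall>j<n. \<exists>c. \<forall>x\<in>carrier G. w j (x \<otimes> h) = (\<Sum>i<n. c i * w i x)))" for n
  obtain N and w :: "nat \<Rightarrow> 'a \<Rightarrow> complex" where "N \<le> card (carrier G)" and w: "\<And>j. j < N \<Longrightarrow> w j \<in> Z"
    "independent_on (carrier G) N w"
    "\<And>f. f \<in> Z \<Longrightarrow> \<exists>c. \<forall>x\<in>carrier G. f x = (\<Sum>j<N. c j * w j x)"
    by (rule maximal_independent_family[OF finite_carrier, of Z]) (rule that)
  have "N > 0"
    using w(3)[OF nz(1)] nz(2,3) by (cases N) auto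
  then have PN: "P N"
    unfolding P_def
  proof (intro conjI exI[of _ w] allI impI ballI)
    fix h j assume "h \<in> carrier G" "j < N"
    then have "(\<lambda>x. w j (x \<otimes> h)) \<in> Z" using inv[OF w(1)] by blast
    from w(3)[OF this] show "\<exists>c. \<forall>x\<in>carrier G. w j (x \<otimes> h) = (\<Sum>i<N. c i * w i x)" .
  qed (use \<open>N > 0\<close> w(1,2) in blast)+
  \<comment> \<open>The dimension of a smallest nonzero invariant subspace of \<open>Z\<close>.\<close>
  define n where "n = (LEAST n. P n)"
  have "P n" unfolding n_def using PN by (rule LeastI)
  have min: "n \<le> m" if "P m" for m unfolding n_def using that by (rule Least_le)
  from \<open>P n\<close> obtain w where n: "n > 0" and wZ: "\<And>j. j < n \<Longrightarrow> w j \<in> Z" and wind: "independent_on (carrier G) n w"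
    and winv: "\<forall>h\<in>carrier G. \<forall>j<n. \<exists>c. \<forall>x\<in>carrier G. w j (x \<otimes> h) = (\<Sum>i<n. c i * w i x)"
    unfolding P_def by blast
  define C where "C h j = (SOME c. \<forall>x\<in>carrier G. w j (x \<otimes> h) = (\<Sum>i<n. c i * w i x))" for h j
  have C: "w j (x \<otimes> h) = (\<Sum>i<n. C h j i * w i x)"
    if "h \<in> carrier G" "j < n" "x \<in> carrier G" for h j x
    using someI_ex[OF winv[rule_format, OF that(1,2)]] that(3) unfolding C_def by blast
  have uniq: "\<forall>i<n. a i = b i" if "\<And>x. x \<in> carrier G \<Longrightarrow> (\<Sum>i<n. a i * w i x) = (\<Sum>i<n. b i * w i x)" for a b
  proof -
    have "\<forall>i<n. a i - b i = 0"
    proof (rule independent_onD[OF wind])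
      fix x assume "x \<in> carrier G"
      then show "(\<Sum>i<n. (a i - b i) * w i x) = 0"
        using that[of x] by (simp add: left_diff_distrib sum_subtractf)
    qed
    then show ?thesis by simp
  qed
  define \<rho> where "\<rho> h = Matrix.mat n n (\<lambda>(i, j). C h j i)" for h
  have mult: "\<rho> (g \<otimes> h) = \<rho> g * \<rho> h" if gh: "g \<in> carrier G" "h \<in> carrier G" for g h
  proof (rule eq_matI)
    fix i j assume "i < dim_row (\<rho> g * \<rho> h)" "j < dim_col (\<rho> g * \<rho> h)"
    then have ij: "i < n" "j < n" by (auto simp: \<rho>_def)
    have "\<forall>l<n. C (g \<otimes> h) j l = (\<Sum>i<n. C g i l * C h j i)"
    proof (rule uniq)
      fix x assume x: "x \<in> carrier G"
      have "(\<Sum>i<n. C (g \<otimes> h) j i * w i x) = w j ((x \<otimes> g) \<otimes> h)"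
        using C[of "g \<otimes> h" j x, symmetric] gh x ij by (simp only: m_assoc m_closed)
      also have "\<dots> = (\<Sum>i<n. C h j i * (\<Sum>l<n. C g i l * w l x))"
        using C gh x ij by simp
      also have "\<dots> = (\<Sum>i<n. \<Sum>l<n. C g i l * C h j i * w l x)"
        by (simp add: sum_distrib_left mult.assoc mult.left_commute)
      also have "\<dots> = (\<Sum>l<n. (\<Sum>i<n. C g i l * C h j i) * w l x)"
        by (subst sum.swap) (simp add: sum_distrib_right)
      finally show "(\<Sum>i<n. C (g \<otimes> h) j i * w i x) = \<dots>" .
    qed
    then show "\<rho> (g \<otimes> h) $$ (i, j) = (\<rho> g * \<rho> h) $$ (i, j)"
      using ij by (simp add: \<rho>_def scalar_prod_def atLeast0LessThan)
  qed (auto simp: \<rho>_def)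
  have one: "\<rho> \<one> = 1\<^sub>m n"
  proof (rule eq_matI)
    fix i j assume "i < dim_row (1\<^sub>m n)" "j < dim_col (1\<^sub>m n)"
    then have ij: "i < n" "j < n" by auto
    have "\<forall>i<n. C \<one> j i = (if i = j then 1 else 0)"
    proof (rule uniq)
      fix x assume x: "x \<in> carrier G"
      have "(\<Sum>i<n. (if i = j then 1 else 0) * w i x) = (\<Sum>i<n. if i = j then w i x else 0)"
        by (intro sum.cong) auto
      also have "\<dots> = w j x" using ij by simp
      finally show "(\<Sum>i<n. C \<one> j i * w i x) = (\<Sum>i<n. (if i = j then 1 else 0) * w i x)"
        using C[of \<one> j x] x ij by simp
    qed
    then show "\<rho> \<one> $$ (i, j) = 1\<^sub>m n $$ (i, j)" using ij by (simp add: \<rho>_def)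
  qed (auto simp: \<rho>_def)
  have \<rho>c: "\<rho> g \<in> carrier_mat n n" for g by (simp add: \<rho>_def)
  have hom: "\<rho> \<in> hom G (GL n)"
  proof (rule homI)
    fix g assume g: "g \<in> carrier G"
    then have "\<rho> (inv g) * \<rho> g = 1\<^sub>m n" "\<rho> g * \<rho> (inv g) = 1\<^sub>m n"
      using mult[of "inv g" g] mult[of g "inv g"] one by auto
    then show "\<rho> g \<in> carrier (GL n)" using \<rho>c by (auto intro: bexI[of _ "\<rho> (inv g)"])
  qed (use mult in simp)
  have irr: "irreducible_rep G n \<rho>"
    unfolding irreducible_rep_def
  proof (intro conjI allI impI n)
    fix W assume "VectorSpace.subspace class_ring W (module_vec TYPE(complex) n) \<and>
      (\<forall>g\<in>carrier G. \<forall>w\<in>W. \<rho> g *\<^sub>v w \<in> W)"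
    then have W: "VectorSpace.subspace class_ring W (module_vec TYPE(complex) n)"
      and Winv: "\<And>g v. g \<in> carrier G \<Longrightarrow> v \<in> W \<Longrightarrow> \<rho> g *\<^sub>v v \<in> W" by auto
    have Wc: "W \<subseteq> carrier_vec n" "0\<^sub>v n \<in> W" using W unfolding subspace_vec_iff by auto
    obtain m b where b: "m \<le> n" "\<And>j. j < m \<Longrightarrow> b j \<in> W"
      "independent_on {..<n} m (\<lambda>j. ($) (b j))"
      "\<And>v. v \<in> W \<Longrightarrow> \<exists>c. \<forall>x<n. v $ x = (\<Sum>j<m. c j * b j $ x)"
      "m = n \<Longrightarrow> W = carrier_vec n"
      by (rule subspace_basis[OF W]) (rule that)
    show "W = {0\<^sub>v n} \<or> W = carrier_vec n"
    proof (cases "m = 0")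
      case True
      have "v = 0\<^sub>v n" if v: "v \<in> W" for v
      proof (rule eq_vecI)
        fix x assume "x < dim_vec (0\<^sub>v n)"
        then show "v $ x = 0\<^sub>v n $ x" using b(4)[OF v] True by simp
      next
        show "dim_vec v = dim_vec (0\<^sub>v n)" using v Wc by auto
      qed
      then show ?thesis using Wc by blast
    next
      case False
      \<comment> \<open>An invariant subspace of the coordinate space corresponds to an invariant space of functions.\<close>
      define w' where "w' j x = (\<Sum>i<n. b j $ i * w i x)" for j x
      have swap: "(\<Sum>j<m. c j * w' j x) = (\<Sum>i<n. (\<Sum>j<m. c j * b j $ i) * w i x)" for c x
        unfolding w'_def by (simp add: sum_distrib_left sum_distrib_right mult.assoc) (rule sum.swap)
      have "P m"
        unfolding P_def
      proof (intro conjI exI[of _ w'] allI impI ballI)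
        show "0 < m" using False by simp
        show "w' j \<in> Z" if "j < m" for j
          unfolding w'_def by (rule lin) (use wZ in auto)
        show "independent_on (carrier G) m w'"
        proof (rule independent_onI)
          fix c j assume c: "\<And>x. x \<in> carrier G \<Longrightarrow> (\<Sum>j<m. c j * w' j x) = 0" and j: "j < m"
          have "\<forall>i<n. (\<Sum>j<m. c j * b j $ i) = 0"
            by (rule independent_onD[OF wind]) (use c in \<open>simp add: swap\<close>)
          then have "\<forall>j<m. c j = 0" by (intro independent_onD[OF b(3)]) simp
          then show "c j = 0" using j by blast
        qed
      next
        fix h j assume h: "h \<in> carrier G" and j: "j < m"
        have bj: "b j \<in> carrier_vec n" using b(2) j Wc by auto
        obtain d where d: "\<And>l. l < n \<Longrightarrow> (\<rho> h *\<^sub>v b j) $ l = (\<Sum>k<m. d k * b k $ l)"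
          using b(4)[OF Winv[OF h b(2)[OF j]]] by blast
        have "w' j (x \<otimes> h) = (\<Sum>k<m. d k * w' k x)" if x: "x \<in> carrier G" for x
        proof -
          have "w' j (x \<otimes> h) = (\<Sum>i<n. \<Sum>l<n. b j $ i * (C h i l * w l x))"
            unfolding w'_def using C h x by (simp add: sum_distrib_left)
          also have "\<dots> = (\<Sum>l<n. (\<Sum>i<n. C h i l * b j $ i) * w l x)"
            by (subst sum.swap) (simp add: sum_distrib_left sum_distrib_right mult_ac)
          also have "\<dots> = (\<Sum>l<n. (\<Sum>k<m. d k * b k $ l) * w l x)"
          proof (rule sum.cong[OF refl])
            fix l assume "l \<in> {..<n}"
            then have l: "l < n" by simp
            have "(\<Sum>i<n. C h i l * b j $ i) = (\<rho> h *\<^sub>v b j) $ l"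
              using l bj by (simp add: \<rho>_def scalar_prod_def atLeast0LessThan)
            then show "(\<Sum>i<n. C h i l * b j $ i) * w l x = (\<Sum>k<m. d k * b k $ l) * w l x"
              by (simp only: d[OF l])
          qed
          finally show ?thesis by (simp add: swap)
        qed
        then show "\<exists>c. \<forall>x\<in>carrier G. w' j (x \<otimes> h) = (\<Sum>i<m. c i * w' i x)"
          by (intro exI[of _ d] ballI)
      qed
      then have "n \<le> m" by (rule min)
      then have "m = n" using b(1) by simp
      then show ?thesis using b(5) by simp
    qed
  qed
  have "\<exists>x\<in>carrier G. w 0 x \<noteq> 0"
  proof (rule ccontr)
    assume "\<not> (\<exists>x\<in>carrier G. w 0 x \<noteq> 0)"
    then have z: "\<forall>x\<in>carrier G. w 0 x = 0" by blast
    have "(\<Sum>j<n. (if j = 0 then 1 else 0) * w j x) = 0" if "x \<in> carrier G" for x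
      by (rule sum.neutral) (use that z in auto)
    then have "\<forall>j<n. (if j = 0 then 1 else 0) = (0::complex)" by (rule independent_onD[OF wind])
    then show False using n by auto
  qed
  then obtain x where x: "x \<in> carrier G" "w 0 x \<noteq> 0" by blast
  show thesis
  proof (rule that[of n \<rho> "w 0" x 0 "\<lambda>i. w i \<one>"])
    show "w 0 x = (\<Sum>i<n. w i \<one> * \<rho> x $$ (i, 0))" if "x \<in> carrier G" for x
    proof -
      have "w 0 x = w 0 (\<one> \<otimes> x)" using that by simp
      also have "\<dots> = (\<Sum>i<n. C x 0 i * w i \<one>)" using C[OF that n one_closed] .
      also have "\<dots> = (\<Sum>i<n. w i \<one> * \<rho> x $$ (i, 0))"
        by (rule sum.cong) (use n in \<open>simp_all add: \<rho>_def\<close>)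
      finally show ?thesis .
    qed
    show "irrep G n \<rho>" using hom irr by (simp add: irrep_def)
    show "w 0 \<in> Z" by (rule wZ[OF n])
  qed (rule x n)+
qed

text \<open>The complex conjugates of the functions that annihilate all matrix coefficients form a space
  that is invariant under right translation.  If it were nonzero, it would contain a nonzero
  combination \<open>w\<close> of matrix coefficients, so that \<open>w\<close> would be orthogonal to itself.\<close>

lemma coefficients_complete:
  assumes f: "\<And>n \<rho> i j. irrep G n \<rho> \<Longrightarrow> i < n \<Longrightarrow> j < n \<Longrightarrow> (\<Sum>g\<in>carrier G. f g * \<rho> g $$ (i, j)) = 0"
    and x0: "x0 \<in> carrier G"
  shows "f x0 = 0"
proof (rule ccontr)
  assume nz: "f x0 \<noteq> 0"
  define Z where "Z = {w. \<forall>n \<rho> i j. irrep G n \<rho> \<longrightarrow> i < n \<longrightarrow> j < n \<longrightarrow> 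
     (\<Sum>g\<in>carrier G. cnj (w g) * \<rho> g $$ (i, j)) = 0}"
  have lin: "(\<lambda>x. \<Sum>i\<in>(I::nat set). c i * w i x) \<in> Z" if "finite I" "\<And>i. i \<in> I \<Longrightarrow> w i \<in> Z" for I c w
    unfolding Z_def
  proof (clarify)
    fix n \<rho> i j assume r: "irrep G n \<rho>" "i < n" "j < n"
    have "(\<Sum>g\<in>carrier G. cnj (\<Sum>i\<in>I. c i * w i g) * \<rho> g $$ (i, j)) =
      (\<Sum>k\<in>I. cnj (c k) * (\<Sum>g\<in>carrier G. cnj (w k g) * \<rho> g $$ (i, j)))"
      by (simp add: sum_distrib_left sum_distrib_right mult.assoc) (rule sum.swap)
    also have "\<dots> = 0"
    proof (rule sum.neutral, rule ballI)
      fix k assume "k \<in> I"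
      then have "w k \<in> Z" by (rule that(2))
      then have "(\<Sum>g\<in>carrier G. cnj (w k g) * \<rho> g $$ (i, j)) = 0" using r unfolding Z_def by blast
      then show "cnj (c k) * (\<Sum>g\<in>carrier G. cnj (w k g) * \<rho> g $$ (i, j)) = 0" by simp
    qed
    finally show "(\<Sum>g\<in>carrier G. cnj (\<Sum>i\<in>I. c i * w i g) * \<rho> g $$ (i, j)) = 0" .
  qed
  have inv: "(\<lambda>x. w (x \<otimes> h)) \<in> Z" if w: "w \<in> Z" and h: "h \<in> carrier G" for w h
    unfolding Z_def
  proof (clarify)
    fix n \<rho> i j assume r: "irrep G n \<rho>" "i < n" "j < n"
    then have hom: "\<rho> \<in> hom G (GL n)" by (auto simp: irrep_def)
    have "(\<Sum>g\<in>carrier G. cnj (w (g \<otimes> h)) * \<rho> g $$ (i, j)) = 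
      (\<Sum>g\<in>carrier G. cnj (w (g \<otimes> h)) * \<rho> ((g \<otimes> h) \<otimes> inv h) $$ (i, j))"
      by (rule sum.cong[OF refl]) (simp add: m_assoc h)
    also have "\<dots> = (\<Sum>g\<in>carrier G. cnj (w g) * \<rho> (g \<otimes> inv h) $$ (i, j))"
      by (rule sum_right_translate[OF h, of "\<lambda>g. cnj (w g) * \<rho> (g \<otimes> inv h) $$ (i, j)"])
    also have "\<dots> = (\<Sum>g\<in>carrier G. cnj (w g) * (\<Sum>l<n. \<rho> g $$ (i, l) * \<rho> (inv h) $$ (l, j)))"
      by (rule sum.cong[OF refl]) (simp only: rep_mult_entry[OF hom _ inv_closed[OF h] r(2,3)])
    also have "\<dots> = (\<Sum>l<n. (\<Sum>g\<in>carrier G. cnj (w g) * \<rho> g $$ (i, l)) * \<rho> (inv h) $$ (l, j))"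
      by (simp add: sum_distrib_left sum_distrib_right mult.assoc) (rule sum.swap)
    also have "\<dots> = 0"
    proof (rule sum.neutral, rule ballI)
      fix l assume "l \<in> {..<n}"
      then have "(\<Sum>g\<in>carrier G. cnj (w g) * \<rho> g $$ (i, l)) = 0" using w r unfolding Z_def by blast
      then show "(\<Sum>g\<in>carrier G. cnj (w g) * \<rho> g $$ (i, l)) * \<rho> (inv h) $$ (l, j) = 0" by simp
    qed
    finally show "(\<Sum>g\<in>carrier G. cnj (w (g \<otimes> h)) * \<rho> g $$ (i, j)) = 0" .
  qed
  show False
  proof (rule invariant_functions_contain_irrep[of Z "\<lambda>g. cnj (f g)" x0])
    show "(\<lambda>g. cnj (f g)) \<in> Z"
      unfolding Z_def by (intro CollectI allI impI) (simp only: complex_cnj_cnj f)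
    show "cnj (f x0) \<noteq> 0" using nz by simp
  next
    fix n \<rho> w x c j
    assume w: "irrep G n \<rho>" "w \<in> Z" "x \<in> carrier G" "w x \<noteq> 0" "j < n"
      "\<And>x. x \<in> carrier G \<Longrightarrow> w x = (\<Sum>i<n. c i * \<rho> x $$ (i, j))"
    have "(\<Sum>g\<in>carrier G. cnj (w g) * w g) = (\<Sum>g\<in>carrier G. cnj (w g) * (\<Sum>i<n. c i * \<rho> g $$ (i, j)))"
      by (rule sum.cong[OF refl]) (simp only: w(6))
    also have "\<dots> = (\<Sum>i<n. c i * (\<Sum>g\<in>carrier G. cnj (w g) * \<rho> g $$ (i, j)))"
      by (simp add: sum_distrib_left mult.left_commute) (rule sum.swap)
    also have "\<dots> = 0"
    proof (rule sum.neutral, rule ballI)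
      fix i assume "i \<in> {..<n}"
      then have "(\<Sum>g\<in>carrier G. cnj (w g) * \<rho> g $$ (i, j)) = 0" using w(1,2,5) unfolding Z_def by blast
      then show "c i * (\<Sum>g\<in>carrier G. cnj (w g) * \<rho> g $$ (i, j)) = 0" by simp
    qed
    finally have "(\<Sum>g\<in>carrier G. cnj (w g) * w g) = 0" .
    moreover have e: "cnj (w g) * w g = complex_of_real ((cmod (w g))\<^sup>2)" for g
      by (subst complex_norm_square) (rule mult.commute)
    ultimately have "(\<Sum>g\<in>carrier G. (cmod (w g))\<^sup>2) = 0"
      by (simp only: e of_real_sum[symmetric] of_real_eq_0_iff)
    then have "(cmod (w x))\<^sup>2 = 0" using w(3) by (subst (asm) sum_nonneg_eq_0_iff) auto
    then show False using w(4) by simp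
  next
    fix I :: "nat set" and c :: "nat \<Rightarrow> complex" and w
    assume "finite I" "\<And>i. i \<in> I \<Longrightarrow> w i \<in> Z"
    then show "(\<lambda>x. \<Sum>i\<in>I. c i * w i x) \<in> Z" by (rule lin)
  next
    fix w h assume "w \<in> Z" "h \<in> carrier G"
    then show "(\<lambda>x. w (x \<otimes> h)) \<in> Z" by (rule inv)
  qed (rule x0)
qed

lemma noniso_insert:
  assumes "noniso G R" "irrep G n \<rho>"
    and "\<And>\<sigma>. (n, \<sigma>) \<in> R \<Longrightarrow> \<not> isomorphic_reps G n \<rho> \<sigma> \<and> \<not> isomorphic_reps G n \<sigma> \<rho>"
  shows "noniso G (insert (n, \<rho>) R)"
  using assms by (auto simp: noniso_def)

lemma exists_maximal_noniso:
  obtains R where "noniso G R" "finite R"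
    "\<And>n \<rho>. irrep G n \<rho> \<Longrightarrow> \<exists>\<sigma>. (n, \<sigma>) \<in> R \<and> (\<rho> = \<sigma> \<or> isomorphic_reps G n \<rho> \<sigma>)"
proof -
  define Q where "Q k \<longleftrightarrow> (\<exists>R. noniso G R \<and> finite R \<and> card R = k)" for k
  have "Q 0" by (auto simp: Q_def noniso_def intro!: exI[of _ "{}"])
  moreover have bound: "k \<le> card conj_classes" if "Q k" for k
    using that card_noniso_le by (auto simp: Q_def)
  ultimately have "Q (GREATEST k. Q k)" 
    by (rule GreatestI_nat[of Q 0 "card conj_classes"])
  then obtain R where R: "noniso G R" "finite R" "card R = (GREATEST k. Q k)" by (auto simp: Q_def)
  have "\<exists>\<sigma>. (n, \<sigma>) \<in> R \<and> (\<rho> = \<sigma> \<or> isomorphic_reps G n \<rho> \<sigma>)" if \<rho>: "irrep G n \<rho>" for n \<rho>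
  proof (rule ccontr)
    assume no: "\<nexists>\<sigma>. (n, \<sigma>) \<in> R \<and> (\<rho> = \<sigma> \<or> isomorphic_reps G n \<rho> \<sigma>)"
    have no': "\<not> isomorphic_reps G n \<sigma> \<rho>" if "(n, \<sigma>) \<in> R" for \<sigma>
    proof
      assume "isomorphic_reps G n \<sigma> \<rho>"
      moreover have "irrep G n \<sigma>" using R(1) that by (auto simp: noniso_def)
      ultimately have "isomorphic_reps G n \<rho> \<sigma>"
        using isomorphic_reps_sym \<rho> by (auto simp: irrep_def)
      then show False using no that by blast
    qed
    have "noniso G (insert (n, \<rho>) R)"
      using R(1) \<rho> by (rule noniso_insert) (use no no' in blast)
    moreover have "(n, \<rho>) \<notin> R" using no by blast
    ultimately have "Q (Suc (card R))"
      unfolding Q_def using R(2) by (intro exI[of _ "insert (n, \<rho>) R"]) simp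
    then have "Suc (card R) \<le> card R"
      unfolding R(3) using bound by (rule Greatest_le_nat[of Q])
    then show False by simp
  qed
  then show thesis using that R by blast
qed

lemma conj_class_fibre:
  assumes "C \<in> conj_classes"
  shows "{g \<in> carrier G. conj_class g = C} = C"
proof -
  obtain g0 where g0: "g0 \<in> carrier G" "C = conj_class g0" using assms by (auto simp: conj_classes_def)
  have "x \<in> carrier G \<and> conj_class x = C" if "x \<in> C" for x
    using that g0 conj_class_eq[of g0 x] by (auto simp: conj_class_def)
  then show ?thesis using conj_class_self by blast
qed

text \<open>The operator \<open>\<Sum> f(g) \<rho>(g)\<close> of a class function commutes with \<open>\<rho>\<close>, so it is a scalar; its trace
  is the pairing of \<open>f\<close> with the character.\<close>

lemma class_function_acts_by_zero:
  assumes \<rho>: "irrep G n \<rho>" and f: "\<And>g h. g \<in> carrier G \<Longrightarrow> h \<in> carrier G \<Longrightarrow> f (h \<otimes> g \<otimes> inv h) = f g"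
    and z: "(\<Sum>g\<in>carrier G. f g * character n \<rho> g) = 0"
    and ij: "i < n" "j < n"
  shows "(\<Sum>g\<in>carrier G. f g * \<rho> g $$ (i, j)) = 0"
proof -
  have h: "\<rho> \<in> hom G (GL n)" and n: "n > 0" using \<rho> by (auto simp: irrep_def irreducible_rep_def)
  define T where "T = Matrix.mat n n (\<lambda>(i, j). \<Sum>g\<in>carrier G. f g * \<rho> g $$ (i, j))"
  have int: "T * \<rho> k = \<rho> k * T" if k: "k \<in> carrier G" for k
  proof (rule eq_matI)
    note c = rep_carrier[OF h k]
    fix i j assume "i < dim_row (\<rho> k * T)" "j < dim_col (\<rho> k * T)"
    then have ij: "i < n" "j < n" using c by (auto simp: T_def)
    have "(T * \<rho> k) $$ (i, j) = (\<Sum>l<n. (\<Sum>g\<in>carrier G. f g * \<rho> g $$ (i, l)) * \<rho> k $$ (l, j))"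
      using ij c by (simp add: T_def scalar_prod_def atLeast0LessThan)
    also have "\<dots> = (\<Sum>g\<in>carrier G. f g * (\<Sum>l<n. \<rho> g $$ (i, l) * \<rho> k $$ (l, j)))"
      by (simp add: sum_distrib_left sum_distrib_right mult.assoc) (rule sum.swap)
    also have "\<dots> = (\<Sum>g\<in>carrier G. f g * \<rho> (g \<otimes> k) $$ (i, j))"
      using rep_mult_entry[OF h] k ij by simp
    also have "\<dots> = (\<Sum>g\<in>carrier G. f ((g \<otimes> k) \<otimes> inv k) * \<rho> (g \<otimes> k) $$ (i, j))"
      by (rule sum.cong[OF refl]) (simp add: m_assoc k)
    also have "\<dots> = (\<Sum>g\<in>carrier G. f (g \<otimes> inv k) * \<rho> g $$ (i, j))"
      by (rule sum_right_translate[OF k, of "\<lambda>g. f (g \<otimes> inv k) * \<rho> g $$ (i, j)"])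
    also have "\<dots> = (\<Sum>g\<in>carrier G. f (k \<otimes> g \<otimes> inv k) * \<rho> (k \<otimes> g) $$ (i, j))"
      by (rule sum_left_translate[OF k, of "\<lambda>g. f (g \<otimes> inv k) * \<rho> g $$ (i, j)", symmetric])
    also have "\<dots> = (\<Sum>g\<in>carrier G. f g * (\<Sum>l<n. \<rho> k $$ (i, l) * \<rho> g $$ (l, j)))"
      using rep_mult_entry[OF h] k ij f by simp
    also have "\<dots> = (\<Sum>l<n. \<rho> k $$ (i, l) * (\<Sum>g\<in>carrier G. f g * \<rho> g $$ (l, j)))"
      by (simp add: sum_distrib_left mult.left_commute) (rule sum.swap)
    also have "\<dots> = (\<rho> k * T) $$ (i, j)"
      using ij c by (simp add: T_def scalar_prod_def atLeast0LessThan)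
    finally show "(T * \<rho> k) $$ (i, j) = (\<rho> k * T) $$ (i, j)" .
  qed (use rep_carrier[OF h k] in \<open>auto simp: T_def\<close>)
  obtain c where c: "T = c \<cdot>\<^sub>m 1\<^sub>m n"
    using Schur_same[OF _ \<rho> int] by (auto simp: T_def)
  have "of_nat n * c = (\<Sum>i<n. T $$ (i, i))" by (simp add: c)
  also have "\<dots> = (\<Sum>g\<in>carrier G. f g * character n \<rho> g)"
    by (simp add: T_def character_def sum_distrib_left) (rule sum.swap)
  finally have "c = 0" using z n by simp
  then have "T $$ (i, j) = 0" using c ij by simp
  then show ?thesis using ij by (simp add: T_def)
qed

lemma mult_mat_entry:
  fixes A B :: "complex mat"
  assumes "A \<in> carrier_mat n m" "B \<in> carrier_mat m k" "i < n" "j < k"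
  shows "(A * B) $$ (i, j) = (\<Sum>l<m. A $$ (i, l) * B $$ (l, j))"
  using assms by (simp add: scalar_prod_def atLeast0LessThan)

lemma group_algebra_zero_iso:
  assumes \<rho>: "\<rho> \<in> hom G (GL n)" and \<sigma>: "\<sigma> \<in> hom G (GL n)" and iso: "isomorphic_reps G n \<rho> \<sigma>"
    and z: "\<And>i j. i < n \<Longrightarrow> j < n \<Longrightarrow> (\<Sum>g\<in>carrier G. f g * \<sigma> g $$ (i, j)) = 0"
    and ij: "i < n" "j < n"
  shows "(\<Sum>g\<in>carrier G. f g * \<rho> g $$ (i, j)) = 0"
proof -
  obtain P Q where P: "P \<in> carrier_mat n n" "Q \<in> carrier_mat n n" "Q * P = 1\<^sub>m n"
    "\<And>g. g \<in> carrier G \<Longrightarrow> P * \<rho> g = \<sigma> g * P"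
    using iso unfolding isomorphic_reps_def Units_ring_mat by blast
  define T where "T = Matrix.mat n n (\<lambda>(i, j). \<Sum>g\<in>carrier G. f g * \<rho> g $$ (i, j))"
  have T: "T \<in> carrier_mat n n" by (simp add: T_def)
  have "P * T = 0\<^sub>m n n"
  proof (rule eq_matI)
    fix i j assume "i < dim_row (0\<^sub>m n n)" "j < dim_col (0\<^sub>m n n)"
    then have ij: "i < n" "j < n" by auto
    have "(P * T) $$ (i, j) = (\<Sum>l<n. P $$ (i, l) * (\<Sum>g\<in>carrier G. f g * \<rho> g $$ (l, j)))"
      using ij P by (simp add: T_def scalar_prod_def atLeast0LessThan)
    also have "\<dots> = (\<Sum>g\<in>carrier G. f g * (\<Sum>l<n. P $$ (i, l) * \<rho> g $$ (l, j)))"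
      by (simp add: sum_distrib_left mult.left_commute) (rule sum.swap)
    also have "\<dots> = (\<Sum>g\<in>carrier G. f g * (P * \<rho> g) $$ (i, j))"
      by (rule sum.cong[OF refl]) (simp only: mult_mat_entry[OF P(1) rep_carrier[OF \<rho>] ij])
    also have "\<dots> = (\<Sum>g\<in>carrier G. f g * (\<sigma> g * P) $$ (i, j))"
      using P(4) by simp
    also have "\<dots> = (\<Sum>g\<in>carrier G. f g * (\<Sum>l<n. \<sigma> g $$ (i, l) * P $$ (l, j)))"
      by (rule sum.cong[OF refl]) (simp only: mult_mat_entry[OF rep_carrier[OF \<sigma>] P(1) ij])
    also have "\<dots> = (\<Sum>l<n. (\<Sum>g\<in>carrier G. f g * \<sigma> g $$ (i, l)) * P $$ (l, j))"
      by (simp add: sum_distrib_left sum_distrib_right mult.assoc) (rule sum.swap)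
    also have "\<dots> = 0" using z ij by simp
    finally show "(P * T) $$ (i, j) = 0\<^sub>m n n $$ (i, j)" using ij by simp
  qed (use P T in auto)
  then have "T = 0\<^sub>m n n"
    using assoc_mult_mat[OF P(2,1) T] P(2,3) T by simp
  then have "T $$ (i, j) = 0" using ij by simp
  then show ?thesis using ij by (simp add: T_def)
qed

text \<open>If a maximal set of pairwise nonisomorphic irreducible representations had fewer members than
  there are conjugacy classes, a nonzero class function would be orthogonal to all irreducible
  characters.  It would act by zero in every irreducible representation, which contradicts
  completeness.\<close>

theorem exists_noniso_card_conj_classes:
  obtains R where "noniso G R" "finite R" "card R = card conj_classes"
proof -
  obtain R where R: "noniso G R" "finite R"
    "\<And>n \<rho>. irrep G n \<rho> \<Longrightarrow> \<exists>\<sigma>. (n, \<sigma>) \<in> R \<and> (\<rho> = \<sigma> \<or> isomorphic_reps G n \<rho> \<sigma>)"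
    using exists_maximal_noniso by blast
  have irr: "irrep G n \<rho>" if "(n, \<rho>) \<in> R" for n \<rho>
    using R(1) that by (auto simp: noniso_def)
  have "\<not> card R < card conj_classes"
  proof
    assume "card R < card conj_classes"
    then obtain c C0 where C0: "C0 \<in> conj_classes" "c C0 \<noteq> 0"
      and c: "\<And>r. r \<in> R \<Longrightarrow> (\<Sum>C\<in>conj_classes. c C * (\<Sum>g\<in>C. character (fst r) (snd r) g)) = 0"
      by (rule linear_relation_exists[OF R(2) finite_conj_classes,
            of "\<lambda>C r. \<Sum>g\<in>C. character (fst r) (snd r) g"]) (rule that)
    define f where "f g = c (conj_class g)" for g
    have fc: "f (h \<otimes> g \<otimes> inv h) = f g" if "g \<in> carrier G" "h \<in> carrier G" for g h
      unfolding f_def using conj_class_eq[OF that(1), of "h \<otimes> g \<otimes> inv h"] that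
      by (force simp: conj_class_def)
    have z: "(\<Sum>g\<in>carrier G. f g * character n \<rho> g) = 0" if r: "(n, \<rho>) \<in> R" for n \<rho>
    proof -
      have "(\<Sum>g\<in>carrier G. f g * character n \<rho> g) =
        (\<Sum>C\<in>conj_classes. \<Sum>g\<in>{g \<in> carrier G. conj_class g = C}. f g * character n \<rho> g)"
        by (rule sum.group[symmetric]) (auto simp: conj_classes_def)
      also have "\<dots> = (\<Sum>C\<in>conj_classes. c C * (\<Sum>g\<in>C. character n \<rho> g))"
      proof (rule sum.cong[OF refl])
        fix C assume C: "C \<in> conj_classes"
        have "(\<Sum>g\<in>{g \<in> carrier G. conj_class g = C}. f g * character n \<rho> g) =
          (\<Sum>g\<in>{g \<in> carrier G. conj_class g = C}. c C * character n \<rho> g)"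
          by (rule sum.cong) (auto simp: f_def)
        then show "(\<Sum>g\<in>{g \<in> carrier G. conj_class g = C}. f g * character n \<rho> g) =
          c C * (\<Sum>g\<in>C. character n \<rho> g)"
          unfolding conj_class_fibre[OF C] by (simp add: sum_distrib_left)
      qed
      also have "\<dots> = 0" using c[OF r] by simp
      finally show ?thesis .
    qed
    have zero: "(\<Sum>g\<in>carrier G. f g * \<rho> g $$ (i, j)) = 0" if \<rho>: "irrep G n \<rho>" and ij: "i < n" "j < n" for n \<rho> i j
    proof -
      obtain \<sigma> where s: "(n, \<sigma>) \<in> R" "\<rho> = \<sigma> \<or> isomorphic_reps G n \<rho> \<sigma>" using R(3)[OF \<rho>] by blast
      have zs: "(\<Sum>g\<in>carrier G. f g * \<sigma> g $$ (i, j)) = 0" if "i < n" "j < n" for i j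
        by (rule class_function_acts_by_zero[OF irr[OF s(1)] fc z[OF s(1)] that])
      show ?thesis
        using s(2)
      proof
        assume "isomorphic_reps G n \<rho> \<sigma>"
        then show ?thesis
          using group_algebra_zero_iso[OF _ _ _ zs ij, of \<rho>] \<rho> irr[OF s(1)] by (auto simp: irrep_def)
      qed (use zs ij in simp)
    qed
    obtain g0 where g0: "g0 \<in> carrier G" "C0 = conj_class g0" using C0 by (auto simp: conj_classes_def)
    have "f g0 = 0" by (rule coefficients_complete[OF zero g0(1)])
    then show False using C0 g0 by (simp add: f_def)
  qed
  then have "card R = card conj_classes" using card_noniso_le[OF R(1,2)] by simp
  then show thesis by (rule that[OF R(1,2)])
qed

end

section \<open>Conjugacy classes and quotient groups\<close>

context finite_group
begin

text \<open>One half of Burnside's count.  Fix a representative \<open>r\<close> of each class and, for each conjugate \<open>g\<close>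
  of \<open>r\<close>, an element \<open>x\<close> that carries \<open>r\<close> to \<open>g\<close>.  A class and an element \<open>y\<close> are recovered from \<open>y r y\<^sup>-\<^sup>1\<close>
  and the element \<open>y x\<^sup>-\<^sup>1\<close> of its centralizer.\<close>

lemma card_commuting_pairs_ge:
  "card conj_classes * order G \<le> card {(g, h) \<in> carrier G \<times> carrier G. g \<otimes> h = h \<otimes> g}" (is "_ \<le> card ?P")
proof -
  define r where "r C = (SOME g. g \<in> carrier G \<and> C = conj_class g)" for C
  have r: "r C \<in> carrier G" "C = conj_class (r C)" if C: "C \<in> conj_classes" for C
  proof -
    have "\<exists>g. g \<in> carrier G \<and> C = conj_class g" using C by (auto simp: conj_classes_def)
    then have "r C \<in> carrier G \<and> C = conj_class (r C)" unfolding r_def by (rule someI_ex)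
    then show "r C \<in> carrier G" "C = conj_class (r C)" by blast+
  qed
  define x where "x C g = (SOME x. x \<in> carrier G \<and> g = x \<otimes> r C \<otimes> inv x)" for C g
  have x: "x C g \<in> carrier G \<and> g = x C g \<otimes> r C \<otimes> inv (x C g)"
    if "y \<in> carrier G" "g = y \<otimes> r C \<otimes> inv y" for C g y
    unfolding x_def by (rule someI[of _ y]) (use that in blast)
  define F where "F = (\<lambda>(C, y). (y \<otimes> r C \<otimes> inv y, y \<otimes> inv (x C (y \<otimes> r C \<otimes> inv y))))"
  have "inj_on F (conj_classes \<times> carrier G)"
  proof (rule inj_onI, clarify)
    fix C y C' y' assume C: "C \<in> conj_classes" "C' \<in> conj_classes" and y: "y \<in> carrier G" "y' \<in> carrier G"
      and e: "F (C, y) = F (C', y')"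
    define g where "g = y \<otimes> r C \<otimes> inv y"
    have g': "g = y' \<otimes> r C' \<otimes> inv y'" using e by (simp add: F_def g_def)
    have "g \<in> conj_class (r C)" unfolding g_def conj_class_def using y(1) by blast
    moreover have "g \<in> conj_class (r C')" unfolding g' conj_class_def using y(2) by blast
    ultimately have CC: "C = C'" using r[OF C(1)] r[OF C(2)] conj_class_eq by metis
    have "F (C, y) = (g, y \<otimes> inv (x C g))" "F (C', y') = (g, y' \<otimes> inv (x C' g))"
      by (simp add: F_def g_def, simp add: F_def g'[symmetric])
    then have "y \<otimes> inv (x C g) = y' \<otimes> inv (x C g)" using e CC by simp
    moreover have "x C g \<in> carrier G" using x[OF y(1), of g C] by (simp add: g_def)
    ultimately have "y = y'" using y by simp
    then show "C = C' \<and> y = y'" using CC by blast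
  qed
  moreover have "F ` (conj_classes \<times> carrier G) \<subseteq> ?P"
  proof
    fix z assume "z \<in> F ` (conj_classes \<times> carrier G)"
    then obtain C y where C: "C \<in> conj_classes" and y: "y \<in> carrier G" and z: "z = F (C, y)" by blast
    define g where "g = y \<otimes> r C \<otimes> inv y"
    define u where "u = x C g"
    have rc: "r C \<in> carrier G" by (rule r[OF C])
    have u: "u \<in> carrier G" "g = u \<otimes> r C \<otimes> inv u" using x[OF y, of g C] by (simp_all add: g_def u_def)
    have gc: "g \<in> carrier G" using y rc by (simp add: g_def)
    have c: "inv v \<otimes> (v \<otimes> z) = z" if "v \<in> carrier G" "z \<in> carrier G" for v z
      using that by (simp flip: m_assoc)
    have "g \<otimes> (y \<otimes> inv u) = y \<otimes> r C \<otimes> inv u"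
      unfolding g_def using y rc u(1) by (simp add: m_assoc c)
    also have "\<dots> = (y \<otimes> inv u) \<otimes> (u \<otimes> r C \<otimes> inv u)"
      using y rc u(1) by (simp add: m_assoc c)
    also have "\<dots> = (y \<otimes> inv u) \<otimes> g" using u(2) by simp
    finally have "g \<otimes> (y \<otimes> inv u) = (y \<otimes> inv u) \<otimes> g" .
    moreover have "z = (g, y \<otimes> inv u)" by (simp add: z F_def g_def u_def)
    ultimately show "z \<in> ?P" using gc y u(1) by simp
  qed
  moreover have "finite ?P" by (rule finite_subset[of _ "carrier G \<times> carrier G"]) auto
  ultimately have "card (conj_classes \<times> carrier G) \<le> card ?P" by (rule card_inj_on_le)
  then show ?thesis by (simp add: card_cartesian_product order_def)
qed

end

lemma isomorphic_reps_refl: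
  assumes "irrep G n \<rho>"
  shows "isomorphic_reps G n \<rho> \<rho>"
proof (rule isomorphic_repsI[of "1\<^sub>m n"])
  fix g assume "g \<in> carrier G"
  then have "\<rho> g \<in> carrier_mat n n" using assms by (auto simp: irrep_def intro: rep_carrier)
  then show "1\<^sub>m n * \<rho> g = \<rho> g * 1\<^sub>m n" by simp
qed auto

lemma noniso_iff:
  "noniso G R \<longleftrightarrow> (\<forall>r\<in>R. irrep G (fst r) (snd r)) \<and>
    (\<forall>r\<in>R. \<forall>r'\<in>R. r \<noteq> r' \<longrightarrow> \<not> (fst r = fst r' \<and> isomorphic_reps G (fst r) (snd r) (snd r')))"
  unfolding noniso_def by (simp add: case_prod_unfold prod_eq_iff)

lemma noniso_subset: "noniso G R \<Longrightarrow> S \<subseteq> R \<Longrightarrow> noniso G S"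
  unfolding noniso_iff by (intro conjI ballI impI; meson in_mono)

lemma isomorphic_reps_cong:
  assumes "\<And>g. g \<in> carrier G \<Longrightarrow> \<rho> g = \<rho>' g" "\<And>g. g \<in> carrier G \<Longrightarrow> \<sigma> g = \<sigma>' g"
  shows "isomorphic_reps G n \<rho> \<sigma> \<longleftrightarrow> isomorphic_reps G n \<rho>' \<sigma>'"
  unfolding isomorphic_reps_def using assms by (intro bex_cong ball_cong) auto

context normal
begin

lemma inflate_iso_iff:
  "isomorphic_reps G n (\<lambda>g. \<sigma> (H #> g)) (\<lambda>g. \<tau> (H #> g)) \<longleftrightarrow> isomorphic_reps (G Mod H) n \<sigma> \<tau>"
  by (simp add: isomorphic_reps_def carrier_FactGroup)

lemma inflate_irreducible_iff:
  "irreducible_rep G n (\<lambda>g. \<sigma> (H #> g)) \<longleftrightarrow> irreducible_rep (G Mod H) n \<sigma>"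
  by (simp add: irreducible_rep_def carrier_FactGroup)

lemma inflate_irrep:
  assumes "irrep (G Mod H) n \<sigma>"
  shows "irrep G n (\<lambda>g. \<sigma> (H #> g))"
proof -
  have h: "\<sigma> \<in> hom (G Mod H) (GL n)" using assms by (simp add: irrep_def)
  have c: "H #> g \<in> carrier (G Mod H)" if "g \<in> carrier G" for g using that by (simp add: carrier_FactGroup)
  have "(\<lambda>g. \<sigma> (H #> g)) \<in> hom G (GL n)"
  proof (rule homI)
    fix g assume "g \<in> carrier G"
    then show "\<sigma> (H #> g) \<in> carrier (GL n)" by (intro hom_in_carrier[OF h] c)
  next
    fix g g' assume g: "g \<in> carrier G" "g' \<in> carrier G"
    then have "H #> (g \<otimes> g') = (H #> g) \<otimes>\<^bsub>G Mod H\<^esub> (H #> g')" by (simp add: rcos_sum)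
    then show "\<sigma> (H #> (g \<otimes> g')) = \<sigma> (H #> g) \<otimes>\<^bsub>GL n\<^esub> \<sigma> (H #> g')"
      using rep_mult[OF h c[OF g(1)] c[OF g(2)]] by simp
  qed
  then show ?thesis using assms inflate_irreducible_iff[of n \<sigma>] by (simp add: irrep_def)
qed

lemma inflate_trivial:
  assumes "irrep (G Mod H) n \<sigma>" "g \<in> H"
  shows "\<sigma> (H #> g) = 1\<^sub>m n"
proof -
  have "H #> g = \<one>\<^bsub>G Mod H\<^esub>" using coset_join2[OF _ is_subgroup assms(2)] subset assms(2) by auto
  then show ?thesis using rep_one[OF factorgroup_is_group] assms(1) by (metis irrep_def)
qed

lemma deflate_irrep:
  assumes \<rho>: "irrep G n \<rho>" and triv: "\<And>g. g \<in> H \<Longrightarrow> \<rho> g = 1\<^sub>m n"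
  obtains \<sigma> where "irrep (G Mod H) n \<sigma>" "\<And>g. g \<in> carrier G \<Longrightarrow> \<sigma> (H #> g) = \<rho> g"
proof -
  have h: "\<rho> \<in> hom G (GL n)" using \<rho> by (simp add: irrep_def)
  define \<sigma> where "\<sigma> C = \<rho> (SOME g. g \<in> C)" for C
  have \<sigma>: "\<sigma> (H #> g) = \<rho> g" if g: "g \<in> carrier G" for g
  proof -
    have "(SOME x. x \<in> H #> g) \<in> H #> g" by (rule someI[of _ g]) (rule rcos_self[OF g is_subgroup])
    then obtain k where k: "k \<in> H" "(SOME x. x \<in> H #> g) = k \<otimes> g" by (auto simp: r_coset_def)
    have "\<rho> (k \<otimes> g) = \<rho> k * \<rho> g" using rep_mult[OF h _ g] k(1) subset by blast
    also have "\<dots> = \<rho> g" using triv[OF k(1)] rep_carrier[OF h g] by simp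
    finally show ?thesis using k(2) by (simp add: \<sigma>_def)
  qed
  have "\<sigma> \<in> hom (G Mod H) (GL n)"
  proof (rule homI)
    fix C assume "C \<in> carrier (G Mod H)"
    then obtain g where g: "g \<in> carrier G" "C = H #> g" by (auto simp: carrier_FactGroup)
    show "\<sigma> C \<in> carrier (GL n)" unfolding g(2) \<sigma>[OF g(1)] by (rule hom_in_carrier[OF h g(1)])
  next
    fix C D assume "C \<in> carrier (G Mod H)" "D \<in> carrier (G Mod H)"
    then obtain g g' where g: "g \<in> carrier G" "C = H #> g" "g' \<in> carrier G" "D = H #> g'"
      by (auto simp: carrier_FactGroup)
    have "C \<otimes>\<^bsub>G Mod H\<^esub> D = H #> (g \<otimes> g')" using g by (simp add: rcos_sum)
    then show "\<sigma> (C \<otimes>\<^bsub>G Mod H\<^esub> D) = \<sigma> C \<otimes>\<^bsub>GL n\<^esub> \<sigma> D"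
      using g rep_mult[OF h g(1,3)] by (simp add: \<sigma>)
  qed
  moreover have "irreducible_rep (G Mod H) n \<sigma>"
    using \<rho> \<sigma> unfolding inflate_irreducible_iff[symmetric] by (simp add: irrep_def irreducible_rep_def)
  ultimately show thesis using that \<sigma> by (simp add: irrep_def)
qed

lemma finite_group_FactGroup: "finite (carrier (G Mod H)) \<Longrightarrow> finite_group (G Mod H)"
  by (simp add: finite_group_def finite_group_axioms_def factorgroup_is_group)

text \<open>Representations that are trivial on a normal subgroup are those of the quotient group, and
  the bound by conjugacy classes applies there.\<close>

lemma noniso_trivial_card_le:
  assumes fin: "finite (carrier (G Mod H))" and R: "noniso G R"
    and triv: "\<And>n \<rho> g. (n, \<rho>) \<in> R \<Longrightarrow> g \<in> H \<Longrightarrow> \<rho> g = 1\<^sub>m n"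
  shows "finite R \<and> card R \<le> card (finite_group.conj_classes (G Mod H))"
proof -
  interpret Q: finite_group "G Mod H" by (rule finite_group_FactGroup[OF fin])
  have irr: "irrep G n \<rho>" if "(n, \<rho>) \<in> R" for n \<rho> using R that by (auto simp: noniso_iff)
  have "\<exists>\<sigma>. irrep (G Mod H) (fst r) \<sigma> \<and> (\<forall>g\<in>carrier G. \<sigma> (H #> g) = snd r g)" if "r \<in> R" for r
  proof -
    have r: "(fst r, snd r) \<in> R" using that by simp
    show ?thesis
      by (rule deflate_irrep[OF irr[OF r] triv[OF r]]) blast+
  qed
  then obtain s where s: "\<And>r. r \<in> R \<Longrightarrow> irrep (G Mod H) (fst r) (s r)"
    "\<And>r g. r \<in> R \<Longrightarrow> g \<in> carrier G \<Longrightarrow> s r (H #> g) = snd r g" by metis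
  have iso: "isomorphic_reps G (fst r) (snd r) (snd r')"
    if "r \<in> R" "r' \<in> R" "isomorphic_reps (G Mod H) (fst r) (s r) (s r')" for r r'
    using that(3) unfolding inflate_iso_iff[symmetric]
    by (subst isomorphic_reps_cong[of G "snd r" "\<lambda>g. s r (H #> g)" "snd r'" "\<lambda>g. s r' (H #> g)"])
      (use that(1,2) s in auto)
  have non: "r = r'" if "r \<in> R" "r' \<in> R" "fst r = fst r'" "isomorphic_reps G (fst r) (snd r) (snd r')" for r r'
    using R that unfolding noniso_iff by blast
  note refl = isomorphic_reps_refl
  define d where "d r = (fst r, s r)" for r
  have inj: "inj_on d R"
  proof (rule inj_onI)
    fix r r' assume r: "r \<in> R" "r' \<in> R" and "d r = d r'"
    then have "fst r = fst r'" "s r = s r'" by (auto simp: d_def)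
    then show "r = r'" using non iso r refl[OF s(1)[OF r(1)]] by metis
  qed
  have dn: "noniso (G Mod H) (d ` R)"
    unfolding noniso_iff
  proof (intro conjI ballI, goal_cases)
    case (1 z)
    then show ?case using s by (auto simp: d_def)
  next
    case (2 z w)
    then obtain r r' where r: "r \<in> R" "r' \<in> R" "z = d r" "w = d r'" by blast
    then show ?case using non[OF r(1,2)] iso[OF r(1,2)] by (auto simp: d_def)
  qed
  have "finite (d ` R) \<and> card (d ` R) \<le> card Q.conj_classes"
  proof (rule finite_if_finite_subsets_card_bdd)
    fix S assume S: "S \<subseteq> d ` R" "finite S"
    have "noniso (G Mod H) S" using dn S(1) by (rule noniso_subset)
    then show "card S \<le> card Q.conj_classes" using S(2) by (rule Q.card_noniso_le)
  qed
  then show ?thesis using inj by (simp add: finite_image_iff card_image)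
qed

text \<open>The last conclusion, constancy on cosets, is what makes these representations continuous for a
  topology in which the cosets are open.\<close>

lemma exists_noniso_trivial:
  assumes fin: "finite (carrier (G Mod H))"
  obtains R where "noniso G R" "finite R" "card R = card (finite_group.conj_classes (G Mod H))"
    "(\<Sum>r\<in>R. fst r ^ 2) \<le> order (G Mod H)"
    "\<And>n \<rho> g. (n, \<rho>) \<in> R \<Longrightarrow> g \<in> H \<Longrightarrow> \<rho> g = 1\<^sub>m n"
    "\<And>n \<rho> g g'. (n, \<rho>) \<in> R \<Longrightarrow> g \<in> carrier G \<Longrightarrow> g' \<in> H #> g \<Longrightarrow> \<rho> g' = \<rho> g"
proof -
  interpret Q: finite_group "G Mod H" by (rule finite_group_FactGroup[OF fin])
  obtain S where S: "noniso (G Mod H) S" "finite S" "card S = card Q.conj_classes"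
    by (rule Q.exists_noniso_card_conj_classes)
  have irr: "irrep (G Mod H) n \<sigma>" if "(n, \<sigma>) \<in> S" for n \<sigma> using S that by (auto simp: noniso_iff)
  define d where "d r = (fst r, \<lambda>g. snd r (H #> g))" for r :: "nat \<times> ('a set \<Rightarrow> complex mat)"
  have non: "r = r'" if "r \<in> S" "r' \<in> S" "fst r = fst r'" "isomorphic_reps (G Mod H) (fst r) (snd r) (snd r')" for r r'
    using S(1) that unfolding noniso_iff by blast
  note refl = isomorphic_reps_refl
  have inj: "inj_on d S"
  proof (rule inj_onI)
    fix r r' assume r: "r \<in> S" "r' \<in> S" and e: "d r = d r'"
    have "irrep G (fst r) (\<lambda>g. snd r (H #> g))" using inflate_irrep irr r(1) by (metis prod.collapse)
    then have "isomorphic_reps G (fst r) (\<lambda>g. snd r (H #> g)) (\<lambda>g. snd r' (H #> g))"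
      using refl e by (metis d_def snd_conv)
    then show "r = r'" using non[OF r] e unfolding inflate_iso_iff by (simp add: d_def)
  qed
  show thesis
  proof (rule that[of "d ` S"])
    show "noniso G (d ` S)"
      unfolding noniso_iff
    proof (intro conjI ballI, goal_cases)
      case (1 z)
      then show ?case using inflate_irrep irr by (auto simp: d_def)
    next
      case (2 z w)
      then obtain r r' where r: "r \<in> S" "r' \<in> S" "z = d r" "w = d r'" by blast
      then show ?case using non[OF r(1,2)] inflate_iso_iff by (auto simp: d_def)
    qed
    show "finite (d ` S)" using S(2) by simp
    show "card (d ` S) = card Q.conj_classes" using S(3) inj by (simp add: card_image)
    have "(\<Sum>r\<in>d ` S. fst r ^ 2) = (\<Sum>r\<in>S. fst r ^ 2)"
      using inj by (subst sum.reindex) (simp_all add: d_def)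
    then show "(\<Sum>r\<in>d ` S. fst r ^ 2) \<le> order (G Mod H)" using Q.sum_squares_le[OF S(1,2)] by simp
    show "\<rho> g = 1\<^sub>m n" if "(n, \<rho>) \<in> d ` S" "g \<in> H" for n \<rho> g
      using that inflate_trivial irr by (auto simp: d_def)
    show "\<rho> g' = \<rho> g" if "(n, \<rho>) \<in> d ` S" "g \<in> carrier G" "g' \<in> H #> g" for n \<rho> g g'
      using that repr_independence[OF that(3,2) is_subgroup] by (auto simp: d_def)
  qed
qed

end

section \<open>Partial sums of the representation zeta function\<close>

lemma isomorphic_reps_trans:
  assumes "\<rho> \<in> hom G (GL n)" "\<sigma> \<in> hom G (GL n)" "\<tau> \<in> hom G (GL n)"
    and "isomorphic_reps G n \<rho> \<sigma>" "isomorphic_reps G n \<sigma> \<tau>"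
  shows "isomorphic_reps G n \<rho> \<tau>"
proof -
  obtain P P' where P: "P \<in> carrier_mat n n" "P' \<in> carrier_mat n n" "P' * P = 1\<^sub>m n" "P * P' = 1\<^sub>m n"
    "\<And>g. g \<in> carrier G \<Longrightarrow> P * \<rho> g = \<sigma> g * P"
    using assms(4) unfolding isomorphic_reps_def Units_ring_mat by blast
  obtain Q Q' where Q: "Q \<in> carrier_mat n n" "Q' \<in> carrier_mat n n" "Q' * Q = 1\<^sub>m n" "Q * Q' = 1\<^sub>m n"
    "\<And>g. g \<in> carrier G \<Longrightarrow> Q * \<sigma> g = \<tau> g * Q"
    using assms(5) unfolding isomorphic_reps_def Units_ring_mat by blast
  have "Determinant.det P \<noteq> 0" "Determinant.det Q \<noteq> 0"
    using Determinant.det_mult[OF P(2,1)] Determinant.det_mult[OF Q(2,1)] P(3) Q(3) by auto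
  then have "Determinant.det (Q * P) \<noteq> 0" using Determinant.det_mult[OF Q(1) P(1)] by simp
  moreover have "Q * P * \<rho> g = \<tau> g * (Q * P)" if g: "g \<in> carrier G" for g
  proof -
    note c = P(1) Q(1) rep_carrier[OF assms(1) g] rep_carrier[OF assms(2) g] rep_carrier[OF assms(3) g]
    have "Q * P * \<rho> g = Q * (\<sigma> g * P)" using assoc_mult_mat[OF c(2,1,3)] P(5)[OF g] by simp
    also have "\<dots> = \<tau> g * Q * P" using assoc_mult_mat[OF c(2,4,1)] Q(5)[OF g] by simp
    also have "\<dots> = \<tau> g * (Q * P)" using assoc_mult_mat[OF c(5,2,1)] .
    finally show ?thesis .
  qed
  ultimately show ?thesis using P(1) Q(1) by (intro isomorphic_repsI[of "Q * P"]) auto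
qed

lemma continuous_irreps_irrep: "\<rho> \<in> continuous_irreps G T n \<Longrightarrow> irrep G n \<rho>"
  by (auto simp: continuous_irreps_def continuous_reps_def irrep_def)

text \<open>The relation whose classes are counted by \<open>irrep_classes\<close>.\<close>

definition iso_rel where
  "iso_rel G T n = {(\<rho>, \<sigma>). \<rho> \<in> continuous_irreps G T n \<and> \<sigma> \<in> continuous_irreps G T n \<and>
               isomorphic_reps G n \<rho> \<sigma>}"

lemma equiv_iso_rel: "equiv (continuous_irreps G T n) (iso_rel G T n)"
proof (rule equivI)
  show "iso_rel G T n \<subseteq> continuous_irreps G T n \<times> continuous_irreps G T n" by (auto simp: iso_rel_def)
  show "refl_on (continuous_irreps G T n) (iso_rel G T n)"
    by (auto simp: refl_on_def iso_rel_def intro: isomorphic_reps_refl continuous_irreps_irrep)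
  have h: "\<rho> \<in> hom G (GL n)" if "\<rho> \<in> continuous_irreps G T n" for \<rho>
    using continuous_irreps_irrep[OF that] by (simp add: irrep_def)
  show "sym (iso_rel G T n)"
    unfolding sym_def iso_rel_def using isomorphic_reps_sym h by blast
  show "trans (iso_rel G T n)"
    unfolding trans_def iso_rel_def using isomorphic_reps_trans h by blast
qed

lemma irrep_classes_eq: "irrep_classes G T n = continuous_irreps G T n // iso_rel G T n"
  by (simp add: irrep_classes_def iso_rel_def)

definition continuous_noniso :: "('g, 'b) monoid_scheme \<Rightarrow> 'g topology \<Rightarrow> (nat \<times> ('g \<Rightarrow> complex mat)) set \<Rightarrow> bool" where
  "continuous_noniso G T R \<longleftrightarrow> noniso G R \<and> (\<forall>r\<in>R. snd r \<in> continuous_irreps G T (fst r))"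

text \<open>A set of pairwise nonisomorphic representations of dimension \<open>n\<close> has at most as many members
  as there are isomorphism classes in that dimension.\<close>

lemma sum_le_rep_zeta:
  assumes R: "continuous_noniso G T R" "finite R"
  shows "ennreal (\<Sum>r\<in>R. real (fst r) powr - s) \<le> rep_zeta G T s"
proof -
  define R' where "R' n = {r \<in> R. fst r = n}" for n
  define c where "c r = iso_rel G T (fst r) `` {snd r}" for r
  have ci: "snd r \<in> continuous_irreps G T (fst r)" if "r \<in> R" for r
    using R(1) that by (simp add: continuous_noniso_def)
  have pos: "fst r > 0" if "r \<in> R" for r
    using continuous_irreps_irrep[OF ci[OF that]] by (simp add: irrep_def irreducible_rep_def)
  have count: "enat (card (R' n)) \<le> irrep_count G T n" for n
  proof (cases "finite (irrep_classes G T n)")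
    case True
    have "inj_on c (R' n)"
    proof (rule inj_onI)
      fix r r' assume r: "r \<in> R' n" "r' \<in> R' n" and e: "c r = c r'"
      then have n: "fst r = n" "fst r' = n" "r \<in> R" "r' \<in> R" by (auto simp: R'_def)
      then have "(snd r, snd r') \<in> iso_rel G T n"
        using eq_equiv_class[OF _ equiv_iso_rel, of G T n "snd r" "snd r'"] e ci[of r'] by (simp add: c_def)
      then have "isomorphic_reps G n (snd r) (snd r')" by (simp add: iso_rel_def)
      then show "r = r'" using R(1) n unfolding continuous_noniso_def noniso_iff by metis
    qed
    moreover have "c ` R' n \<subseteq> irrep_classes G T n"
      using ci by (auto simp: c_def R'_def irrep_classes_eq intro: quotientI)
    ultimately have "card (R' n) \<le> card (irrep_classes G T n)" using True by (rule card_inj_on_le)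
    then show ?thesis using True by (simp add: irrep_count_def)
  qed (simp add: irrep_count_def)
  define M where "M = Max (insert 0 (fst ` R))"
  have M: "fst r \<le> M" if "r \<in> R" for r
    unfolding M_def by (rule Max_ge) (use that R(2) in auto)
  have "(\<Sum>r\<in>R. real (fst r) powr - s) = (\<Sum>i<M. \<Sum>r\<in>{r\<in>R. fst r - 1 = i}. real (fst r) powr - s)"
    by (rule sum.group[symmetric]) (use R(2) M pos in force)+
  also have "\<dots> = (\<Sum>i<M. \<Sum>r\<in>R' (Suc i). real (Suc i) powr - s)"
  proof (rule sum.cong[OF refl])
    fix i
    have "{r\<in>R. fst r - 1 = i} = R' (Suc i)" using pos by (fastforce simp: R'_def)
    then show "(\<Sum>r\<in>{r\<in>R. fst r - 1 = i}. real (fst r) powr - s) = (\<Sum>r\<in>R' (Suc i). real (Suc i) powr - s)"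
      by (intro sum.cong) (auto simp: R'_def)
  qed
  also have "\<dots> = (\<Sum>i<M. real (card (R' (Suc i))) * real (Suc i) powr - s)" by simp
  finally have "ennreal (\<Sum>r\<in>R. real (fst r) powr - s) = (\<Sum>i<M. ennreal (real (card (R' (Suc i))) * real (Suc i) powr - s))"
    by (simp add: sum_ennreal)
  also have "\<dots> \<le> (\<Sum>i<M. ennreal_of_enat (irrep_count G T (Suc i)) * ennreal (real (Suc i) powr - s))"
  proof (rule sum_mono)
    fix i
    have "ennreal (real (card (R' (Suc i))) * real (Suc i) powr - s) =
        ennreal_of_enat (enat (card (R' (Suc i)))) * ennreal (real (Suc i) powr - s)"
      by (simp add: ennreal_mult ennreal_of_nat_eq_real_of_nat)
    also have "\<dots> \<le> ennreal_of_enat (irrep_count G T (Suc i)) * ennreal (real (Suc i) powr - s)"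
    proof (rule mult_right_mono)
      show "ennreal_of_enat (enat (card (R' (Suc i)))) \<le> ennreal_of_enat (irrep_count G T (Suc i))"
        unfolding ennreal_of_enat_le_iff by (rule count)
    qed simp
    finally show "ennreal (real (card (R' (Suc i))) * real (Suc i) powr - s) \<le> \<dots>" .
  qed
  also have "\<dots> \<le> rep_zeta G T s"
    unfolding rep_zeta_def by (rule sum_le_suminf) auto
  finally show ?thesis .
qed

text \<open>Choosing a representative of each class turns a finite partial sum of the series into a sum over
  a finite set of pairwise nonisomorphic representations.  The same argument shows that there are
  finitely many classes in each dimension, since arbitrarily many of them would exceed \<open>B\<close>.\<close>

lemma rep_zeta_le:
  assumes B: "\<And>R. continuous_noniso G T R \<Longrightarrow> finite R \<Longrightarrow> (\<Sum>r\<in>R. real (fst r) powr - s) \<le> B"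
  shows "rep_zeta G T s \<le> ennreal B"
proof -
  define p where "p C = (SOME \<rho>. \<rho> \<in> C)" for C :: "('a \<Rightarrow> complex mat) set"
  have p: "p C \<in> C" "p C \<in> continuous_irreps G T n" if C: "C \<in> irrep_classes G T n" for C n
  proof -
    obtain \<rho> where \<rho>: "\<rho> \<in> continuous_irreps G T n" "C = iso_rel G T n `` {\<rho>}"
      using C unfolding irrep_classes_eq by (auto elim: quotientE)
    have "\<rho> \<in> C" using equiv_class_self[OF equiv_iso_rel \<rho>(1)] \<rho>(2) by simp
    then show "p C \<in> C" unfolding p_def by (rule someI[of "\<lambda>\<rho>. \<rho> \<in> C"])
    then show "p C \<in> continuous_irreps G T n" using \<rho>(2) by (auto simp: iso_rel_def)
  qed
  have bound: "(\<Sum>z\<in>Z. real (fst z) powr - s) \<le> B" if Z: "finite Z" "Z \<subseteq> Sigma UNIV (irrep_classes G T)" for Z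
  proof -
    define d where "d z = (fst z, p (snd z))" for z :: "nat \<times> ('a \<Rightarrow> complex mat) set"
    have zc: "snd z \<in> irrep_classes G T (fst z)" if "z \<in> Z" for z using Z that by auto
    have same: "z = z'" if z: "z \<in> Z" "z' \<in> Z" and e: "fst z = fst z'" 
      "isomorphic_reps G (fst z) (p (snd z)) (p (snd z'))" for z z'
    proof -
      have zc': "snd z' \<in> irrep_classes G T (fst z)" using zc[OF z(2)] e(1) by simp
      have "(p (snd z), p (snd z')) \<in> iso_rel G T (fst z)"
        using e(2) p(2)[OF zc[OF z(1)]] p(2)[OF zc'] by (simp add: iso_rel_def)
      then have "snd z = snd z'"
        using quotient_eqI[OF equiv_iso_rel] zc[OF z(1)] zc' p(1)[OF zc[OF z(1)]] p(1)[OF zc']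
        unfolding irrep_classes_eq by metis
      then show "z = z'" using e(1) by (simp add: prod_eq_iff)
    qed
    have "inj_on d Z"
    proof (rule inj_onI)
      fix z z' assume z: "z \<in> Z" "z' \<in> Z" and "d z = d z'"
      then have e: "fst z = fst z'" "p (snd z) = p (snd z')" by (auto simp: d_def)
      have "isomorphic_reps G (fst z) (p (snd z)) (p (snd z))"
        using p(2)[OF zc[OF z(1)]] by (intro isomorphic_reps_refl continuous_irreps_irrep)
      then show "z = z'" using same[OF z e(1)] e(2) by simp
    qed
    moreover have "continuous_noniso G T (d ` Z)"
      unfolding continuous_noniso_def noniso_iff
    proof (intro conjI ballI impI, goal_cases)
      case (1 r)
      then show ?case using p(2) zc continuous_irreps_irrep by (fastforce simp: d_def)
    next
      case (2 r r')
      then obtain z z' where z: "z \<in> Z" "z' \<in> Z" "r = d z" "r' = d z'" by blast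
      then show ?case using same[OF z(1,2)] 2 by (auto simp: d_def)
    next
      case (3 r)
      then show ?case using p(2) zc by (fastforce simp: d_def)
    qed
    then have "(\<Sum>r\<in>d ` Z. real (fst r) powr - s) \<le> B" using Z(1) by (intro B) auto
    ultimately show ?thesis by (subst (asm) sum.reindex) (simp_all add: d_def)
  qed
  have fin: "finite (irrep_classes G T n)" if n: "n > 0" for n
  proof (rule ccontr)
    assume inf: "infinite (irrep_classes G T n)"
    obtain m :: nat where m: "B / (real n powr - s) < real m" using reals_Archimedean2 by blast
    obtain S where S: "finite S" "card S = m" "S \<subseteq> irrep_classes G T n"
      using infinite_arbitrarily_large[OF inf] by blast
    have "(\<Sum>z\<in>Pair n ` S. real (fst z) powr - s) \<le> B"
      by (rule bound) (use S in auto)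
    then have "real m * real n powr - s \<le> B"
      using S(2) by (subst (asm) sum.reindex) (auto simp: inj_on_def)
    moreover have "real n powr - s > 0" using n by simp
    ultimately show False using m by (simp add: pos_divide_less_eq)
  qed
  show ?thesis
    unfolding rep_zeta_def
  proof (rule suminf_le_const[OF summableI])
    fix M
    define Z where "Z = Sigma (Suc ` {..<M}) (irrep_classes G T)"
    have finZ: "finite Z" unfolding Z_def using fin by (intro finite_SigmaI) auto
    have "(\<Sum>i<M. ennreal_of_enat (irrep_count G T (Suc i)) * ennreal (real (Suc i) powr - s)) =
      (\<Sum>i<M. ennreal (real (card (irrep_classes G T (Suc i))) * real (Suc i) powr - s))"
    proof (rule sum.cong[OF refl])
      fix i
      show "ennreal_of_enat (irrep_count G T (Suc i)) * ennreal (real (Suc i) powr - s) =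
        ennreal (real (card (irrep_classes G T (Suc i))) * real (Suc i) powr - s)"
        using fin[of "Suc i"] by (simp add: irrep_count_def ennreal_mult ennreal_of_nat_eq_real_of_nat)
    qed
    also have "\<dots> = ennreal (\<Sum>i<M. real (card (irrep_classes G T (Suc i))) * real (Suc i) powr - s)"
      by (simp add: sum_ennreal)
    also have "(\<Sum>i<M. real (card (irrep_classes G T (Suc i))) * real (Suc i) powr - s) =
      (\<Sum>n\<in>Suc ` {..<M}. \<Sum>C\<in>irrep_classes G T n. real n powr - s)"
      by (subst sum.reindex) auto
    also have "\<dots> = (\<Sum>z\<in>Z. real (fst z) powr - s)"
      unfolding Z_def by (subst sum.Sigma) (auto simp: fin case_prod_unfold)
    also have "ennreal \<dots> \<le> ennreal B"
      by (rule ennreal_leI, rule bound[OF finZ]) (auto simp: Z_def)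
    finally show "(\<Sum>i<M. ennreal_of_enat (irrep_count G T (Suc i)) * ennreal (real (Suc i) powr - s)) \<le> ennreal B" .
  qed
qed

section \<open>Congruences modulo powers of a uniformizer\<close>

lemma card_Sigma_le:
  assumes "finite A" "\<And>a. a \<in> A \<Longrightarrow> finite (B a)" "\<And>a. a \<in> A \<Longrightarrow> card (B a) \<le> m"
  shows "card (Sigma A B) \<le> card A * m"
proof -
  have "card (Sigma A B) = (\<Sum>a\<in>A. card (B a))" using assms(1,2) by (simp add: card_SigmaI)
  also have "\<dots> \<le> (\<Sum>a\<in>A. m)" by (rule sum_mono) (rule assms(3))
  finally show ?thesis by simp
qed

text \<open>The properties of a discrete valuation ring of characteristic two with finite residue field that
  are used below, expressed by divisibility through a generator \<open>t\<close> of the maximal ideal.\<close>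

locale char_two_uniformizer =
  fixes t :: "'a::idom"
  assumes t_nonzero: "t \<noteq> 0"
    and t_nonunit: "\<not> t dvd 1"
    and dvd_or_unit: "t dvd x \<or> x dvd 1"
    and two_eq_zero: "(1::'a) + 1 = 0"
    and finite_residues: "\<exists>S. finite S \<and> (\<forall>x. \<exists>y\<in>S. t dvd x - y)"
begin

lemma add_self [simp]: "x + x = (0::'a)"
proof -
  have "x + x = (1 + 1) * x" by (simp only: distrib_right mult_1)
  then show ?thesis by (simp only: two_eq_zero mult_zero_left)
qed

text \<open>As simplification rules this fact and the next two remove all signs: every identity of integral
  polynomials becomes one over the field with two elements.\<close>

lemma minus_eq [simp]: "- x = (x::'a)"
  using add_self[of x] by (simp only: neg_eq_iff_add_eq_0)

lemma diff_eq [simp]: "x - y = (x::'a) + y"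
  by (simp only: diff_conv_add_uminus minus_eq)

lemma add_self_left [simp]: "x + (x + y) = (y::'a)"
  by (simp flip: add.assoc)

lemma unit_iff: "u dvd 1 \<longleftrightarrow> \<not> t dvd u"
  using dvd_or_unit t_nonunit dvd_trans by blast

lemma pow_dvd_cancel:
  assumes "i \<le> k"
  shows "t ^ k dvd t ^ i * y \<longleftrightarrow> t ^ (k - i) dvd y"
proof -
  have "t ^ k = t ^ i * t ^ (k - i)" using assms by (simp flip: power_add)
  then show ?thesis using t_nonzero by simp
qed

lemma unit_dvd_cancel:
  fixes u x y :: 'a
  assumes "u dvd 1"
  shows "x dvd u * y \<longleftrightarrow> x dvd y"
proof
  obtain v where v: "1 = u * v" using assms by (auto elim: dvdE)
  assume "x dvd u * y"
  then have "x dvd v * (u * y)" by (rule dvd_mult)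
  also have "v * (u * y) = (u * v) * y" by (simp only: ac_simps)
  also have "\<dots> = y" by (simp flip: v)
  finally show "x dvd y" .
qed (rule dvd_mult)

text \<open>The number \<open>i\<close> is the valuation of \<open>x\<close>, capped at \<open>k\<close>.  The congruence modulo \<open>t\<^sup>k\<close> also
  covers elements that are divisible by \<open>t\<^sup>k\<close>, with \<open>i = k\<close> and any unit.\<close>

definition valuation_form :: "nat \<Rightarrow> nat \<Rightarrow> 'a \<Rightarrow> bool" where
  "valuation_form k i x \<longleftrightarrow> i \<le> k \<and> (\<exists>u. u dvd 1 \<and> t ^ k dvd x - t ^ i * u)"

lemma valuation_form_exists: "\<exists>i. valuation_form k i x"
proof (induction k arbitrary: x)
  case 0
  show ?case by (auto simp: valuation_form_def intro!: exI[of _ 1])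
next
  case (Suc k)
  show ?case
  proof (cases "t dvd x")
    case True
    then obtain y where y: "x = t * y" by (auto elim: dvdE)
    obtain i u where i: "i \<le> k" "u dvd 1" "t ^ k dvd y - t ^ i * u"
      using Suc[of y] by (auto simp: valuation_form_def)
    have "x - t ^ Suc i * u = t * (y - t ^ i * u)" by (simp add: y algebra_simps)
    then have "t ^ Suc k dvd x - t ^ Suc i * u" using i(3) by (simp add: mult_dvd_mono)
    then show ?thesis using i by (auto simp: valuation_form_def intro!: exI[of _ "Suc i"])
  next
    case False
    then have "x dvd 1" by (simp add: unit_iff)
    then show ?thesis by (auto simp: valuation_form_def intro!: exI[of _ 0] exI[of _ x])
  qed
qed

lemma valuation_form_dvd:
  assumes "valuation_form k i x"
  shows "t ^ i dvd x"
proof -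
  obtain u where "i \<le> k" "t ^ k dvd x - t ^ i * u" using assms by (auto simp: valuation_form_def)
  then have "t ^ i dvd x - t ^ i * u" using le_imp_power_dvd dvd_trans by blast
  then have "t ^ i dvd (x - t ^ i * u) + t ^ i * u" by (rule dvd_add) simp
  then show ?thesis by (simp add: add.assoc)
qed

lemma valuation_form_cancel:
  assumes x: "valuation_form k i x" and d: "t ^ k dvd x * d"
  shows "t ^ (k - i) dvd d"
proof -
  obtain u where u: "i \<le> k" "u dvd 1" "t ^ k dvd x - t ^ i * u" using x by (auto simp: valuation_form_def)
  have "t ^ k dvd (x - t ^ i * u) * d" using u(3) by (rule dvd_mult2)
  then have "t ^ k dvd x * d - (x - t ^ i * u) * d" using d by (intro dvd_diff)
  also have "x * d - (x - t ^ i * u) * d = t ^ i * (u * d)" by (simp add: algebra_simps)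
  finally show ?thesis using u by (simp add: pow_dvd_cancel unit_dvd_cancel)
qed

lemma dvd_mult_split:
  assumes "t ^ k dvd x * y"
  obtains e where "e \<le> k" "t ^ e dvd x" "t ^ (k - e) dvd y"
  using valuation_form_exists[of k x] valuation_form_dvd valuation_form_cancel[OF _ assms]
  by (metis valuation_form_def)

text \<open>A canonical representative of the residue class modulo \<open>t\<^sup>k\<close>.  The finite quotient rings are
  replaced by these representatives inside the ring itself.\<close>

definition red :: "nat \<Rightarrow> 'a \<Rightarrow> 'a" where
  "red k x = (SOME y. t ^ k dvd x - y)"

definition residues :: "nat \<Rightarrow> 'a set" where
  "residues k = range (red k)"

text \<open>The order of the residue field.\<close>

definition q :: nat where "q = card (residues 1)"

lemma red_dvd: "t ^ k dvd x - red k x"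
  unfolding red_def by (rule someI[of _ x]) simp

lemma red_eq_iff: "red k x = red k y \<longleftrightarrow> t ^ k dvd x - y"
proof
  assume e: "red k x = red k y"
  have "t ^ k dvd (x - red k x) - (y - red k y)" by (intro dvd_diff red_dvd)
  then show "t ^ k dvd x - y" by (simp add: e ac_simps)
next
  assume d: "t ^ k dvd x - y"
  have "t ^ k dvd x - z \<longleftrightarrow> t ^ k dvd y - z" for z
  proof -
    have "x - z = (x - y) + (y - z)" by (simp add: ac_simps)
    then show ?thesis using d by (simp only: dvd_add_right_iff)
  qed
  then show "red k x = red k y" by (simp only: red_def)
qed

lemma red_in [simp]: "red k x \<in> residues k"
  by (simp add: residues_def)

lemma red_residue: "x \<in> residues k \<Longrightarrow> red k x = x"
proof -
  have "red k (red k z) = red k z" for z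
    using red_dvd[of k z] by (simp add: red_eq_iff add.commute)
  then show "x \<in> residues k \<Longrightarrow> red k x = x" unfolding residues_def by blast
qed

lemma residues_eqI: "x \<in> residues k \<Longrightarrow> y \<in> residues k \<Longrightarrow> t ^ k dvd x - y \<Longrightarrow> x = y"
  by (metis red_eq_iff red_residue)

lemma residues_0: "card (residues 0) = 1" "finite (residues 0)"
proof -
  have "residues 0 = {red 0 0}" by (auto simp: residues_def red_eq_iff)
  then show "card (residues 0) = 1" "finite (residues 0)" by simp_all
qed

lemma finite_residues_1: "finite (residues 1)"
proof -
  obtain S where S: "finite S" "\<forall>x. \<exists>y\<in>S. t dvd x - y" using finite_residues by blast
  have "residues 1 \<subseteq> red 1 ` S"
  proof
    fix z assume "z \<in> residues 1"
    then obtain x where x: "z = red 1 x" by (auto simp: residues_def)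
    obtain y where "y \<in> S" "t dvd x - y" using S by blast
    then show "z \<in> red 1 ` S" by (auto simp: x red_eq_iff intro!: image_eqI[of _ _ y])
  qed
  then show ?thesis using S finite_subset by blast
qed

text \<open>The first digit of the \<open>t\<close>-adic expansion and the remaining ones.\<close>

lemma residues_Suc:
  "bij_betw (\<lambda>(a, y). red (Suc k) (a + t * y)) (residues 1 \<times> residues k) (residues (Suc k))"
  unfolding bij_betw_def
proof
  show "inj_on (\<lambda>(a, y). red (Suc k) (a + t * y)) (residues 1 \<times> residues k)"
  proof (rule inj_onI, clarify)
    fix a y a' y' assume r: "a \<in> residues 1" "y \<in> residues k" "a' \<in> residues 1" "y' \<in> residues k"
      and "red (Suc k) (a + t * y) = red (Suc k) (a' + t * y')"
    then have d: "t * t ^ k dvd (a + t * y) - (a' + t * y')" by (simp only: red_eq_iff power_Suc)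
    then have "t dvd (a + t * y) - (a' + t * y')" by (rule dvd_mult_left)
    then have "t dvd ((a + t * y) - (a' + t * y')) - t * (y - y')" by (rule dvd_diff) simp
    also have "((a + t * y) - (a' + t * y')) - t * (y - y') = a - a'" by (simp add: algebra_simps)
    finally have a: "a = a'" using r by (intro residues_eqI[of _ 1]) simp_all
    have "(a + t * y) - (a' + t * y') = t * (y - y')" unfolding a by (simp add: algebra_simps)
    then have "t ^ k dvd y - y'" using d t_nonzero by simp
    then show "a = a' \<and> y = y'" using a r residues_eqI by blast
  qed
  show "(\<lambda>(a, y). red (Suc k) (a + t * y)) ` (residues 1 \<times> residues k) = residues (Suc k)"
  proof
    show "residues (Suc k) \<subseteq> (\<lambda>(a, y). red (Suc k) (a + t * y)) ` (residues 1 \<times> residues k)"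
    proof
      fix z assume "z \<in> residues (Suc k)"
      then obtain x where x: "z = red (Suc k) x" by (auto simp: residues_def)
      have "t dvd x - red 1 x" using red_dvd[of 1 x] by simp
      then obtain y where y: "x - red 1 x = t * y" by (auto elim: dvdE)
      have "t * t ^ k dvd t * (y - red k y)" by (intro mult_dvd_mono red_dvd dvd_refl)
      also have "t * (y - red k y) = x - (red 1 x + t * red k y)"
        using y by (simp add: algebra_simps flip: add.assoc)
      finally have "z = red (Suc k) (red 1 x + t * red k y)"
        unfolding x red_eq_iff power_Suc .
      then show "z \<in> (\<lambda>(a, y). red (Suc k) (a + t * y)) ` (residues 1 \<times> residues k)" 
        by (intro image_eqI[of _ _ "(red 1 x, red k y)"]) auto
    qed
  qed auto
qed

lemma card_residues: "finite (residues k) \<and> card (residues k) = q ^ k"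
proof (induction k)
  case (Suc k)
  have "finite (residues 1 \<times> residues k)" using Suc finite_residues_1 by simp
  then have "finite (residues (Suc k))" using bij_betw_finite[OF residues_Suc] by blast
  moreover have "card (residues (Suc k)) = card (residues 1 \<times> residues k)"
    using bij_betw_same_card[OF residues_Suc] by simp
  ultimately show ?case using Suc by (simp add: card_cartesian_product q_def)
qed (use residues_0 in simp)

lemma finite_res [simp]: "finite (residues k)"
  using card_residues by blast

lemma q_ge_2: "q \<ge> 2"
proof -
  have "red 1 0 \<noteq> red 1 1" using t_nonunit by (simp add: red_eq_iff)
  then have "card {red 1 0, red 1 1} = 2" by simp
  moreover have "card {red 1 0, red 1 1} \<le> card (residues 1)"
    by (rule card_mono) auto
  ultimately show ?thesis by (simp add: q_def)
qed

lemma card_congruent_le: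
  assumes "m \<le> k"
  shows "card {x \<in> residues k. t ^ m dvd x - y} \<le> q ^ (k - m)"
proof -
  have "{x \<in> residues k. t ^ m dvd x - y} \<subseteq> (\<lambda>z. red k (y + t ^ m * z)) ` residues (k - m)"
  proof clarify
    fix x assume x: "x \<in> residues k" and "t ^ m dvd x - y"
    then obtain z where z: "x - y = t ^ m * z" by (auto elim: dvdE)
    have "t ^ m * t ^ (k - m) dvd t ^ m * (z - red (k - m) z)" by (intro mult_dvd_mono red_dvd dvd_refl)
    also have "t ^ m * t ^ (k - m) = t ^ k" using assms by (simp flip: power_add)
    also have "t ^ m * (z - red (k - m) z) = x - (y + t ^ m * red (k - m) z)"
      using z by (simp add: algebra_simps flip: add.assoc)
    finally have "red k x = red k (y + t ^ m * red (k - m) z)" by (simp only: red_eq_iff)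
    moreover have "red k x = x" using x by (rule red_residue)
    ultimately show "x \<in> (\<lambda>z. red k (y + t ^ m * z)) ` residues (k - m)" by auto
  qed
  then have "card {x \<in> residues k. t ^ m dvd x - y} \<le> card (residues (k - m))"
    by (rule surj_card_le[rotated]) simp
  then show ?thesis using card_residues by simp
qed

lemma card_multiples_le: "m \<le> k \<Longrightarrow> card {x \<in> residues k. t ^ m dvd x} \<le> q ^ (k - m)"
  using card_congruent_le[of m k 0] by simp

text \<open>Two solutions differ by a multiple of \<open>t\<^sup>k\<^sup>-\<^sup>i\<close>.\<close>

lemma card_linear_le:
  assumes b: "valuation_form k i b"
  shows "card {x \<in> residues k. t ^ k dvd b * x - s} \<le> q ^ i"
proof (cases "\<exists>x0. t ^ k dvd b * x0 - s")
  case True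
  then obtain x0 where x0: "t ^ k dvd b * x0 - s" by blast
  have ik: "i \<le> k" using b by (simp add: valuation_form_def)
  have "{x \<in> residues k. t ^ k dvd b * x - s} \<subseteq> {x \<in> residues k. t ^ (k - i) dvd x - x0}"
  proof clarify
    fix x assume "t ^ k dvd b * x - s"
    then have "t ^ k dvd (b * x - s) - (b * x0 - s)" using x0 by (rule dvd_diff)
    also have "(b * x - s) - (b * x0 - s) = b * (x - x0)" by (simp add: algebra_simps)
    finally show "t ^ (k - i) dvd x - x0" by (rule valuation_form_cancel[OF b])
  qed
  then have "card {x \<in> residues k. t ^ k dvd b * x - s} \<le> card {x \<in> residues k. t ^ (k - i) dvd x - x0}"
    by (intro card_mono) auto
  also have "\<dots> \<le> q ^ i" using card_congruent_le[of "k - i" k x0] ik by simp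
  finally show ?thesis .
next
  case False
  then have e: "{x \<in> residues k. t ^ k dvd b * x - s} = {}" by blast
  show ?thesis unfolding e by simp
qed

text \<open>The map \<open>a \<mapsto> a\<^sup>2 + \<alpha> a\<close> is additive in characteristic two, so the solutions of a quadratic
  congruence form a coset of the roots of \<open>d (d + \<alpha>)\<close>.\<close>

lemma quadratic_difference:
  assumes "t ^ k dvd a * a + \<alpha> * a + c" "t ^ k dvd a0 * a0 + \<alpha> * a0 + c"
  shows "t ^ k dvd (a - a0) * ((a - a0) + \<alpha>)"
proof -
  have "t ^ k dvd (a * a + \<alpha> * a + c) - (a0 * a0 + \<alpha> * a0 + c)" using assms by (rule dvd_diff)
  also have "(a * a + \<alpha> * a + c) - (a0 * a0 + \<alpha> * a0 + c) = (a - a0) * ((a - a0) + \<alpha>)"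
    by (simp add: algebra_simps)
  finally show ?thesis .
qed

lemma card_two_classes:
  assumes "S \<subseteq> {a \<in> residues k. t ^ m dvd a - y \<or> t ^ m dvd a - z}" "m \<le> k"
  shows "card S \<le> 2 * q ^ (k - m)"
proof -
  have "card S \<le> card ({a \<in> residues k. t ^ m dvd a - y} \<union> {a \<in> residues k. t ^ m dvd a - z})"
    using assms(1) by (intro card_mono) auto
  also have "\<dots> \<le> card {a \<in> residues k. t ^ m dvd a - y} + card {a \<in> residues k. t ^ m dvd a - z}"
    by (rule card_Un_le)
  also have "\<dots> \<le> 2 * q ^ (k - m)"
    using card_congruent_le[OF assms(2), of y] card_congruent_le[OF assms(2), of z] by linarith
  finally show ?thesis .
qed

text \<open>If \<open>d\<close> is not divisible by \<open>t\<^sup>k\<^sup>-\<^sup>j\<close>, then \<open>d + \<alpha>\<close> is divisible by a higher power of \<open>t\<close> than \<open>\<alpha>\<close>, so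
  \<open>d\<close> has the same valuation \<open>j\<close> as \<open>\<alpha>\<close>, and \<open>d + \<alpha>\<close> is divisible by \<open>t\<^sup>k\<^sup>-\<^sup>j\<close>.\<close>

lemma card_quadratic_le:
  assumes \<alpha>: "valuation_form k j \<alpha>"
  shows "card {a \<in> residues k. t ^ k dvd a * a + \<alpha> * a + c} \<le> 2 * q ^ j"
proof (cases "\<exists>a0. t ^ k dvd a0 * a0 + \<alpha> * a0 + c")
  case True
  then obtain a0 where a0: "t ^ k dvd a0 * a0 + \<alpha> * a0 + c" by blast
  obtain u where u: "j \<le> k" "u dvd 1" "t ^ k dvd \<alpha> - t ^ j * u" using \<alpha> by (auto simp: valuation_form_def)
  have "t ^ (k - j) dvd a - a0 \<or> t ^ (k - j) dvd a - (a0 + \<alpha>)" 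
    if a: "t ^ k dvd a * a + \<alpha> * a + c" for a
  proof -
    define d where "d = a - a0"
    have d: "t ^ k dvd d * (d + \<alpha>)" unfolding d_def by (rule quadratic_difference[OF a a0])
    then obtain e where e: "e \<le> k" "t ^ e dvd d" "t ^ (k - e) dvd d + \<alpha>" by (rule dvd_mult_split)
    show ?thesis
    proof (cases "k - j \<le> e")
      case True
      then have "t ^ (k - j) dvd d" using e(2) le_imp_power_dvd dvd_trans by blast
      then show ?thesis by (simp add: d_def)
    next
      case False
      then have je: "Suc j \<le> k - e" "Suc j \<le> k" by auto
      have "t ^ Suc j dvd d + \<alpha>" using e(3) je(1) le_imp_power_dvd dvd_trans by blast
      moreover have "t ^ Suc j dvd \<alpha> - t ^ j * u" using u(3) je(2) le_imp_power_dvd dvd_trans by blast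
      ultimately have "t ^ Suc j dvd (d + \<alpha>) + (\<alpha> - t ^ j * u)" by (rule dvd_add)
      then have "t ^ Suc j dvd d + t ^ j * u" by (simp add: ac_simps)
      then obtain w where w: "d + t ^ j * u = t ^ Suc j * w" by (auto elim: dvdE)
      have "d = (d + t ^ j * u) - t ^ j * u" by (simp add: add.assoc)
      then have "d = t ^ Suc j * w - t ^ j * u" by (simp only: w)
      then have dw: "d = t ^ j * (t * w - u)" by (simp add: algebra_simps)
      have "\<not> t dvd u" using u(2) unit_iff by blast
      then have "\<not> t dvd t * w - u" by (simp add: dvd_add_right_iff)
      then have "valuation_form k j d"
        using u(1) unfolding valuation_form_def unit_iff by (intro conjI exI[of _ "t * w - u"]) (auto simp: dw)
      then have "t ^ (k - j) dvd d + \<alpha>" using d by (rule valuation_form_cancel)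
      then show ?thesis by (simp add: d_def add.assoc)
    qed
  qed
  then have "{a \<in> residues k. t ^ k dvd a * a + \<alpha> * a + c} \<subseteq> 
      {a \<in> residues k. t ^ (k - j) dvd a - a0 \<or> t ^ (k - j) dvd a - (a0 + \<alpha>)}" by blast
  from card_two_classes[OF this] show ?thesis using u(1) by simp
next
  case False
  then have e: "{a \<in> residues k. t ^ k dvd a * a + \<alpha> * a + c} = {}" by blast
  show ?thesis unfolding e by simp
qed

text \<open>One of the factors \<open>d\<close> and \<open>d + \<alpha>\<close> is divisible by at least half of the power \<open>t\<^sup>m\<close>.  This bound
  takes over when \<open>\<alpha>\<close> is divisible by a high power of \<open>t\<close>.\<close>

lemma card_quadratic_le_half:
  assumes m: "m \<le> k"
  shows "card {a \<in> residues k. t ^ m dvd a * a + \<alpha> * a + c} \<le> 2 * q ^ (k - m + m div 2)"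
proof (cases "\<exists>a0. t ^ m dvd a0 * a0 + \<alpha> * a0 + c")
  case True
  then obtain a0 where a0: "t ^ m dvd a0 * a0 + \<alpha> * a0 + c" by blast
  have "t ^ (m - m div 2) dvd a - a0 \<or> t ^ (m - m div 2) dvd a - (a0 + \<alpha>)" 
    if a: "t ^ m dvd a * a + \<alpha> * a + c" for a
  proof -
    obtain e where e: "e \<le> m" "t ^ e dvd a - a0" "t ^ (m - e) dvd (a - a0) + \<alpha>" 
      using quadratic_difference[OF a a0] by (rule dvd_mult_split)
    show ?thesis
    proof (cases "m - m div 2 \<le> e")
      case True
      then show ?thesis using e(2) le_imp_power_dvd dvd_trans by blast
    next
      case False
      then have "m - m div 2 \<le> m - e" by linarith
      then have "t ^ (m - m div 2) dvd (a - a0) + \<alpha>" using e(3) le_imp_power_dvd dvd_trans by blast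
      then show ?thesis by (simp add: add.assoc)
    qed
  qed
  then have "{a \<in> residues k. t ^ m dvd a * a + \<alpha> * a + c} \<subseteq> 
      {a \<in> residues k. t ^ (m - m div 2) dvd a - a0 \<or> t ^ (m - m div 2) dvd a - (a0 + \<alpha>)}" by blast
  from card_two_classes[OF this] have "card {a \<in> residues k. t ^ m dvd a * a + \<alpha> * a + c} \<le> 2 * q ^ (k - (m - m div 2))"
    using m by simp
  also have "k - (m - m div 2) = k - m + m div 2" using m by linarith
  finally show ?thesis .
next
  case False
  then have e: "{a \<in> residues k. t ^ m dvd a * a + \<alpha> * a + c} = {}" by blast
  show ?thesis unfolding e by simp
qed

section \<open>Counting commuting pairs\<close>

definition residues_val :: "nat \<Rightarrow> nat \<Rightarrow> 'a set" where
  "residues_val k i = {x \<in> residues k. valuation_form k i x}"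

lemma finite_residues_val [simp]: "finite (residues_val k i)"
  by (simp add: residues_val_def)

lemma card_residues_val_le:
  assumes "i \<le> k"
  shows "card (residues_val k i) \<le> q ^ (k - i)"
proof -
  have "card (residues_val k i) \<le> card {x \<in> residues k. t ^ i dvd x}"
    by (rule card_mono) (auto simp: residues_val_def intro: valuation_form_dvd)
  then show ?thesis using card_multiples_le[OF assms] by simp
qed

text \<open>There are at most \<open>q\<^sup>k\<^sup>-\<^sup>m\<close> factors \<open>f\<close> of valuation \<open>m\<close>, and each leaves at most \<open>q\<^sup>m\<close> values
  of \<open>\<alpha>\<close>.\<close>

lemma card_product_eq_le: "card {(f, \<alpha>) \<in> residues k \<times> residues k. t ^ k dvd f * \<alpha> - s} \<le> Suc k * q ^ k"
proof -
  define D where "D m = Sigma (residues_val k m) (\<lambda>f. {\<alpha> \<in> residues k. t ^ k dvd f * \<alpha> - s})" for m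
  have "{(f, \<alpha>) \<in> residues k \<times> residues k. t ^ k dvd f * \<alpha> - s} \<subseteq> (\<Union>m\<in>{..k}. D m)"
  proof clarify
    fix f \<alpha> assume fa: "f \<in> residues k" "\<alpha> \<in> residues k" "t ^ k dvd f * \<alpha> - s"
    obtain m where "valuation_form k m f" using valuation_form_exists by blast
    then show "(f, \<alpha>) \<in> (\<Union>m\<in>{..k}. D m)"
      using fa by (auto simp: D_def residues_val_def valuation_form_def)
  qed
  then have "card {(f, \<alpha>) \<in> residues k \<times> residues k. t ^ k dvd f * \<alpha> - s} \<le> card (\<Union>m\<in>{..k}. D m)"
    by (rule card_mono[rotated]) (auto simp: D_def)
  also have "\<dots> \<le> (\<Sum>m\<in>{..k}. card (D m))" by (rule card_UN_le) simp
  also have "\<dots> \<le> (\<Sum>m\<in>{..k}. q ^ k)"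
  proof (rule sum_mono)
    fix m assume "m \<in> {..k}"
    then have m: "m \<le> k" by simp
    have "card (D m) \<le> card (residues_val k m) * q ^ m"
      unfolding D_def by (rule card_Sigma_le) (auto simp: residues_val_def simp del: diff_eq intro: card_linear_le)
    also have "\<dots> \<le> q ^ (k - m) * q ^ m" by (intro mult_right_mono card_residues_val_le m) simp
    also have "\<dots> = q ^ k" using m by (simp flip: power_add)
    finally show "card (D m) \<le> q ^ k" .
  qed
  also have "\<dots> = Suc k * q ^ k" by simp
  finally show ?thesis .
qed

text \<open>Since \<open>b c\<close> is divisible by \<open>t\<^sup>2\<^sup>i\<close>, the entry \<open>a\<close> solves a quadratic congruence modulo \<open>t\<^sup>2\<^sup>i\<close>
  (or modulo \<open>t\<^sup>k\<close> if \<open>k < 2 i\<close>), and then \<open>c\<close> solves a linear one.\<close>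

lemma card_diagonal_solutions_le:
  assumes b: "valuation_form k i b"
  shows "card {(a, c) \<in> residues k \<times> residues k. t ^ i dvd c \<and> t ^ k dvd a * a + \<alpha> * a + (b * c + 1)} \<le> 2 * q ^ k"
proof -
  have ik: "i \<le> k" using b by (simp add: valuation_form_def)
  \<comment> \<open>A congruence for \<open>a\<close> alone.\<close>
  define m where "m = min (2 * i) k"
  define A where "A = {a \<in> residues k. t ^ m dvd a * a + \<alpha> * a + 1}"
  define B where "B a = {c \<in> residues k. t ^ i dvd c \<and> t ^ k dvd b * c - (a * a + \<alpha> * a + 1)}" for a
  have "{(a, c) \<in> residues k \<times> residues k. t ^ i dvd c \<and> t ^ k dvd a * a + \<alpha> * a + (b * c + 1)} \<subseteq> Sigma A B"
  proof
    fix z assume "z \<in> {(a, c) \<in> residues k \<times> residues k. t ^ i dvd c \<and> t ^ k dvd a * a + \<alpha> * a + (b * c + 1)}"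
    then obtain a c where z: "z = (a, c)" and ac: "a \<in> residues k" "c \<in> residues k" "t ^ i dvd c" 
      and d: "t ^ k dvd a * a + \<alpha> * a + (b * c + 1)" by blast
    have "t ^ i * t ^ i dvd b * c" using valuation_form_dvd[OF b] ac(3) by (rule mult_dvd_mono)
    then have "t ^ (2 * i) dvd b * c" by (simp add: mult_2 power_add)
    then have "t ^ m dvd b * c" unfolding m_def by (meson dvd_trans le_imp_power_dvd min.cobounded1)
    moreover have "t ^ m dvd a * a + \<alpha> * a + (b * c + 1)"
      using d unfolding m_def by (meson dvd_trans le_imp_power_dvd min.cobounded2)
    ultimately have "t ^ m dvd b * c + (a * a + \<alpha> * a + (b * c + 1))" by (rule dvd_add)
    also have "b * c + (a * a + \<alpha> * a + (b * c + 1)) = a * a + \<alpha> * a + 1" by (simp add: ac_simps)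
    finally have "a \<in> A" using ac by (simp add: A_def)
    moreover have "c \<in> B a" using ac d by (simp add: B_def ac_simps)
    ultimately show "z \<in> Sigma A B" unfolding z by blast
  qed
  then have "card {(a, c) \<in> residues k \<times> residues k. t ^ i dvd c \<and> t ^ k dvd a * a + \<alpha> * a + (b * c + 1)} 
      \<le> card (Sigma A B)"
    by (rule card_mono[rotated]) (auto simp: A_def B_def)
  also have "\<dots> \<le> card A * q ^ (min i (k - i))"
  proof (rule card_Sigma_le)
    fix a
    have "card (B a) \<le> card {c \<in> residues k. t ^ k dvd b * c - (a * a + \<alpha> * a + 1)}"
      by (rule card_mono) (auto simp: B_def)
    also have "\<dots> \<le> q ^ i" by (rule card_linear_le[OF b])
    finally have 1: "card (B a) \<le> q ^ i" .
    have "card (B a) \<le> card {c \<in> residues k. t ^ i dvd c}"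
      by (rule card_mono) (auto simp: B_def)
    also have "\<dots> \<le> q ^ (k - i)" by (rule card_multiples_le[OF ik])
    finally show "card (B a) \<le> q ^ (min i (k - i))" using 1 by (simp add: min_def)
  qed (auto simp: A_def B_def)
  also have "\<dots> \<le> 2 * q ^ (k - m + m div 2) * q ^ (min i (k - i))"
    unfolding A_def by (intro mult_right_mono card_quadratic_le_half) (auto simp: m_def)
  also have "\<dots> = 2 * q ^ (k - m + m div 2 + min i (k - i))" by (simp add: power_add)
  also have "\<dots> \<le> 2 * q ^ k"
    using q_ge_2 ik by (intro mult_left_mono power_increasing) (auto simp: m_def min_def)
  finally show ?thesis .
qed

text \<open>Pairs of commuting matrices of determinant one modulo \<open>t\<^sup>k\<close>.  The first matrix has upper row
  \<open>(a, b)\<close>, lower left entry \<open>c\<close> and trace \<open>\<alpha>\<close>, the second one has upper row \<open>(e, f)\<close>, lower left entry \<open>x\<close> and trace \<open>\<beta>\<close>.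
  In these coordinates, and in characteristic two, the determinant is \<open>a\<^sup>2 + \<alpha> a + b c\<close>, and
  commuting means that the vectors \<open>(\<alpha>, b, c)\<close> and \<open>(\<beta>, f, x)\<close> are parallel.\<close>

definition commuting_tuples :: "nat \<Rightarrow> ('a \<times> 'a \<times> 'a \<times> 'a \<times> 'a \<times> 'a \<times> 'a \<times> 'a) set" where
  "commuting_tuples k = {(a, \<alpha>, b, c, e, \<beta>, f, x). 
     {a, \<alpha>, b, c, e, \<beta>, f, x} \<subseteq> residues k \<and>
     t ^ k dvd a * a + \<alpha> * a + (b * c + 1) \<and> t ^ k dvd e * e + \<beta> * e + (f * x + 1) \<and>
     t ^ k dvd b * x - c * f \<and> t ^ k dvd b * \<beta> - \<alpha> * f \<and> t ^ k dvd c * \<beta> - \<alpha> * x}"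

text \<open>The entry \<open>b\<close> has the least valuation among \<open>b\<close> and \<open>c\<close>, and \<open>i\<close> is that valuation.  The entries are
  chosen in the order \<open>b\<close>, \<open>\<beta>\<close>, \<open>(f, \<alpha>)\<close>, \<open>(a, c)\<close>, \<open>x\<close>, \<open>e\<close>.  The factors \<open>q\<^sup>k\<^sup>-\<^sup>i\<close> for \<open>b\<close> and \<open>q\<^sup>i\<close> for
  \<open>x\<close> cancel, and so do \<open>q\<^sup>k\<^sup>-\<^sup>j\<close> for \<open>\<beta>\<close> and \<open>2 q\<^sup>j\<close> for \<open>e\<close>, up to the power \<open>q\<^sup>k\<close> and a constant.\<close>

lemma card_commuting_tuples_corner:
  assumes ij: "i \<le> k" "j \<le> k"
  shows "card {(a, \<alpha>, b, c, e, \<beta>, f, x) \<in> commuting_tuples k.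
     valuation_form k i b \<and> t ^ i dvd c \<and> valuation_form k j \<beta>} \<le> 4 * Suc k * q ^ (4 * k)" (is "card ?S \<le> _")
proof -
  define A1 where "A1 = residues_val k i \<times> residues_val k j"
  define A2 where "A2 = Sigma A1 (\<lambda>(b, \<beta>). {(f, \<alpha>) \<in> residues k \<times> residues k. t ^ k dvd f * \<alpha> - b * \<beta>})"
  define A3 where "A3 = Sigma A2 (\<lambda>((b, \<beta>), (f, \<alpha>)). {(a, c) \<in> residues k \<times> residues k. 
      t ^ i dvd c \<and> t ^ k dvd a * a + \<alpha> * a + (b * c + 1)})"
  define A4 where "A4 = Sigma A3 (\<lambda>(((b, \<beta>), (f, \<alpha>)), (a, c)). {x \<in> residues k. t ^ k dvd b * x - c * f})"
  define A5 where "A5 = Sigma A4 (\<lambda>((((b, \<beta>), (f, \<alpha>)), (a, c)), x). {e \<in> residues k. t ^ k dvd e * e + \<beta> * e + (f * x + 1)})"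
  have fin1: "finite A1" by (simp add: A1_def)
  have fin2: "finite A2" unfolding A2_def by (rule finite_SigmaI[OF fin1]) (auto intro: finite_subset[of _ "residues k \<times> residues k"])
  have fin3: "finite A3" unfolding A3_def by (rule finite_SigmaI[OF fin2]) (auto intro: finite_subset[of _ "residues k \<times> residues k"])
  have fin4: "finite A4" unfolding A4_def by (rule finite_SigmaI[OF fin3]) auto
  have fin5: "finite A5" unfolding A5_def by (rule finite_SigmaI[OF fin4]) auto
  have "?S \<subseteq> (\<lambda>(((((b, \<beta>), (f, \<alpha>)), (a, c)), x), e). (a, \<alpha>, b, c, e, \<beta>, f, x)) ` A5"
  proof clarify
    fix a \<alpha> b c e \<beta> f x
    assume *: "(a, \<alpha>, b, c, e, \<beta>, f, x) \<in> commuting_tuples k" "valuation_form k i b" "t ^ i dvd c" "valuation_form k j \<beta>"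
    have "(((((b, \<beta>), (f, \<alpha>)), (a, c)), x), e) \<in> A5"
      using * by (simp add: commuting_tuples_def A5_def A4_def A3_def A2_def A1_def residues_val_def ac_simps)
    then show "(a, \<alpha>, b, c, e, \<beta>, f, x) \<in> (\<lambda>(((((b, \<beta>), (f, \<alpha>)), (a, c)), x), e). (a, \<alpha>, b, c, e, \<beta>, f, x)) ` A5"
      by (rule image_eqI[rotated]) simp
  qed
  then have "card ?S \<le> card A5" by (rule surj_card_le[OF fin5])
  also have "\<dots> \<le> card A4 * (2 * q ^ j)"
    unfolding A5_def
  proof (rule card_Sigma_le[OF fin4])
    fix z assume "z \<in> A4"
    then show "card ((\<lambda>((((b, \<beta>), (f, \<alpha>)), (a, c)), x). {e \<in> residues k. t ^ k dvd e * e + \<beta> * e + (f * x + 1)}) z) \<le> 2 * q ^ j"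
      by (auto simp: A4_def A3_def A2_def A1_def residues_val_def intro: card_quadratic_le)
  qed auto
  also have "card A4 \<le> card A3 * q ^ i"
    unfolding A4_def
  proof (rule card_Sigma_le[OF fin3])
    fix z assume "z \<in> A3"
    then show "card ((\<lambda>(((b, \<beta>), (f, \<alpha>)), (a, c)). {x \<in> residues k. t ^ k dvd b * x - c * f}) z) \<le> q ^ i"
      by (auto simp: A3_def A2_def A1_def residues_val_def simp del: diff_eq intro: card_linear_le)
  qed auto
  also have "card A3 \<le> card A2 * (2 * q ^ k)"
    unfolding A3_def
  proof (rule card_Sigma_le[OF fin2])
    fix z assume "z \<in> A2"
    then obtain b \<beta> f \<alpha> where z: "z = ((b, \<beta>), (f, \<alpha>))" "valuation_form k i b"
      by (auto simp: A2_def A1_def residues_val_def)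
    show "card ((\<lambda>((b, \<beta>), (f, \<alpha>)). {(a, c) \<in> residues k \<times> residues k. 
      t ^ i dvd c \<and> t ^ k dvd a * a + \<alpha> * a + (b * c + 1)}) z) \<le> 2 * q ^ k"
      unfolding z(1) prod.case by (rule card_diagonal_solutions_le[OF z(2)])
  qed (auto intro: finite_subset[of _ "residues k \<times> residues k"])
  also have "card A2 \<le> card A1 * (Suc k * q ^ k)"
    unfolding A2_def
  proof (rule card_Sigma_le[OF fin1])
    fix z assume "z \<in> A1"
    show "card ((\<lambda>(b, \<beta>). {(f, \<alpha>) \<in> residues k \<times> residues k. t ^ k dvd f * \<alpha> - b * \<beta>}) z) \<le> Suc k * q ^ k"
      by (cases z) (simp only: prod.case card_product_eq_le)
  qed (auto intro: finite_subset[of _ "residues k \<times> residues k"])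
  also have "card A1 \<le> q ^ (k - i) * q ^ (k - j)"
    unfolding A1_def card_cartesian_product by (intro mult_mono card_residues_val_le ij) auto
  finally have "card ?S \<le> q ^ (k - i) * q ^ (k - j) * (Suc k * q ^ k) * (2 * q ^ k) * q ^ i * (2 * q ^ j)"
    by (simp add: mult_le_mono)
  also have "\<dots> = 4 * Suc k * ((q ^ (k - i) * q ^ i) * (q ^ (k - j) * q ^ j) * q ^ k * q ^ k)"
  proof -
    have "A * B * (S * C) * (2 * C) * U * (2 * V) = 4 * S * ((A * U) * (B * V) * C * C)" for A B C S U V :: nat
      by (simp add: ac_simps)
    then show ?thesis .
  qed
  also have "(q ^ (k - i) * q ^ i) * (q ^ (k - j) * q ^ j) * q ^ k * q ^ k = q ^ (k + k + k + k)"
    using ij by (simp flip: power_add)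
  also have "k + k + k + k = 4 * k" by simp
  finally show ?thesis .
qed

text \<open>Here \<open>\<alpha>\<close> has the least valuation \<open>i\<close> among \<open>\<alpha>\<close>, \<open>b\<close> and \<open>c\<close>.  The choices of \<open>a\<close>, \<open>f\<close> and \<open>x\<close> each
  contribute a factor \<open>q\<^sup>i\<close>, which compensates for the divisibility of \<open>\<alpha>\<close>, \<open>b\<close> and \<open>c\<close>.\<close>

lemma card_commuting_tuples_diagonal:
  assumes ij: "i \<le> k" "j \<le> k"
  shows "card {(a, \<alpha>, b, c, e, \<beta>, f, x) \<in> commuting_tuples k.
     valuation_form k i \<alpha> \<and> t ^ i dvd b \<and> t ^ i dvd c \<and> valuation_form k j \<beta>} \<le> 4 * q ^ (4 * k)" (is "card ?S \<le> _")
proof -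
  define M where "M = {x \<in> residues k. t ^ i dvd x}"
  define A1 where "A1 = (residues_val k i \<times> residues_val k j) \<times> (M \<times> M)"
  define A2 where "A2 = Sigma A1 (\<lambda>((\<alpha>, \<beta>), (b, c)). {a \<in> residues k. t ^ k dvd a * a + \<alpha> * a + (b * c + 1)})"
  define A3 where "A3 = Sigma A2 (\<lambda>(((\<alpha>, \<beta>), (b, c)), a). {f \<in> residues k. t ^ k dvd \<alpha> * f - b * \<beta>})"
  define A4 where "A4 = Sigma A3 (\<lambda>((((\<alpha>, \<beta>), (b, c)), a), f). {x \<in> residues k. t ^ k dvd \<alpha> * x - c * \<beta>})"
  define A5 where "A5 = Sigma A4 (\<lambda>(((((\<alpha>, \<beta>), (b, c)), a), f), x). {e \<in> residues k. t ^ k dvd e * e + \<beta> * e + (f * x + 1)})"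
  have fin1: "finite A1" by (simp add: A1_def M_def)
  have fin2: "finite A2" unfolding A2_def by (rule finite_SigmaI[OF fin1]) auto
  have fin3: "finite A3" unfolding A3_def by (rule finite_SigmaI[OF fin2]) auto
  have fin4: "finite A4" unfolding A4_def by (rule finite_SigmaI[OF fin3]) auto
  have fin5: "finite A5" unfolding A5_def by (rule finite_SigmaI[OF fin4]) auto
  have "?S \<subseteq> (\<lambda>((((((\<alpha>, \<beta>), (b, c)), a), f), x), e). (a, \<alpha>, b, c, e, \<beta>, f, x)) ` A5"
  proof clarify
    fix a \<alpha> b c e \<beta> f x
    assume *: "(a, \<alpha>, b, c, e, \<beta>, f, x) \<in> commuting_tuples k" "valuation_form k i \<alpha>" "t ^ i dvd b" "t ^ i dvd c" "valuation_form k j \<beta>"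
    have "((((((\<alpha>, \<beta>), (b, c)), a), f), x), e) \<in> A5"
      using * by (simp add: commuting_tuples_def A5_def A4_def A3_def A2_def A1_def M_def residues_val_def ac_simps)
    then show "(a, \<alpha>, b, c, e, \<beta>, f, x) \<in> (\<lambda>((((((\<alpha>, \<beta>), (b, c)), a), f), x), e). (a, \<alpha>, b, c, e, \<beta>, f, x)) ` A5"
      by (rule image_eqI[rotated]) simp
  qed
  then have "card ?S \<le> card A5" by (rule surj_card_le[OF fin5])
  also have "\<dots> \<le> card A4 * (2 * q ^ j)"
    unfolding A5_def
  proof (rule card_Sigma_le[OF fin4])
    fix z assume "z \<in> A4"
    then show "card ((\<lambda>(((((\<alpha>, \<beta>), (b, c)), a), f), x). {e \<in> residues k. t ^ k dvd e * e + \<beta> * e + (f * x + 1)}) z) \<le> 2 * q ^ j"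
      by (auto simp: A4_def A3_def A2_def A1_def residues_val_def intro: card_quadratic_le)
  qed auto
  also have "card A4 \<le> card A3 * q ^ i"
    unfolding A4_def
  proof (rule card_Sigma_le[OF fin3])
    fix z assume "z \<in> A3"
    then show "card ((\<lambda>((((\<alpha>, \<beta>), (b, c)), a), f). {x \<in> residues k. t ^ k dvd \<alpha> * x - c * \<beta>}) z) \<le> q ^ i"
      by (auto simp: A3_def A2_def A1_def residues_val_def simp del: diff_eq intro: card_linear_le)
  qed auto
  also have "card A3 \<le> card A2 * q ^ i"
    unfolding A3_def
  proof (rule card_Sigma_le[OF fin2])
    fix z assume "z \<in> A2"
    then show "card ((\<lambda>(((\<alpha>, \<beta>), (b, c)), a). {f \<in> residues k. t ^ k dvd \<alpha> * f - b * \<beta>}) z) \<le> q ^ i"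
      by (auto simp: A2_def A1_def residues_val_def simp del: diff_eq intro: card_linear_le)
  qed auto
  also have "card A2 \<le> card A1 * (2 * q ^ i)"
    unfolding A2_def
  proof (rule card_Sigma_le[OF fin1])
    fix z assume "z \<in> A1"
    then show "card ((\<lambda>((\<alpha>, \<beta>), (b, c)). {a \<in> residues k. t ^ k dvd a * a + \<alpha> * a + (b * c + 1)}) z) \<le> 2 * q ^ i"
      by (auto simp: A1_def residues_val_def intro: card_quadratic_le)
  qed auto
  also have "card A1 \<le> (q ^ (k - i) * q ^ (k - j)) * (q ^ (k - i) * q ^ (k - i))"
    unfolding A1_def card_cartesian_product M_def
    by (intro mult_mono card_residues_val_le card_multiples_le ij) auto
  finally have "card ?S \<le> (q ^ (k - i) * q ^ (k - j)) * (q ^ (k - i) * q ^ (k - i)) * (2 * q ^ i) * q ^ i * q ^ i * (2 * q ^ j)"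
    by (simp add: mult_le_mono)
  also have "\<dots> = 4 * ((q ^ (k - i) * q ^ i) * (q ^ (k - j) * q ^ j) * (q ^ (k - i) * q ^ i) * (q ^ (k - i) * q ^ i))"
    by (simp add: ac_simps)
  also have "(q ^ (k - i) * q ^ i) * (q ^ (k - j) * q ^ j) * (q ^ (k - i) * q ^ i) * (q ^ (k - i) * q ^ i) = q ^ (k + k + k + k)"
    using ij by (simp flip: power_add)
  also have "k + k + k + k = 4 * k" by simp
  finally show ?thesis .
qed

lemma finite_commuting_tuples [simp]: "finite (commuting_tuples k)"
proof (rule finite_subset)
  let ?R = "residues k"
  show "commuting_tuples k \<subseteq> ?R \<times> ?R \<times> ?R \<times> ?R \<times> ?R \<times> ?R \<times> ?R \<times> ?R"
    by (auto simp: commuting_tuples_def)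
qed (intro finite_cartesian_product finite_res)

text \<open>One of \<open>b\<close>, \<open>c\<close> and \<open>\<alpha>\<close> has least valuation.  Transposition of both matrices exchanges the first
  two cases.\<close>

lemma card_commuting_tuples_le: "card (commuting_tuples k) \<le> 12 * Suc k ^ 3 * q ^ (4 * k)"
proof -
  let ?C = "commuting_tuples k"
  define S1 where "S1 i j = {(a, \<alpha>, b, c, e, \<beta>, f, x) \<in> ?C.
     valuation_form k i b \<and> t ^ i dvd c \<and> valuation_form k j \<beta>}" for i j
  define S2 where "S2 i j = {(a, \<alpha>, b, c, e, \<beta>, f, x) \<in> ?C.
     valuation_form k i c \<and> t ^ i dvd b \<and> valuation_form k j \<beta>}" for i j
  define S3 where "S3 i j = {(a, \<alpha>, b, c, e, \<beta>, f, x) \<in> ?C.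
     valuation_form k i \<alpha> \<and> t ^ i dvd b \<and> t ^ i dvd c \<and> valuation_form k j \<beta>}" for i j
  let ?IJ = "{..k} \<times> {..k}"
  have finS: "finite (S1 i j)" "finite (S2 i j)" "finite (S3 i j)" for i j
    by (rule finite_subset[OF _ finite_commuting_tuples[of k]]; force simp: S1_def S2_def S3_def)+
  have "?C \<subseteq> (\<Union>(i, j)\<in>?IJ. S1 i j \<union> S2 i j \<union> S3 i j)"
  proof clarify
    fix a \<alpha> b c e \<beta> f x assume *: "(a, \<alpha>, b, c, e, \<beta>, f, x) \<in> ?C"
    obtain ia ib ic j where v: "valuation_form k ia \<alpha>" "valuation_form k ib b" "valuation_form k ic c" "valuation_form k j \<beta>"
      using valuation_form_exists by meson
    note d = valuation_form_dvd[OF v(1)] valuation_form_dvd[OF v(2)] valuation_form_dvd[OF v(3)]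
    have le: "ia \<le> k" "ib \<le> k" "ic \<le> k" "j \<le> k" using v by (auto simp: valuation_form_def)
    consider "ib \<le> ic" "ib \<le> ia" | "ic \<le> ib" "ic \<le> ia" | "ia \<le> ib" "ia \<le> ic" by linarith
    then show "(a, \<alpha>, b, c, e, \<beta>, f, x) \<in> (\<Union>(i, j)\<in>?IJ. S1 i j \<union> S2 i j \<union> S3 i j)"
    proof cases
      case 1
      then have "t ^ ib dvd c" using d(3) le_imp_power_dvd dvd_trans by blast
      then have "(a, \<alpha>, b, c, e, \<beta>, f, x) \<in> S1 ib j" using * v by (simp add: S1_def)
      then show ?thesis using le by blast
    next
      case 2
      then have "t ^ ic dvd b" using d(2) le_imp_power_dvd dvd_trans by blast
      then have "(a, \<alpha>, b, c, e, \<beta>, f, x) \<in> S2 ic j" using * v by (simp add: S2_def)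
      then show ?thesis using le by blast
    next
      case 3
      then have "t ^ ia dvd b" "t ^ ia dvd c" using d(2,3) le_imp_power_dvd dvd_trans by blast+
      then have "(a, \<alpha>, b, c, e, \<beta>, f, x) \<in> S3 ia j" using * v by (simp add: S3_def)
      then show ?thesis using le by blast
    qed
  qed
  then have "card ?C \<le> card (\<Union>(i, j)\<in>?IJ. S1 i j \<union> S2 i j \<union> S3 i j)"
    by (rule card_mono[rotated]) (auto simp: finS)
  also have "\<dots> \<le> (\<Sum>ij\<in>?IJ. card (case ij of (i, j) \<Rightarrow> S1 i j \<union> S2 i j \<union> S3 i j))"
    by (rule card_UN_le) simp
  also have "\<dots> \<le> (\<Sum>ij\<in>?IJ. 12 * Suc k * q ^ (4 * k))"
  proof (rule sum_mono)
    fix z assume "z \<in> ?IJ"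
    then obtain i j where z: "z = (i, j)" and ij: "i \<le> k" "j \<le> k" by auto
    have 1: "card (S1 i j) \<le> 4 * Suc k * q ^ (4 * k)"
      unfolding S1_def by (rule card_commuting_tuples_corner[OF ij])
    have "S2 i j \<subseteq> (\<lambda>(a, \<alpha>, b, c, e, \<beta>, f, x). (a, \<alpha>, c, b, e, \<beta>, x, f)) ` S1 i j"
    proof clarify
      fix a \<alpha> b c e \<beta> f x assume "(a, \<alpha>, b, c, e, \<beta>, f, x) \<in> S2 i j"
      then have "(a, \<alpha>, c, b, e, \<beta>, x, f) \<in> S1 i j"
        by (simp add: S1_def S2_def commuting_tuples_def ac_simps)
      then show "(a, \<alpha>, b, c, e, \<beta>, f, x) \<in> (\<lambda>(a, \<alpha>, b, c, e, \<beta>, f, x). (a, \<alpha>, c, b, e, \<beta>, x, f)) ` S1 i j"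
        by (rule image_eqI[rotated]) simp
    qed
    then have 2: "card (S2 i j) \<le> card (S1 i j)" by (rule surj_card_le[OF finS(1)])
    have 3: "card (S3 i j) \<le> 4 * q ^ (4 * k)"
      unfolding S3_def by (rule card_commuting_tuples_diagonal[OF ij])
    have "card (S1 i j \<union> S2 i j \<union> S3 i j) \<le> card (S1 i j) + card (S2 i j) + card (S3 i j)"
      using card_Un_le[of "S1 i j \<union> S2 i j" "S3 i j"] card_Un_le[of "S1 i j" "S2 i j"] by linarith
    also have "\<dots> \<le> 4 * Suc k * q ^ (4 * k) + 4 * Suc k * q ^ (4 * k) + 4 * q ^ (4 * k)"
      using 1 2 3 by linarith
    also have "\<dots> \<le> 12 * Suc k * q ^ (4 * k)" by (simp add: algebra_simps)
    finally show "card (case z of (i, j) \<Rightarrow> S1 i j \<union> S2 i j \<union> S3 i j) \<le> 12 * Suc k * q ^ (4 * k)"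
      unfolding z prod.case .
  qed
  also have "\<dots> = 12 * Suc k ^ 3 * q ^ (4 * k)"
    by (simp only: sum_constant card_cartesian_product card_atMost power3_eq_cube ac_simps of_nat_id)
  finally show ?thesis .
qed

end

section \<open>Uniformizers of discrete valuation rings\<close>

lemma power_dvr_ideal_eq:
  assumes P: "dvr_ideal (class_ring :: 'a::idom ring) = {x. t dvd x}"
  shows "dvr_ideal_power (class_ring :: 'a ring) k = {x. t ^ k dvd x}"
proof (induction k)
  case 0
  show ?case by (simp add: dvr_ideal_power_def nat_pow_def ideals_set_def)
next
  case (Suc k)
  have "dvr_ideal_power (class_ring :: 'a ring) (Suc k) =
      ideal_prod class_ring (dvr_ideal_power (class_ring :: 'a ring) k) (dvr_ideal class_ring)"
    by (simp add: dvr_ideal_power_def nat_pow_def ideals_set_def)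
  also have "\<dots> = ideal_prod (class_ring :: 'a ring) {x. t ^ k dvd x} {x. t dvd x}"
    by (simp only: Suc P)
  also have "\<dots> = {x. t ^ Suc k dvd x}"
  proof
    show "ideal_prod (class_ring :: 'a ring) {x. t ^ k dvd x} {x. t dvd x} \<subseteq> {x. t ^ Suc k dvd x}"
    proof
      fix x :: 'a assume "x \<in> ideal_prod class_ring {x. t ^ k dvd x} {x. t dvd x}"
      then show "x \<in> {x. t ^ Suc k dvd x}"
      proof (induction rule: ideal_prod.induct)
        case (prod i j)
        then have "t ^ k * t dvd i * j" by (intro mult_dvd_mono) auto
        then show ?case by (simp add: mult.commute)
      next
        case (sum s1 s2)
        then show ?case by simp
      qed
    qed
    show "{x. t ^ Suc k dvd x} \<subseteq> ideal_prod (class_ring :: 'a ring) {x. t ^ k dvd x} {x. t dvd x}"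
    proof
      fix x assume "x \<in> {x. t ^ Suc k dvd x}"
      then obtain y where "x = t ^ Suc k * y" by (auto elim: dvdE)
      then have "x = t ^ k * (t * y)" by (simp add: ac_simps)
      then show "x \<in> ideal_prod (class_ring :: 'a ring) {x. t ^ k dvd x} {x. t dvd x}"
        using ideal_prod.prod[of "t ^ k" "{x. t ^ k dvd x}" "t * y" "{x. t dvd x}" "class_ring :: 'a ring"] by simp
    qed
  qed
  finally show ?case .
qed

text \<open>A generator \<open>t\<close> of the nonzero prime ideal divides every nonunit \<open>x \<noteq> 0\<close>: an irreducible divisor
  of \<open>x\<close> generates a nonzero prime ideal, and there is only one.\<close>

lemma exists_uniformizer:
  assumes dvr: "discrete_valuation_ring (class_ring :: 'a::idom ring)"
    and fin: "finite (carrier (residue_field (class_ring :: 'a ring)))"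
    and char2: "CHAR('a) = 2"
  obtains t :: "'a::idom" where "char_two_uniformizer t" "dvr_ideal (class_ring :: 'a ring) = {x. t dvd x}"
proof -
  let ?R = "class_ring :: 'a ring"
  interpret R: discrete_valuation_ring ?R by (rule dvr)
  define P where "P = dvr_ideal ?R"
  have P: "primeideal P ?R" "P \<noteq> {0}"
    using theI'[OF R.ex1_nonzero_prime] by (simp_all add: P_def dvr_ideal_def)
  have uniq: "Q = P" if "primeideal Q ?R" "Q \<noteq> {0}" for Q
    using R.ex1_nonzero_prime P that by auto
  have "ideal P ?R" using P(1) by (simp add: primeideal_def)
  then obtain t where "P = PIdl\<^bsub>?R\<^esub> t" using R.exists_gen by blast
  then have Pt: "P = {x. t dvd x}" by (auto simp: cgenideal_def dvd_def mult.commute)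
  have t0: "t \<noteq> 0" using P(2) Pt by auto
  have t1: "\<not> t dvd 1"
  proof
    assume "t dvd 1"
    then have "P = UNIV" using Pt dvd_trans one_dvd by blast
    then show False using primeideal.I_notcarr[OF P(1)] by simp
  qed
  have unit: "t dvd x \<or> x dvd 1" for x
  proof (cases "x = 0 \<or> x dvd 1")
    case False
    have "x \<notin> Units ?R"
    proof
      assume "x \<in> Units ?R"
      then obtain y where "y * x = 1" by (auto simp: Units_def)
      then have "1 = x * y" by (simp add: mult.commute)
      then have "x dvd 1" by (rule dvdI)
      then show False using False by blast
    qed
    moreover have "x \<in> carrier ?R - {\<zero>\<^bsub>?R\<^esub>}" using False by simp
    ultimately obtain b where b: "b \<in> carrier ?R" "ring_irreducible\<^bsub>?R\<^esub> b" "b divides\<^bsub>?R\<^esub> x"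
      using R.exists_irreducible_divisor by blast
    have b0: "b \<noteq> 0" using b(2) by (auto simp: ring_irreducible_def)
    have "primeideal (PIdl\<^bsub>?R\<^esub> b) ?R"
      using R.primeideal_iff_prime[of b] R.primeness_condition[of b] b b0 by simp
    moreover have bP: "b \<in> PIdl\<^bsub>?R\<^esub> b" by (auto simp: cgenideal_def intro!: exI[of _ 1])
    ultimately have "PIdl\<^bsub>?R\<^esub> b = P" using uniq b0 by blast
    then have "t dvd b" using bP Pt by blast
    moreover have "b dvd x" using b(3) by (auto simp: factor_def)
    ultimately show ?thesis using dvd_trans by blast
  qed auto
  have two: "(1::'a) + 1 = 0"
    using of_nat_CHAR[where 'a = 'a] char2 by simp
  have residues: "\<exists>S. finite S \<and> (\<forall>x. \<exists>y\<in>S. t dvd x - y)"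
  proof -
    define C where "C = carrier (residue_field ?R)"
    define S where "S = (\<lambda>A. SOME y. y \<in> A) ` C"
    have "\<exists>y\<in>S. t dvd x - y" for x
    proof -
      have c: "P +>\<^bsub>?R\<^esub> x \<in> C"
        by (auto simp: C_def residue_field_def FactRing_def A_RCOSETS_def' P_def)
      have "x \<in> P +>\<^bsub>?R\<^esub> x" using Pt by (auto simp: a_r_coset_def' intro!: bexI[of _ 0])
      then have "(SOME y. y \<in> P +>\<^bsub>?R\<^esub> x) \<in> P +>\<^bsub>?R\<^esub> x" by (rule someI)
      then obtain p where p: "t dvd p" "(SOME y. y \<in> P +>\<^bsub>?R\<^esub> x) = p + x"
        using Pt by (auto simp: a_r_coset_def')
      have "t dvd x - (p + x)" using p(1) by simp
      then show ?thesis using c p(2) unfolding S_def by (metis imageI)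
    qed
    moreover have "finite S" using fin by (simp add: S_def C_def)
    ultimately show ?thesis by blast
  qed
  show thesis
  proof (rule that[of t])
    show "char_two_uniformizer t" by unfold_locales (use t0 t1 unit two residues in blast)+
    show "dvr_ideal ?R = {x. t dvd x}" using Pt by (simp add: P_def)
  qed
qed

section \<open>Congruence quotients of the special linear group\<close>

definition mat2 :: "'a \<Rightarrow> 'a \<Rightarrow> 'a \<Rightarrow> 'a \<Rightarrow> 'a mat" where
  "mat2 a b c d = Matrix.mat 2 2 (\<lambda>(i, j). if i = 0 then if j = 0 then a else b else if j = 0 then c else d)"

lemma mat2_carrier [simp]: "mat2 a b c d \<in> carrier_mat 2 2"
  by (simp add: mat2_def)

lemma mat2_index [simp]:
  "mat2 a b c d $$ (0, 0) = a" "mat2 a b c d $$ (0, Suc 0) = b"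
  "mat2 a b c d $$ (Suc 0, 0) = c" "mat2 a b c d $$ (Suc 0, Suc 0) = d"
  by (simp_all add: mat2_def)

lemma mat2_dim [simp]: "dim_row (mat2 a b c d) = 2" "dim_col (mat2 a b c d) = 2"
  by (simp_all add: mat2_def)

lemma all_less_2: "(\<forall>i<2. P i) \<longleftrightarrow> P (0::nat) \<and> P (Suc 0)"
  using less_2_cases_iff by auto

lemma mat2_eqI:
  assumes "A \<in> carrier_mat 2 2" "A $$ (0, 0) = a" "A $$ (0, Suc 0) = b"
    "A $$ (Suc 0, 0) = c" "A $$ (Suc 0, Suc 0) = d"
  shows "A = mat2 a b c d"
proof (rule eq_matI)
  fix i j assume "i < dim_row (mat2 a b c d)" "j < dim_col (mat2 a b c d)"
  then have "(i = 0 \<or> i = Suc 0) \<and> (j = 0 \<or> j = Suc 0)" by auto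
  then show "A $$ (i, j) = mat2 a b c d $$ (i, j)" using assms by auto
qed (use assms in auto)

lemma mat2_cases:
  assumes "A \<in> carrier_mat 2 2"
  obtains a b c d where "A = mat2 a b c d"
  using mat2_eqI[OF assms] by blast

lemma mat2_mult:
  "mat2 a b c d * mat2 e f g h = mat2 (a * e + b * g) (a * f + b * h) (c * e + d * g) (c * f + d * (h::'a::comm_ring_1))"
  by (rule mat2_eqI) (auto simp: scalar_prod_def numeral_2_eq_2 intro: mult_carrier_mat[of _ 2 2])

lemma one_mat2: "1\<^sub>m 2 = mat2 1 0 0 (1::'a::comm_ring_1)"
  by (rule mat2_eqI) auto

lemma det_mat2: "Determinant.det (mat2 a b c d) = a * d - b * (c::'a::comm_ring_1)"
proof -
  have e: "Determinant.det (mat_delete (mat2 a b c d) 0 j) = (if j = 0 then d else c)" if "j < 2" for j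
  proof -
    have "mat_delete (mat2 a b c d) 0 j \<in> carrier_mat 1 1" by (rule carrier_matI) (auto simp: mat_delete_def)
    then have "Determinant.det (mat_delete (mat2 a b c d) 0 j) = mat_delete (mat2 a b c d) 0 j $$ (0, 0)"
      by (rule det_single)
    also have "\<dots> = (if j = 0 then d else c)" using that by (auto simp: mat_delete_def less_2_cases_iff)
    finally show ?thesis .
  qed
  have "Determinant.det (mat2 a b c d) = (\<Sum>j<2. mat2 a b c d $$ (0, j) * cofactor (mat2 a b c d) 0 j)"
    by (rule laplace_expansion_row) auto
  then show ?thesis using e[of 0] e[of 1] by (simp add: cofactor_def numeral_2_eq_2)
qed

lemma SL2_cases:
  assumes "A \<in> carrier (SL 2 :: 'a::comm_ring_1 mat monoid)"
  obtains a b c d where "A = mat2 a b c d" "a * d - b * c = 1"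
proof -
  have "A \<in> carrier_mat 2 2" "Determinant.det A = 1" using assms by (auto simp: SL_def)
  then show thesis using that by (metis mat2_cases det_mat2)
qed

lemma mat2_in_SL2: "mat2 a b c d \<in> carrier (SL 2) \<longleftrightarrow> a * d - b * c = (1::'a::comm_ring_1)"
  by (simp add: SL_def det_mat2)

lemma SL_simps [simp]: "monoid.mult (SL n) = (*)" "one (SL n) = 1\<^sub>m n"
  by (simp_all add: SL_def)

lemma SL2_carrier_mat: "A \<in> carrier (SL 2) \<Longrightarrow> A \<in> carrier_mat 2 2"
  by (simp add: SL_def)

context char_two_uniformizer
begin

abbreviation G :: "'a mat monoid" where "G \<equiv> SL 2"

definition congruent :: "nat \<Rightarrow> 'a \<Rightarrow> 'a \<Rightarrow> bool" where
  "congruent k x y \<longleftrightarrow> t ^ k dvd x - y"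

lemma congruent_refl [simp]: "congruent k x x"
  by (simp add: congruent_def)

lemma congruent_sym: "congruent k x y \<Longrightarrow> congruent k y x"
  by (simp add: congruent_def add.commute)

lemma congruent_add: "congruent k x y \<Longrightarrow> congruent k x' y' \<Longrightarrow> congruent k (x + x') (y + y')"
  using dvd_add[of "t ^ k" "x + y" "x' + y'"] by (simp add: congruent_def ac_simps)

lemma congruent_trans: "congruent k x y \<Longrightarrow> congruent k y z \<Longrightarrow> congruent k x z"
  using dvd_add[of "t ^ k" "x + y" "y + z"] by (simp add: congruent_def add.assoc)

lemma congruent_mult: "congruent k x y \<Longrightarrow> congruent k x' y' \<Longrightarrow> congruent k (x * x') (y * y')"
proof -
  assume "congruent k x y" "congruent k x' y'"
  then have "t ^ k dvd (x - y) * x' + y * (x' - y')"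
    unfolding congruent_def by (intro dvd_add dvd_mult dvd_mult2)
  also have "(x - y) * x' + y * (x' - y') = x * x' - y * y'" by (simp add: algebra_simps)
  finally show "congruent k (x * x') (y * y')" by (simp add: congruent_def)
qed

lemma congruent_red: "congruent k (red k x) x"
  using red_dvd[of k x] by (simp add: congruent_def add.commute)

lemma congruent_iff_red: "congruent k x y \<longleftrightarrow> red k x = red k y"
  by (simp only: congruent_def red_eq_iff)

lemma congruent_zero: "congruent k x 0 \<longleftrightarrow> t ^ k dvd x"
  by (simp add: congruent_def)

definition mat_congruent :: "nat \<Rightarrow> 'a mat \<Rightarrow> 'a mat \<Rightarrow> bool" where
  "mat_congruent k A B \<longleftrightarrow> (\<forall>i<2. \<forall>j<2. congruent k (A $$ (i, j)) (B $$ (i, j)))"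

lemma mat_congruent_mat2: "mat_congruent k (mat2 a b c d) (mat2 a' b' c' d') \<longleftrightarrow>
    congruent k a a' \<and> congruent k b b' \<and> congruent k c c' \<and> congruent k d d'"
  by (simp add: mat_congruent_def all_less_2)

lemma mat_congruent_refl [simp]: "mat_congruent k A A"
  by (simp add: mat_congruent_def)

lemma mat_congruent_sym: "mat_congruent k A B \<Longrightarrow> mat_congruent k B A"
  unfolding mat_congruent_def using congruent_sym by blast

lemma mat_congruent_trans: "mat_congruent k A B \<Longrightarrow> mat_congruent k B C \<Longrightarrow> mat_congruent k A C"
  unfolding mat_congruent_def using congruent_trans by meson

lemma mat_congruent_mult:
  assumes "A \<in> carrier_mat 2 2" "A' \<in> carrier_mat 2 2" "B \<in> carrier_mat 2 2" "B' \<in> carrier_mat 2 2"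
    and "mat_congruent k A A'" "mat_congruent k B B'"
  shows "mat_congruent k (A * B) (A' * B')"
proof -
  obtain a b c d where A: "A = mat2 a b c d" using assms(1) by (rule mat2_cases)
  obtain a' b' c' d' where A': "A' = mat2 a' b' c' d'" using assms(2) by (rule mat2_cases)
  obtain e f g h where B: "B = mat2 e f g h" using assms(3) by (rule mat2_cases)
  obtain e' f' g' h' where B': "B' = mat2 e' f' g' h'" using assms(4) by (rule mat2_cases)
  show ?thesis using assms(5,6)
    unfolding A A' B B' mat2_mult mat_congruent_mat2
    by (intro conjI congruent_add congruent_mult) blast+
qed

text \<open>The kernel of reduction modulo \<open>t\<^sup>k\<close>.\<close>

definition principal_congruence :: "nat \<Rightarrow> 'a mat set" where
  "principal_congruence k = {A \<in> carrier G. mat_congruent k A (1\<^sub>m 2)}"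

interpretation G: Group.group G by (rule group_SL)

lemma SL2_mult_congruent:
  assumes "A \<in> carrier G" "A' \<in> carrier G" "B \<in> carrier G" "B' \<in> carrier G"
    "mat_congruent k A A'" "mat_congruent k B B'"
  shows "mat_congruent k (A * B) (A' * B')"
  using assms by (intro mat_congruent_mult SL2_carrier_mat)

lemma principal_congruence_mult_inv:
  assumes A: "A \<in> carrier G" and B: "B \<in> carrier G"
  shows "A * inv\<^bsub>G\<^esub> B \<in> principal_congruence k \<longleftrightarrow> mat_congruent k A B"
proof
  have iB: "inv\<^bsub>G\<^esub> B \<in> carrier G" using B by simp
  have one: "(1\<^sub>m 2 :: 'a mat) \<in> carrier G" using G.one_closed by simp
  have AB: "A * inv\<^bsub>G\<^esub> B \<in> carrier G" using G.m_closed[OF A iB] by simp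
  assume "A * inv\<^bsub>G\<^esub> B \<in> principal_congruence k"
  then have "mat_congruent k (A * inv\<^bsub>G\<^esub> B) (1\<^sub>m 2)" by (simp add: principal_congruence_def)
  then have "mat_congruent k (A * inv\<^bsub>G\<^esub> B * B) (1\<^sub>m 2 * B)"
    using AB one B by (intro SL2_mult_congruent) auto
  moreover have "A * inv\<^bsub>G\<^esub> B * B = A"
    using G.m_assoc[OF A iB B] G.l_inv[OF B] SL2_carrier_mat[OF A] by simp
  moreover have "1\<^sub>m 2 * B = B" using SL2_carrier_mat[OF B] by simp
  ultimately show "mat_congruent k A B" by simp
next
  have iB: "inv\<^bsub>G\<^esub> B \<in> carrier G" using B by simp
  assume "mat_congruent k A B"
  then have "mat_congruent k (A * inv\<^bsub>G\<^esub> B) (B * inv\<^bsub>G\<^esub> B)"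
    using A B iB by (intro SL2_mult_congruent) auto
  then show "A * inv\<^bsub>G\<^esub> B \<in> principal_congruence k"
    using G.r_inv[OF B] G.m_closed[OF A iB] by (simp add: principal_congruence_def)
qed

lemma principal_congruence_subgroup: "subgroup (principal_congruence k) G"
proof (rule G.subgroupI)
  have "1\<^sub>m 2 \<in> principal_congruence k" using G.one_closed by (simp add: principal_congruence_def)
  then show "principal_congruence k \<noteq> {}" by blast
next
  fix A assume "A \<in> principal_congruence k"
  then have A: "A \<in> carrier G" "mat_congruent k (1\<^sub>m 2) A" by (auto simp: principal_congruence_def mat_congruent_sym)
  have "1\<^sub>m 2 * inv\<^bsub>G\<^esub> A \<in> principal_congruence k"
    using principal_congruence_mult_inv[OF _ A(1), of "1\<^sub>m 2" k] A G.one_closed by simp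
  then show "inv\<^bsub>G\<^esub> A \<in> principal_congruence k" 
    using SL2_carrier_mat[OF G.inv_closed[OF A(1)]] by simp
next
  fix A B assume "A \<in> principal_congruence k" "B \<in> principal_congruence k"
  then have A: "A \<in> carrier G" "mat_congruent k A (1\<^sub>m 2)" "B \<in> carrier G" "mat_congruent k B (1\<^sub>m 2)"
    by (auto simp: principal_congruence_def)
  then have "mat_congruent k (A * B) (1\<^sub>m 2 * 1\<^sub>m 2)" using G.one_closed by (intro SL2_mult_congruent) auto
  then show "A \<otimes>\<^bsub>G\<^esub> B \<in> principal_congruence k" using G.m_closed[OF A(1,3)] by (simp add: principal_congruence_def)
qed (auto simp: principal_congruence_def)

lemma principal_congruence_normal: "principal_congruence k \<lhd> G"
  unfolding G.normal_inv_iff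
proof (intro conjI ballI principal_congruence_subgroup)
  fix A B assume A: "A \<in> carrier G" and "B \<in> principal_congruence k"
  then have B: "B \<in> carrier G" "mat_congruent k B (1\<^sub>m 2)" by (auto simp: principal_congruence_def)
  have "mat_congruent k (A * B) (A * 1\<^sub>m 2)"
    using A B G.one_closed by (intro SL2_mult_congruent) auto
  then have "mat_congruent k (A * B) A" using SL2_carrier_mat[OF A] by simp
  then show "A \<otimes>\<^bsub>G\<^esub> B \<otimes>\<^bsub>G\<^esub> inv\<^bsub>G\<^esub> A \<in> principal_congruence k"
    using principal_congruence_mult_inv[of "A * B" A k] A G.m_closed[OF A B(1)] by simp
qed

lemma coset_eq_iff:
  assumes A: "A \<in> carrier G" and B: "B \<in> carrier G"
  shows "principal_congruence k #>\<^bsub>G\<^esub> A = principal_congruence k #>\<^bsub>G\<^esub> B \<longleftrightarrow> mat_congruent k A B"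
proof -
  have "principal_congruence k #>\<^bsub>G\<^esub> A = principal_congruence k #>\<^bsub>G\<^esub> B \<longleftrightarrow> A \<in> principal_congruence k #>\<^bsub>G\<^esub> B"
    using G.repr_independence[OF _ B principal_congruence_subgroup] G.rcos_self[OF A principal_congruence_subgroup] by metis
  also have "\<dots> \<longleftrightarrow> mat_congruent k A B"
    using subgroup.rcos_module[OF principal_congruence_subgroup G.is_group B A] principal_congruence_mult_inv[OF A B]
    by simp
  finally show ?thesis .
qed

lemma coset_mem_iff:
  assumes A: "A \<in> carrier G" and B: "B \<in> carrier G"
  shows "A \<in> principal_congruence k #>\<^bsub>G\<^esub> B \<longleftrightarrow> mat_congruent k A B"
  using subgroup.rcos_module[OF principal_congruence_subgroup G.is_group B A] principal_congruence_mult_inv[OF A B]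
  by simp

abbreviation quotient :: "nat \<Rightarrow> 'a mat set monoid" where
  "quotient k \<equiv> G Mod principal_congruence k"

definition coset_rep :: "'a mat set \<Rightarrow> 'a mat" where
  "coset_rep C = (SOME A. A \<in> C)"

lemma coset_rep_props:
  assumes "C \<in> carrier (quotient k)"
  shows "coset_rep C \<in> carrier G" "C = principal_congruence k #>\<^bsub>G\<^esub> coset_rep C"
proof -
  obtain A where A: "A \<in> carrier G" "C = principal_congruence k #>\<^bsub>G\<^esub> A"
    using assms by (auto simp: carrier_FactGroup)
  have "coset_rep C \<in> C"
    unfolding coset_rep_def A(2) by (rule someI) (rule G.rcos_self[OF A(1) principal_congruence_subgroup])
  then show "coset_rep C \<in> carrier G"
    using A G.r_coset_subset_G[OF subgroup.subset[OF principal_congruence_subgroup] A(1)] by blast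
  show "C = principal_congruence k #>\<^bsub>G\<^esub> coset_rep C"
    using G.repr_independence[OF _ A(1) principal_congruence_subgroup, of "coset_rep C" k] \<open>coset_rep C \<in> C\<close> A(2) by simp
qed

definition code :: "nat \<Rightarrow> 'a mat \<Rightarrow> 'a \<times> 'a \<times> 'a \<times> 'a" where
  "code k A = (red k (A $$ (0, 0)), red k (A $$ (0, Suc 0)), red k (A $$ (Suc 0, 0)), red k (A $$ (Suc 0, Suc 0)))"

lemma code_eq_iff: "code k A = code k B \<longleftrightarrow> mat_congruent k A B"
  by (auto simp: code_def mat_congruent_def all_less_2 congruent_iff_red)

lemma code_inj: "inj_on (\<lambda>C. code k (coset_rep C)) (carrier (quotient k))"
proof (rule inj_onI)
  fix C D assume C: "C \<in> carrier (quotient k)" and D: "D \<in> carrier (quotient k)"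
    and e: "code k (coset_rep C) = code k (coset_rep D)"
  then have "principal_congruence k #>\<^bsub>G\<^esub> coset_rep C = principal_congruence k #>\<^bsub>G\<^esub> coset_rep D"
    using coset_eq_iff[OF coset_rep_props(1)[OF C] coset_rep_props(1)[OF D]] by (simp add: code_eq_iff)
  then show "C = D" using coset_rep_props(2)[OF C] coset_rep_props(2)[OF D] by simp
qed

lemma valuation_form_0:
  assumes "x dvd 1 \<or> k = 0"
  shows "valuation_form k 0 x"
  using assms
proof
  assume "x dvd 1"
  then show ?thesis unfolding valuation_form_def by (intro conjI exI[of _ x]) auto
next
  assume "k = 0"
  then show ?thesis unfolding valuation_form_def by (intro conjI exI[of _ 1]) auto
qed

lemma det_congruent_unit:
  assumes "congruent k (a * d + b * c) 1"
  shows "valuation_form k 0 a \<or> valuation_form k 0 b"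
proof (cases "k = 0")
  case False
  have "\<not> (t dvd a \<and> t dvd b)"
  proof
    assume ab: "t dvd a \<and> t dvd b"
    have "t dvd t ^ k" using False by (simp add: dvd_power)
    then have "t dvd (a * d + b * c) - 1" using assms dvd_trans unfolding congruent_def by blast
    moreover have "t dvd a * d + b * c" using ab by simp
    ultimately have "t dvd (a * d + b * c) + ((a * d + b * c) + 1)" unfolding diff_eq by (rule dvd_add[rotated])
    then show False unfolding add_self_left using t_nonunit by blast
  qed
  then show ?thesis using valuation_form_0 unit_iff by blast
qed (use valuation_form_0 in simp)

lemma card_linear_unit_le:
  assumes "valuation_form k 0 a"
  shows "card {d \<in> residues k. t ^ k dvd a * d - s} \<le> 1"
  using card_linear_le[OF assms] by simp

text \<open>One entry of the upper row of a matrix of determinant one is a unit; it determines the entry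
  diagonally opposite to it from the other two.\<close>

lemma card_quotient_le: "finite (carrier (quotient k)) \<and> card (carrier (quotient k)) \<le> 2 * q ^ (3 * k)"
proof -
  let ?R = "residues k"
  define U where "U = residues_val k 0"
  define S where "S = Sigma (U \<times> ?R \<times> ?R) (\<lambda>(a, b, c). {d \<in> ?R. t ^ k dvd a * d - (b * c + 1)})"
  define F1 where "F1 = (\<lambda>((a :: 'a, b :: 'a, c :: 'a), d :: 'a). (a, b, c, d))"
  define F2 where "F2 = (\<lambda>((b :: 'a, a :: 'a, d :: 'a), c :: 'a). (a, b, c, d))"
  have finS: "finite S" unfolding S_def by (rule finite_SigmaI) (auto simp: U_def)
  have "card S \<le> card (U \<times> ?R \<times> ?R) * 1"
    unfolding S_def
  proof (rule card_Sigma_le)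
    fix z assume "z \<in> U \<times> ?R \<times> ?R"
    then obtain a b c where z: "z = (a, b, c)" "valuation_form k 0 a" by (auto simp: U_def residues_val_def)
    show "card ((\<lambda>(a, b, c). {d \<in> ?R. t ^ k dvd a * d - (b * c + 1)}) z) \<le> 1"
      unfolding z(1) prod.case by (rule card_linear_unit_le[OF z(2)])
  qed (auto simp: U_def)
  also have "\<dots> \<le> q ^ (3 * k)"
  proof -
    have "card U \<le> q ^ k" using card_residues_val_le[of 0 k] by (simp add: U_def)
    then have "card (U \<times> ?R \<times> ?R) \<le> q ^ k * (q ^ k * q ^ k)"
      unfolding card_cartesian_product using card_residues by (intro mult_mono) auto
    also have "q ^ k * (q ^ k * q ^ k) = q ^ (k + (k + k))" by (simp only: power_add)
    also have "k + (k + k) = 3 * k" by simp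
    finally show ?thesis by simp
  qed
  finally have cS: "card S \<le> q ^ (3 * k)" .
  have sub: "(\<lambda>C. code k (coset_rep C)) ` carrier (quotient k) \<subseteq> F1 ` S \<union> F2 ` S"
  proof
    fix z assume "z \<in> (\<lambda>C. code k (coset_rep C)) ` carrier (quotient k)"
    then obtain C where C: "C \<in> carrier (quotient k)" "z = code k (coset_rep C)" by blast
    obtain a b c d where m: "coset_rep C = mat2 a b c d" "a * d - b * c = 1"
      using coset_rep_props(1)[OF C(1)] by (rule SL2_cases)
    have z: "z = (red k a, red k b, red k c, red k d)" unfolding C(2) m(1) by (simp add: code_def)
    have "congruent k (red k a * red k d + red k b * red k c) (a * d + b * c)"
      by (intro congruent_add congruent_mult congruent_red)
    then have cg: "congruent k (red k a * red k d + red k b * red k c) 1" using m(2) by simp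
    then have d1: "t ^ k dvd red k a * red k d - (red k b * red k c + 1)"
      and d2: "t ^ k dvd red k b * red k c - (red k a * red k d + 1)"
      unfolding congruent_def by (simp_all add: ac_simps)
    from det_congruent_unit[OF cg] show "z \<in> F1 ` S \<union> F2 ` S"
    proof
      assume "valuation_form k 0 (red k a)"
      then have "((red k a, red k b, red k c), red k d) \<in> S"
        using d1 by (simp add: S_def U_def residues_val_def)
      then show ?thesis unfolding z F1_def by (intro UnI1 image_eqI[rotated]) auto
    next
      assume "valuation_form k 0 (red k b)"
      then have "((red k b, red k a, red k d), red k c) \<in> S"
        using d2 by (simp add: S_def U_def residues_val_def)
      then show ?thesis unfolding z F2_def by (intro UnI2 image_eqI[rotated]) auto
    qed
  qed
  have fin: "finite (F1 ` S \<union> F2 ` S)" using finS by simp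
  have "finite (carrier (quotient k))"
    using finite_subset[OF sub fin] code_inj by (simp add: finite_image_iff)
  moreover have "card (carrier (quotient k)) \<le> card (F1 ` S \<union> F2 ` S)"
    using card_inj_on_le[OF code_inj sub fin] .
  moreover have "card (F1 ` S \<union> F2 ` S) \<le> card S + card S"
    using card_Un_le[of "F1 ` S" "F2 ` S"] card_image_le[OF finS, of F1] card_image_le[OF finS, of F2] by linarith
  ultimately show ?thesis using cS by simp
qed

definition unit_residues :: "nat \<Rightarrow> 'a set" where
  "unit_residues k = {x \<in> residues k. x dvd 1}"

lemma card_unit_residues_ge:
  assumes "k > 0"
  shows "q ^ k \<le> 2 * card (unit_residues k)"
proof -
  have "residues k \<subseteq> unit_residues k \<union> {x \<in> residues k. t ^ 1 dvd x}"
    by (auto simp: unit_residues_def unit_iff)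
  then have "card (residues k) \<le> card (unit_residues k \<union> {x \<in> residues k. t ^ 1 dvd x})"
    by (rule card_mono[rotated]) (auto simp: unit_residues_def)
  also have "\<dots> \<le> card (unit_residues k) + card {x \<in> residues k. t ^ 1 dvd x}" by (rule card_Un_le)
  also have "\<dots> \<le> card (unit_residues k) + q ^ (k - 1)"
    using card_multiples_le[of 1 k] assms by simp
  finally have "q ^ k \<le> card (unit_residues k) + q ^ (k - 1)" using card_residues by simp
  moreover have "2 * q ^ (k - 1) \<le> q * q ^ (k - 1)" using q_ge_2 by simp
  moreover have "q * q ^ (k - 1) = q ^ k" using assms by (simp add: power_eq_if)
  ultimately show ?thesis by linarith
qed

text \<open>A unit \<open>a\<close> and arbitrary entries \<open>b\<close> and \<open>c\<close> extend to a matrix of determinant one.\<close>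

lemma card_quotient_ge: "q ^ (3 * k) \<le> 2 * card (carrier (quotient k))"
proof (cases "k = 0")
  case True
  have "principal_congruence k #>\<^bsub>G\<^esub> 1\<^sub>m 2 \<in> carrier (quotient k)" using G.one_closed by (auto simp: carrier_FactGroup)
  then have "card (carrier (quotient k)) > 0" using card_quotient_le[of k] card_gt_0_iff by blast
  then show ?thesis using True by simp
next
  case False
  define iv where "iv a = (SOME v. a * v = 1)" for a :: 'a
  have iv: "a * iv a = 1" if "a dvd 1" for a
    using that unfolding iv_def by (intro someI_ex[of "\<lambda>v. a * v = 1"]) (auto simp: dvd_def)
  let ?R = "residues k"
  define F where "F = (\<lambda>(a, b, c). principal_congruence k #>\<^bsub>G\<^esub> mat2 a b c (iv a * (1 + b * c)))"
  have SLm: "mat2 a b c (iv a * (1 + b * c)) \<in> carrier G" if "a dvd 1" for a b c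
  proof -
    have "a * (iv a * (1 + b * c)) = (a * iv a) * (1 + b * c)" by (simp only: mult.assoc)
    also have "\<dots> = 1 + b * c" using iv[OF that] by simp
    finally have "a * (iv a * (1 + b * c)) - b * c = 1 + b * c - b * c" by (simp only:)
    also have "\<dots> = 1" by (simp only: diff_eq add.assoc add_self add_0_right)
    finally show ?thesis unfolding mat2_in_SL2 .
  qed
  have "inj_on F (unit_residues k \<times> ?R \<times> ?R)"
  proof (rule inj_onI)
    fix z z' assume "z \<in> unit_residues k \<times> ?R \<times> ?R" "z' \<in> unit_residues k \<times> ?R \<times> ?R" and e': "F z = F z'"
    then obtain a b c a' b' c' where z: "z = (a, b, c)" "z' = (a', b', c')"
      and r: "a \<in> unit_residues k" "b \<in> ?R" "c \<in> ?R" "a' \<in> unit_residues k" "b' \<in> ?R" "c' \<in> ?R" by blast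
    have e: "F (a, b, c) = F (a', b', c')" using e' by (simp only: z)
    have u: "a dvd 1" "a' dvd 1" "a \<in> ?R" "a' \<in> ?R" using r by (auto simp: unit_residues_def)
    have "congruent k a a' \<and> congruent k b b' \<and> congruent k c c'"
      using e coset_eq_iff[OF SLm[OF u(1)] SLm[OF u(2)]] by (simp add: F_def mat_congruent_mat2)
    then have "a = a' \<and> b = b' \<and> c = c'"
      using residues_eqI r u unfolding congruent_def by blast
    then show "z = z'" by (simp only: z)
  qed
  moreover have "F ` (unit_residues k \<times> ?R \<times> ?R) \<subseteq> carrier (quotient k)"
    using SLm by (auto simp: F_def carrier_FactGroup unit_residues_def)
  moreover have "finite (carrier (quotient k))" using card_quotient_le by blast
  ultimately have "card (unit_residues k \<times> ?R \<times> ?R) \<le> card (carrier (quotient k))" by (rule card_inj_on_le)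
  then have "card (unit_residues k) * (q ^ k * q ^ k) \<le> card (carrier (quotient k))"
    using card_residues by (simp add: card_cartesian_product)
  moreover have "q ^ (3 * k) = q ^ k * (q ^ k * q ^ k)"
  proof -
    have "q ^ k * (q ^ k * q ^ k) = q ^ (k + (k + k))" by (simp only: power_add)
    also have "k + (k + k) = 3 * k" by simp
    finally show ?thesis by simp
  qed
  moreover have "q ^ k * (q ^ k * q ^ k) \<le> (2 * card (unit_residues k)) * (q ^ k * q ^ k)"
    using card_unit_residues_ge[of k] False by (intro mult_right_mono) auto
  moreover have "(2 * card (unit_residues k)) * (q ^ k * q ^ k) = 2 * (card (unit_residues k) * (q ^ k * q ^ k))"
    by (simp only: mult.assoc)
  ultimately show ?thesis by linarith
qed

lemma finite_quotient: "finite_group (quotient k)"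
  by (rule normal.finite_group_FactGroup[OF principal_congruence_normal]) (simp add: card_quotient_le)

lemma quotient_mult:
  assumes C: "C \<in> carrier (quotient k)" and D: "D \<in> carrier (quotient k)"
  shows "C \<otimes>\<^bsub>quotient k\<^esub> D = principal_congruence k #>\<^bsub>G\<^esub> (coset_rep C * coset_rep D)"
proof -
  interpret N: normal "principal_congruence k" G by (rule principal_congruence_normal)
  have "C \<otimes>\<^bsub>quotient k\<^esub> D = 
    (principal_congruence k #>\<^bsub>G\<^esub> coset_rep C) <#>\<^bsub>G\<^esub> (principal_congruence k #>\<^bsub>G\<^esub> coset_rep D)"
    using coset_rep_props(2)[OF C] coset_rep_props(2)[OF D] by simp
  also have "\<dots> = principal_congruence k #>\<^bsub>G\<^esub> (coset_rep C * coset_rep D)"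
    using N.rcos_sum[OF coset_rep_props(1)[OF C] coset_rep_props(1)[OF D]] by simp
  finally show ?thesis .
qed

lemma congruent_zeroI:
  assumes "congruent k x y"
  shows "t ^ k dvd x - y"
  using assms by (simp only: congruent_def)

lemma card_commuting_pairs_le:
  "card {(C, D) \<in> carrier (quotient k) \<times> carrier (quotient k). C \<otimes>\<^bsub>quotient k\<^esub> D = D \<otimes>\<^bsub>quotient k\<^esub> C}
     \<le> card (commuting_tuples k)" (is "card ?P \<le> _")
proof -
  define tr where "tr A = A $$ (0, 0) + A $$ (Suc 0, Suc 0)" for A :: "'a mat"
  define T where "T = (\<lambda>A. (red k (A $$ (0, 0)), red k (tr A), red k (A $$ (0, Suc 0)), red k (A $$ (Suc 0, 0))))"
  define F where "F = (\<lambda>(C, D). case T (coset_rep C) of (a, \<alpha>, b, c) \<Rightarrow> case T (coset_rep D) of (e, \<beta>, f, x) \<Rightarrow>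
    (a, \<alpha>, b, c, e, \<beta>, f, x))"
  have T_inj: "C = D" if C: "C \<in> carrier (quotient k)" and D: "D \<in> carrier (quotient k)"
    and e: "T (coset_rep C) = T (coset_rep D)" for C D
  proof -
    obtain a b c d where m: "coset_rep C = mat2 a b c d" "a * d - b * c = 1"
      using coset_rep_props(1)[OF C] by (rule SL2_cases)
    obtain a' b' c' d' where m': "coset_rep D = mat2 a' b' c' d'" "a' * d' - b' * c' = 1"
      using coset_rep_props(1)[OF D] by (rule SL2_cases)
    have cg: "congruent k a a'" "congruent k (a + d) (a' + d')" "congruent k b b'" "congruent k c c'"
      using e by (simp_all add: m m' T_def tr_def congruent_iff_red)
    have "congruent k (a + (a + d)) (a' + (a' + d'))" by (rule congruent_add[OF cg(1,2)])
    then have "congruent k d d'" by simp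
    then have "code k (coset_rep C) = code k (coset_rep D)"
      using cg unfolding code_eq_iff m(1) m'(1) mat_congruent_mat2 by blast
    then show "C = D" using code_inj C D by (auto dest: inj_onD)
  qed
  have "inj_on F ?P"
  proof (rule inj_onI)
    fix z w assume "z \<in> ?P" "w \<in> ?P" and e: "F z = F w"
    then obtain C D C' D' where zw: "z = (C, D)" "w = (C', D')" and c: "C \<in> carrier (quotient k)"
      "D \<in> carrier (quotient k)" "C' \<in> carrier (quotient k)" "D' \<in> carrier (quotient k)" by blast
    have "T (coset_rep C) = T (coset_rep C')" "T (coset_rep D) = T (coset_rep D')"
      using e by (simp_all add: F_def zw T_def)
    then show "z = w" using T_inj c zw by blast
  qed
  moreover have "F ` ?P \<subseteq> commuting_tuples k"
  proof
    fix z assume "z \<in> F ` ?P"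
    then obtain C D where z: "z = F (C, D)" and C: "C \<in> carrier (quotient k)" and D: "D \<in> carrier (quotient k)"
      and comm: "C \<otimes>\<^bsub>quotient k\<^esub> D = D \<otimes>\<^bsub>quotient k\<^esub> C" by blast
    obtain a b c d where m: "coset_rep C = mat2 a b c d" "a * d - b * c = 1"
      using coset_rep_props(1)[OF C] by (rule SL2_cases)
    obtain e f x y where m': "coset_rep D = mat2 e f x y" "e * y - f * x = 1"
      using coset_rep_props(1)[OF D] by (rule SL2_cases)
    define \<alpha> \<beta> where "\<alpha> = a + d" and "\<beta> = e + y"
    have "coset_rep C * coset_rep D \<in> carrier G" "coset_rep D * coset_rep C \<in> carrier G"
      using G.m_closed[OF coset_rep_props(1)[OF C] coset_rep_props(1)[OF D]] G.m_closed[OF coset_rep_props(1)[OF D] coset_rep_props(1)[OF C]]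
      by simp_all
    then have "mat_congruent k (coset_rep C * coset_rep D) (coset_rep D * coset_rep C)"
      using comm unfolding quotient_mult[OF C D] quotient_mult[OF D C] by (simp add: coset_eq_iff)
    then have cg: "congruent k (a * e + b * x) (e * a + f * c)" "congruent k (a * f + b * y) (e * b + f * d)"
      "congruent k (c * e + d * x) (x * a + y * c)"
      unfolding m(1) m'(1) mat2_mult mat_congruent_mat2 by blast+
    have c1: "t ^ k dvd b * x - c * f"
    proof -
      have "(a * e + b * x) - (e * a + f * c) = b * x - c * f" by (simp add: ac_simps)
      then show ?thesis using congruent_zeroI[OF cg(1)] by (simp only:)
    qed
    have c2: "t ^ k dvd b * \<beta> - \<alpha> * f"
    proof -
      have "(a * f + b * y) - (e * b + f * d) = b * \<beta> - \<alpha> * f" by (simp add: \<alpha>_def \<beta>_def algebra_simps)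
      then show ?thesis using congruent_zeroI[OF cg(2)] by (simp only:)
    qed
    have c3: "t ^ k dvd c * \<beta> - \<alpha> * x"
    proof -
      have "(c * e + d * x) - (x * a + y * c) = c * \<beta> - \<alpha> * x" by (simp add: \<alpha>_def \<beta>_def algebra_simps)
      then show ?thesis using congruent_zeroI[OF cg(3)] by (simp only:)
    qed
    have d1: "a * a + \<alpha> * a + (b * c + 1) = 0"
    proof -
      have "a * a + \<alpha> * a + (b * c + 1) = (a * d + b * c) + 1" by (simp add: \<alpha>_def algebra_simps)
      also have "\<dots> = 0" using m(2) by (simp only: diff_eq two_eq_zero)
      finally show ?thesis .
    qed
    have d2: "e * e + \<beta> * e + (f * x + 1) = 0"
    proof -
      have "e * e + \<beta> * e + (f * x + 1) = (e * y + f * x) + 1" by (simp add: \<beta>_def algebra_simps)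
      also have "\<dots> = 0" using m'(2) by (simp only: diff_eq two_eq_zero)
      finally show ?thesis .
    qed
    have z': "z = (red k a, red k \<alpha>, red k b, red k c, red k e, red k \<beta>, red k f, red k x)"
      by (simp add: z F_def T_def tr_def m m' \<alpha>_def \<beta>_def)
    have transfer: "t ^ k dvd u'" if "congruent k u' u" "t ^ k dvd u" for u u'
      using that congruent_trans congruent_zero by blast
    show "z \<in> commuting_tuples k"
      unfolding z' commuting_tuples_def mem_Collect_eq prod.case
    proof (intro conjI)
      show "t ^ k dvd red k a * red k a + red k \<alpha> * red k a + (red k b * red k c + 1)"
        by (rule transfer[OF _ dvd_0_right])
          (subst d1[symmetric], intro congruent_add congruent_mult congruent_red congruent_refl)
      show "t ^ k dvd red k e * red k e + red k \<beta> * red k e + (red k f * red k x + 1)"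
        by (rule transfer[OF _ dvd_0_right])
          (subst d2[symmetric], intro congruent_add congruent_mult congruent_red congruent_refl)
      show "t ^ k dvd red k b * red k x - red k c * red k f"
        unfolding diff_eq
        by (rule transfer[OF _ c1]) (unfold diff_eq, intro congruent_add congruent_mult congruent_red)
      show "t ^ k dvd red k b * red k \<beta> - red k \<alpha> * red k f"
        unfolding diff_eq
        by (rule transfer[OF _ c2]) (unfold diff_eq, intro congruent_add congruent_mult congruent_red)
      show "t ^ k dvd red k c * red k \<beta> - red k \<alpha> * red k x"
        unfolding diff_eq
        by (rule transfer[OF _ c3]) (unfold diff_eq, intro congruent_add congruent_mult congruent_red)
    qed simp
  qed
  ultimately show ?thesis by (rule card_inj_on_le) simp
qed

abbreviation class_number :: "nat \<Rightarrow> nat" where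
  "class_number k \<equiv> card (finite_group.conj_classes (quotient k))"

lemma class_number_le: "class_number k \<le> 24 * Suc k ^ 3 * q ^ k"
proof -
  interpret Q: finite_group "quotient k" by (rule finite_quotient)
  have "class_number k * q ^ (3 * k) \<le> 2 * (class_number k * order (quotient k))"
    using mult_left_mono[OF card_quotient_ge[of k], of "class_number k"] by (simp add: order_def ac_simps)
  also have "\<dots> \<le> 2 * card (commuting_tuples k)"
    using Q.card_commuting_pairs_ge card_commuting_pairs_le[of k] by simp
  also have "\<dots> \<le> 2 * (12 * Suc k ^ 3 * q ^ (4 * k))" using card_commuting_tuples_le[of k] by simp
  also have "q ^ (4 * k) = q ^ k * q ^ (3 * k)" by (simp flip: power_add)
  finally have "class_number k * q ^ (3 * k) \<le> (24 * Suc k ^ 3 * q ^ k) * q ^ (3 * k)" by (simp add: ac_simps)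
  moreover have "q ^ (3 * k) > 0" using q_ge_2 by simp
  ultimately show ?thesis by (metis mult_le_cancel2)
qed

text \<open>The trace separates the classes of the matrices with rows \<open>(x, 1)\<close> and \<open>(1, 0)\<close>.  The trace of a coset
  is not available as a function, so the conjugating matrix is used instead: its entries are
  annihilated modulo \<open>t\<^sup>k\<close> by the difference of the traces, and hence so is its determinant.\<close>

lemma class_number_ge: "q ^ k \<le> class_number k"
proof -
  interpret Q: finite_group "quotient k" by (rule finite_quotient)
  let ?K = "principal_congruence k"
  have m: "mat2 x 1 1 0 \<in> carrier G" for x :: 'a by (simp add: mat2_in_SL2)
  have mc: "?K #>\<^bsub>G\<^esub> mat2 x 1 1 0 \<in> carrier (quotient k)" for x :: 'a
    using m by (auto simp: carrier_FactGroup)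
  have "inj_on (\<lambda>x. Q.conj_class (?K #>\<^bsub>G\<^esub> mat2 x 1 1 0)) (residues k)"
  proof (rule inj_onI)
    fix x y assume xy: "x \<in> residues k" "y \<in> residues k"
      and e: "Q.conj_class (?K #>\<^bsub>G\<^esub> mat2 x 1 1 0) = Q.conj_class (?K #>\<^bsub>G\<^esub> mat2 y 1 1 0)"
    let ?X = "?K #>\<^bsub>G\<^esub> mat2 x 1 1 0" and ?Y = "?K #>\<^bsub>G\<^esub> mat2 y 1 1 0"
    have "?X \<in> Q.conj_class ?Y" using Q.conj_class_self[OF mc[of x]] e by simp
    then obtain H where H: "H \<in> carrier (quotient k)"
      "?X = H \<otimes>\<^bsub>quotient k\<^esub> ?Y \<otimes>\<^bsub>quotient k\<^esub> inv\<^bsub>quotient k\<^esub> H" by (auto simp: Q.conj_class_def)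
    have eq: "?X \<otimes>\<^bsub>quotient k\<^esub> H = H \<otimes>\<^bsub>quotient k\<^esub> ?Y"
      using H mc[of y] Q.m_assoc Q.l_inv Q.inv_closed Q.m_closed Q.r_one by metis
    obtain B where B: "B \<in> carrier G" "H = ?K #>\<^bsub>G\<^esub> B" using H(1) by (auto simp: carrier_FactGroup)
    obtain a b c d where Bm: "B = mat2 a b c d" "a * d - b * c = 1" using B(1) by (rule SL2_cases)
    interpret N: normal ?K G by (rule principal_congruence_normal)
    have "?K #>\<^bsub>G\<^esub> (mat2 x 1 1 0 * B) = ?K #>\<^bsub>G\<^esub> (B * mat2 y 1 1 0)"
      using eq N.rcos_sum[OF m[of x] B(1)] N.rcos_sum[OF B(1) m[of y]] by (simp add: B(2))
    then have "mat_congruent k (mat2 x 1 1 0 * B) (B * mat2 y 1 1 0)"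
      using G.m_closed[OF m[of x] B(1)] G.m_closed[OF B(1) m[of y]] by (simp add: coset_eq_iff)
    then have cg: "t ^ k dvd (x * a + c) - (a * y + b)" "t ^ k dvd (x * b + d) - a"
      "t ^ k dvd a - (c * y + d)" "t ^ k dvd b - c"
      unfolding Bm(1) mat2_mult mat_congruent_mat2 by (simp_all add: congruent_def)
    have a: "t ^ k dvd a * (x - y)"
    proof -
      have "a * (x - y) = ((x * a + c) - (a * y + b)) + (b - c)" by (simp add: algebra_simps)
      then show ?thesis using dvd_add[OF cg(1,4)] by (simp only:)
    qed
    have b: "t ^ k dvd b * (x - y)"
    proof -
      have "b * (x - y) = ((x * b + d) - a) + (a - (c * y + d)) + y * (b - c)" by (simp add: algebra_simps)
      then show ?thesis using dvd_add[OF dvd_add[OF cg(2,3)] dvd_mult[OF cg(4), of y]] by (simp only:)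
    qed
    have "x - y = d * (a * (x - y)) - c * (b * (x - y))"
    proof -
      have "d * (a * (x - y)) - c * (b * (x - y)) = (a * d - b * c) * (x - y)" by (simp add: algebra_simps)
      then show ?thesis using Bm(2) by simp
    qed
    moreover have "t ^ k dvd d * (a * (x - y)) - c * (b * (x - y))"
      by (intro dvd_diff dvd_mult a b)
    ultimately have "t ^ k dvd x - y" by (simp only:)
    then show "x = y" using residues_eqI xy by blast
  qed
  moreover have "(\<lambda>x. Q.conj_class (?K #>\<^bsub>G\<^esub> mat2 x 1 1 0)) ` residues k \<subseteq> Q.conj_classes"
    using mc by (auto simp: Q.conj_classes_def)
  ultimately have "card (residues k) \<le> card Q.conj_classes" by (rule card_inj_on_le) simp
  then show ?thesis using card_residues by simp
qed

end

section \<open>A lower bound for dimensions\<close>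

text \<open>Eigenvectors for distinct systems of eigenvalues are linearly independent: a shortest relation
  is shortened by applying an operator that distinguishes two of its members.\<close>

lemma simultaneous_eigenvectors_card_le:
  fixes T :: "'x \<Rightarrow> complex mat" and w :: "'i \<Rightarrow> complex Matrix.vec"
  assumes I: "finite I"
    and T: "\<And>x. x \<in> D \<Longrightarrow> T x \<in> carrier_mat n n"
    and w: "\<And>a. a \<in> I \<Longrightarrow> w a \<in> carrier_vec n" "\<And>a. a \<in> I \<Longrightarrow> w a \<noteq> 0\<^sub>v n"
    and eig: "\<And>a x. a \<in> I \<Longrightarrow> x \<in> D \<Longrightarrow> T x *\<^sub>v w a = \<chi> a x \<cdot>\<^sub>v w a"
    and dist: "\<And>a b. a \<in> I \<Longrightarrow> b \<in> I \<Longrightarrow> a \<noteq> b \<Longrightarrow> \<exists>x\<in>D. \<chi> a x \<noteq> \<chi> b x"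
  shows "card I \<le> n"
proof -
  have ind: "\<forall>a\<in>S. c a = 0" if "finite S" "S \<subseteq> I" "\<And>i. i < n \<Longrightarrow> (\<Sum>a\<in>S. c a * w a $ i) = 0" for S c
    using that
  proof (induction S arbitrary: c rule: finite_induct)
    case empty
    then show ?case by simp
  next
    case (insert b S)
    have b: "b \<in> I" and S: "S \<subseteq> I" using insert.prems by auto
    have eigi: "(\<Sum>j<n. T x $$ (i, j) * w a $ j) = \<chi> a x * w a $ i" if "a \<in> I" "x \<in> D" "i < n" for a x i
    proof -
      have "(T x *\<^sub>v w a) $ i = (\<Sum>j<n. T x $$ (i, j) * w a $ j)"
        using T[OF that(2)] w(1)[OF that(1)] that(3) by (simp add: scalar_prod_def atLeast0LessThan)
      moreover have "(\<chi> a x \<cdot>\<^sub>v w a) $ i = \<chi> a x * w a $ i" using w(1)[OF that(1)] that(3) by simp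
      ultimately show ?thesis using eig[OF that(1,2)] by simp
    qed
    have 1: "(\<Sum>a\<in>insert b S. (c a * \<chi> a x) * w a $ i) = 0" if "x \<in> D" "i < n" for x i
    proof -
      have "(\<Sum>a\<in>insert b S. (c a * \<chi> a x) * w a $ i) = (\<Sum>a\<in>insert b S. c a * (\<Sum>j<n. T x $$ (i, j) * w a $ j))"
      proof (rule sum.cong[OF refl])
        fix a assume "a \<in> insert b S"
        then have "a \<in> I" using insert.prems(1) by blast
        then show "(c a * \<chi> a x) * w a $ i = c a * (\<Sum>j<n. T x $$ (i, j) * w a $ j)"
          using eigi[of a x i] that by (simp add: mult.assoc)
      qed
      also have "\<dots> = (\<Sum>j<n. T x $$ (i, j) * (\<Sum>a\<in>insert b S. c a * w a $ j))"
        unfolding sum_distrib_left by (subst sum.swap) (simp only: mult.left_commute)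
      also have "\<dots> = 0" by (rule sum.neutral) (use insert.prems(2) in simp)
      finally show ?thesis .
    qed
    have 2: "(\<Sum>a\<in>S. (c a * (\<chi> a x - \<chi> b x)) * w a $ i) = 0" if "x \<in> D" "i < n" for x i
    proof -
      have "(\<Sum>a\<in>insert b S. (c a * (\<chi> a x - \<chi> b x)) * w a $ i) = 
        (\<Sum>a\<in>insert b S. (c a * \<chi> a x) * w a $ i) - \<chi> b x * (\<Sum>a\<in>insert b S. c a * w a $ i)"
        unfolding sum_distrib_left sum_subtractf[symmetric] by (rule sum.cong) (simp_all add: algebra_simps)
      also have "\<dots> = 0" using 1[OF that] insert.prems(2)[OF that(2)] by (simp only: diff_0_right mult_zero_right)
      finally show ?thesis using insert.hyps by simp
    qed
    have S0: "c a = 0" if a: "a \<in> S" for a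
    proof -
      have "a \<noteq> b" "a \<in> I" using a insert.hyps S by auto
      then obtain x where x: "x \<in> D" "\<chi> a x \<noteq> \<chi> b x" using dist b by blast
      have "\<forall>a\<in>S. c a * (\<chi> a x - \<chi> b x) = 0"
        by (rule insert.IH[OF S]) (rule 2[OF x(1)])
      then show ?thesis using a x(2) by auto
    qed
    have "c b = 0"
    proof (rule ccontr)
      assume cb: "c b \<noteq> 0"
      have "w b = 0\<^sub>v n"
      proof (rule eq_vecI)
        fix i assume "i < dim_vec (0\<^sub>v n)"
        then have i: "i < n" by simp
        have "(\<Sum>a\<in>S. c a * w a $ i) = 0" by (rule sum.neutral) (simp add: S0)
        then have "c b * w b $ i = 0" using insert.prems(2)[OF i] insert.hyps by simp
        then show "w b $ i = 0\<^sub>v n $ i" using cb i by simp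
      qed (use w(1)[OF b] in simp)
      then show False using w(2)[OF b] by blast
    qed
    then show ?case using S0 by blast
  qed
  have "card I \<le> card {..<n}"
  proof (rule independent_functions_card_le[where F = "\<lambda>a. ($) (w a)"])
    fix c assume "\<And>x. x \<in> {..<n} \<Longrightarrow> (\<Sum>i\<in>I. c i * w i $ x) = 0"
    then show "\<forall>i\<in>I. c i = 0" by (intro ind[OF I]) auto
  qed (use I in auto)
  then show ?thesis by simp
qed

context char_two_uniformizer
begin

interpretation G: Group.group G by (rule group_SL)

definition unip :: "'a \<Rightarrow> 'a mat" where "unip x = mat2 1 x 0 1"

lemma unip_in_SL2 [simp]: "unip x \<in> carrier G"
  by (simp add: unip_def mat2_in_SL2)

lemma unip_mult: "unip x * unip y = unip (x + y)"
  by (simp add: unip_def mat2_mult add.commute)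

lemma unip_0: "unip 0 = 1\<^sub>m 2"
  by (simp add: unip_def one_mat2)

lemma unip_congruent: "mat_congruent k (unip x) (unip y) \<longleftrightarrow> congruent k x y"
  by (simp add: unip_def mat_congruent_mat2)

lemma rep_congruent:
  assumes \<rho>: "\<rho> \<in> hom G (GL n)" and triv: "\<And>g. g \<in> principal_congruence k \<Longrightarrow> \<rho> g = 1\<^sub>m n"
    and A: "A \<in> carrier G" "B \<in> carrier G" "mat_congruent k A B"
  shows "\<rho> A = \<rho> B"
proof -
  have iB: "inv\<^bsub>G\<^esub> B \<in> carrier G" using A by simp
  have "A = A * inv\<^bsub>G\<^esub> B * B"
    using G.m_assoc[OF A(1) iB A(2)] G.l_inv[OF A(2)] SL2_carrier_mat[OF A(1)] by simp
  then have "\<rho> A = \<rho> (A * inv\<^bsub>G\<^esub> B) * \<rho> B"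
    using rep_mult[OF \<rho> G.m_closed[OF A(1) iB] A(2)] by simp
  also have "\<rho> (A * inv\<^bsub>G\<^esub> B) = 1\<^sub>m n"
    by (rule triv) (simp add: principal_congruence_mult_inv A)
  finally show ?thesis using rep_carrier[OF \<rho> A(2)] by simp
qed

lemma rep_conj_trivial:
  assumes \<rho>: "\<rho> \<in> hom G (GL n)" and A: "A \<in> carrier G" and C: "C \<in> carrier G" "C * C = 1\<^sub>m 2" and z: "\<rho> A = 1\<^sub>m n"
  shows "\<rho> (C * A * C) = 1\<^sub>m n"
proof -
  have CA: "C * A \<in> carrier G" using G.m_closed[OF C(1) A] by simp
  have "\<rho> (C * A * C) = \<rho> C * \<rho> A * \<rho> C"
    using rep_mult[OF \<rho> CA C(1)] rep_mult[OF \<rho> C(1) A] by simp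
  also have "\<dots> = \<rho> C * \<rho> C" using z rep_carrier[OF \<rho> C(1)] by simp
  also have "\<dots> = \<rho> (C * C)" using rep_mult[OF \<rho> C(1) C(1)] by simp
  also have "\<dots> = 1\<^sub>m n" using rep_one[OF G.is_group \<rho>] C(2) by simp
  finally show ?thesis .
qed

text \<open>Modulo \<open>t\<^sup>k\<close> the subgroup of level \<open>k - 1\<close> is the additive group of matrices of trace zero over
  the residue field, and in characteristic two it contains the scalar matrices.  The upper unipotent
  matrices in it generate it together with their conjugates by the matrices with rows
  \<open>(1, 0), (1, 1)\<close> and \<open>(0, 1), (1, 0)\<close>; both of these are involutions in characteristic two.\<close>

lemma principal_congruence_generated:
  assumes \<rho>: "\<rho> \<in> hom G (GL n)" and triv: "\<And>g. g \<in> principal_congruence k \<Longrightarrow> \<rho> g = 1\<^sub>m n"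
    and k: "k \<ge> 2" and u: "\<And>y. \<rho> (unip (t ^ (k - 1) * y)) = 1\<^sub>m n"
    and A: "A \<in> principal_congruence (k - 1)"
  shows "\<rho> A = 1\<^sub>m n"
proof -
  define s where "s = t ^ (k - 1)"
  have ss: "t ^ k dvd s * s"
  proof -
    have "s * s = t ^ (k - 1 + (k - 1))" by (simp only: s_def power_add)
    then show ?thesis using k by (simp add: le_imp_power_dvd)
  qed
  have st: "t ^ k dvd s * y" if "t dvd y" for y
  proof -
    have "t ^ k = s * t" using k by (simp add: s_def power_eq_if mult.commute)
    then show ?thesis using that by (simp add: mult_dvd_mono)
  qed
  have AG: "A \<in> carrier G" using A by (simp add: principal_congruence_def)
  obtain a b c d where m: "A = mat2 a b c d" "a * d - b * c = 1" using AG by (rule SL2_cases)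
  have "mat_congruent (k - 1) (mat2 a b c d) (mat2 1 0 0 1)"
    using A unfolding m(1) one_mat2[symmetric] by (simp add: principal_congruence_def)
  then have "s dvd a - 1" "s dvd b" "s dvd c" "s dvd d - 1"
    by (simp_all add: mat_congruent_mat2 congruent_def s_def)
  then obtain x y z w where xyzw: "a - 1 = s * x" "b = s * y" "c = s * z" "d - 1 = s * w" by (auto elim!: dvdE)
  have a: "a = 1 + s * x" and d: "d = 1 + s * w"
    using xyzw(1,4) by (metis diff_eq add.commute add_self_left)+
  have s0: "s \<noteq> 0" using t_nonzero by (simp add: s_def)
  have "s * (x + w + s * (x * w + y * z)) = (a * d + b * c) + 1"
    unfolding a d xyzw(2,3) by (simp add: algebra_simps)
  also have "\<dots> = 0" using m(2) by (simp only: diff_eq two_eq_zero)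
  finally have "x + w + s * (x * w + y * z) = 0" using s0 by simp
  then have xw: "x + w = s * (x * w + y * z)" by (simp only: add_eq_0_iff minus_eq)
  have "t dvd s" using k by (simp add: s_def dvd_power)
  then have txw: "t dvd x + w" unfolding xw by simp
  \<comment> \<open>The parameters are read off from the product of the three factors modulo \<open>s\<^sup>2\<close>, which is divisible by \<open>t\<^sup>k\<close>.\<close>
  define p r v where "p = s * x" and "r = s * (y + x)" and "v = s * (z + x)"
  define E where "E = mat2 1 0 1 1 * unip p * mat2 1 0 1 (1::'a)"
  define L where "L = mat2 0 1 1 0 * unip v * mat2 0 1 1 (0::'a)"
  have E1: "mat2 1 0 1 (1::'a) \<in> carrier G" "mat2 0 1 1 (0::'a) \<in> carrier G" by (simp_all add: mat2_in_SL2)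
  have E: "E \<in> carrier G" "L \<in> carrier G"
    unfolding E_def L_def using G.m_closed[OF G.m_closed[OF E1(1) unip_in_SL2[of p]] E1(1)]
      G.m_closed[OF G.m_closed[OF E1(2) unip_in_SL2[of v]] E1(2)] by simp_all
  have EL: "\<rho> E = 1\<^sub>m n" "\<rho> L = 1\<^sub>m n"
    unfolding E_def L_def p_def v_def s_def
    by (rule rep_conj_trivial[OF \<rho> unip_in_SL2 _ _ u]; simp add: E1 mat2_mult one_mat2)+
  define B where "B = E * unip r * L"
  have ErG: "E * unip r \<in> carrier G" using G.m_closed[OF E(1) unip_in_SL2[of r]] by simp
  have BG: "B \<in> carrier G" unfolding B_def using G.m_closed[OF ErG E(2)] by simp
  have "\<rho> B = 1\<^sub>m n"
    unfolding B_def using rep_mult[OF \<rho> ErG E(2)] rep_mult[OF \<rho> E(1) unip_in_SL2[of r]] EL u[of "y + x"]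
    by (simp add: r_def s_def)
  moreover have "mat_congruent k A B"
  proof -
    have Em: "E = mat2 (1 + p) p p (1 + p)" unfolding E_def unip_def mat2_mult by (simp add: ac_simps)
    have Lm: "L = mat2 1 0 v 1" unfolding L_def unip_def mat2_mult by simp
    have Bm: "B = mat2 (1 + p + ((1 + p) * r + p) * v) ((1 + p) * r + p) (p + (p * r + 1 + p) * v) (p * r + 1 + p)"
      unfolding B_def Em Lm unip_def mat2_mult by (simp add: algebra_simps)
    have sp: "s dvd p" "s dvd r" "s dvd v" by (simp_all add: p_def r_def v_def)
    have prod: "t ^ k dvd m * m'" if "s dvd m" "s dvd m'" for m m'
      using dvd_trans[OF ss mult_dvd_mono[OF that]] .
    have "t ^ k dvd ((1 + p) * r + p) * v" by (rule prod) (use sp in auto)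
    moreover have "t ^ k dvd p * r" by (rule prod) (use sp in auto)
    moreover have "t ^ k dvd (p * r + p) * v" by (rule prod) (use sp in auto)
    moreover have "t ^ k dvd s * (x + w)" by (rule st[OF txw])
    moreover have "a + (1 + p + ((1 + p) * r + p) * v) = ((1 + p) * r + p) * v" by (simp add: a p_def ac_simps)
    moreover have "b + ((1 + p) * r + p) = p * r" unfolding xyzw(2) p_def r_def by (simp add: algebra_simps)
    moreover have "c + (p + (p * r + 1 + p) * v) = (p * r + p) * v" unfolding xyzw(3) p_def v_def by (simp add: algebra_simps)
    moreover have "d + (p * r + 1 + p) = s * (x + w) + p * r" unfolding d p_def by (simp add: algebra_simps)
    ultimately show ?thesis unfolding m(1) Bm mat_congruent_mat2 congruent_def diff_eq by (simp only: dvd_add)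
  qed
  ultimately show ?thesis using rep_congruent[OF \<rho> triv AG BG] by simp
qed

lemma dvd_square:
  assumes "t ^ k dvd z * z"
  shows "t ^ (k div 2) dvd z"
proof -
  obtain e where e: "e \<le> k" "t ^ e dvd z" "t ^ (k - e) dvd z" using assms by (rule dvd_mult_split)
  have "k div 2 \<le> e \<or> k div 2 \<le> k - e" by linarith
  then show ?thesis using e le_imp_power_dvd dvd_trans by blast
qed

text \<open>Commuting involutions, with a prescribed one of them acting by \<open>-1\<close>.  If \<open>v\<close> is such a vector for
  \<open>F\<close>, then \<open>v + U x v\<close> is one for \<open>insert x F\<close>, unless it is zero, in which case \<open>v\<close> already is.\<close>

lemma joint_eigenvector:
  fixes U :: "'b \<Rightarrow> complex mat"
  assumes U: "\<And>x. U x \<in> carrier_mat n n" and comm: "\<And>x y. U x * U y = U y * U x"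
    and inv: "\<And>x. U x * U x = 1\<^sub>m n" and s0: "U s0 \<noteq> 1\<^sub>m n" and fin: "finite F"
  shows "\<exists>v\<in>carrier_vec n. v \<noteq> 0\<^sub>v n \<and> U s0 *\<^sub>v v = (-1) \<cdot>\<^sub>v v \<and> 
    (\<forall>x\<in>F. \<exists>c. U x *\<^sub>v v = c \<cdot>\<^sub>v v)"
  using fin
proof (induction F rule: finite_induct)
  case empty
  have dU [simp]: "dim_row (U x) = n" "dim_col (U x) = n" for x using U[of x] by auto
  have "\<exists>u\<in>carrier_vec n. U s0 *\<^sub>v u \<noteq> u"
  proof (rule ccontr)
    assume n: "\<not> (\<exists>u\<in>carrier_vec n. U s0 *\<^sub>v u \<noteq> u)"
    have "U s0 - 1\<^sub>m n = 0\<^sub>m n n"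
    proof (rule mat_eq_zeroI)
      fix v :: "complex Matrix.vec" assume v: "v \<in> carrier_vec n"
      have "(U s0 - 1\<^sub>m n) *\<^sub>v v = U s0 *\<^sub>v v - 1\<^sub>m n *\<^sub>v v"
        by (rule minus_mult_distrib_mat_vec[OF U one_carrier_mat v])
      also have "\<dots> = v - v" using n v by simp
      also have "\<dots> = 0\<^sub>v n" using v by simp
      finally show "(U s0 - 1\<^sub>m n) *\<^sub>v v = 0\<^sub>v n" .
    qed (rule minus_carrier_mat[OF one_carrier_mat])
    then have e: "(U s0 - 1\<^sub>m n) $$ (i, j) = 0" if "i < n" "j < n" for i j using that by simp
    have "U s0 = 1\<^sub>m n"
      by (rule eq_matI) (use e in \<open>auto split: if_splits\<close>)
    then show False using s0 by blast
  qed
  then obtain u where u: "u \<in> carrier_vec n" "U s0 *\<^sub>v u \<noteq> u" by blast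
  \<comment> \<open>The image of \<open>U s0 - 1\<close> lies in the eigenspace for \<open>-1\<close>.\<close>
  define v where "v = U s0 *\<^sub>v u - u"
  have Uu: "U s0 *\<^sub>v u \<in> carrier_vec n" by (rule mult_mat_vec_carrier[OF U u(1)])
  have v: "v \<in> carrier_vec n" using Uu u by (simp add: v_def)
  moreover have "v \<noteq> 0\<^sub>v n"
  proof
    assume "v = 0\<^sub>v n"
    then have "\<And>i. i < n \<Longrightarrow> (U s0 *\<^sub>v u) $ i - u $ i = 0" using u Uu unfolding v_def by (metis index_minus_vec(1) index_zero_vec(1) carrier_vecD)
    then have "U s0 *\<^sub>v u = u" using u Uu by (intro eq_vecI) auto
    then show False using u by blast
  qed
  moreover have "U s0 *\<^sub>v v = (-1) \<cdot>\<^sub>v v"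
  proof -
    have "U s0 *\<^sub>v v = U s0 *\<^sub>v (U s0 *\<^sub>v u) - U s0 *\<^sub>v u"
      unfolding v_def by (rule mult_minus_distrib_mat_vec[OF U Uu u(1)])
    also have "U s0 *\<^sub>v (U s0 *\<^sub>v u) = u"
      using assoc_mult_mat_vec[OF U U u(1), of s0 s0] inv[of s0] u(1) by simp
    also have "u - U s0 *\<^sub>v u = (-1) \<cdot>\<^sub>v v" unfolding v_def using u(1) Uu by (intro eq_vecI) auto
    finally show ?thesis .
  qed
  ultimately show ?case by blast
next
  case (insert x F)
  then obtain v where v: "v \<in> carrier_vec n" "v \<noteq> 0\<^sub>v n" "U s0 *\<^sub>v v = (-1) \<cdot>\<^sub>v v"
    and F: "\<And>y. y \<in> F \<Longrightarrow> \<exists>c. U y *\<^sub>v v = c \<cdot>\<^sub>v v" by blast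
  have dU [simp]: "dim_row (U x) = n" "dim_col (U x) = n" for x using U[of x] by auto
  have Uv: "U x *\<^sub>v v \<in> carrier_vec n" by (rule mult_mat_vec_carrier[OF U v(1)])
  define v' where "v' = v + U x *\<^sub>v v"
  have v'c: "v' \<in> carrier_vec n" using v Uv by (simp add: v'_def)
  show ?case
  proof (cases "v' = 0\<^sub>v n")
    case True
    have "U x *\<^sub>v v = (-1) \<cdot>\<^sub>v v"
    proof (rule eq_vecI)
      fix i assume "i < dim_vec ((-1) \<cdot>\<^sub>v v)"
      then have i: "i < n" using v by simp
      have "v' $ i = 0" using True i by simp
      then have "(U x *\<^sub>v v) $ i = - v $ i" using i v Uv by (simp add: v'_def eq_neg_iff_add_eq_0 add.commute)
      then show "(U x *\<^sub>v v) $ i = ((-1) \<cdot>\<^sub>v v) $ i" using i v by simp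
    qed (use v Uv in simp)
    then show ?thesis using v F by blast
  next
    case False
    have comm_eig: "U y *\<^sub>v v' = c \<cdot>\<^sub>v v'" if c: "U y *\<^sub>v v = c \<cdot>\<^sub>v v" for y c
    proof -
      have "U y *\<^sub>v v' = U y *\<^sub>v v + U y *\<^sub>v (U x *\<^sub>v v)"
        unfolding v'_def by (rule mult_add_distrib_mat_vec[OF U v(1) Uv])
      also have "U y *\<^sub>v (U x *\<^sub>v v) = U x *\<^sub>v (U y *\<^sub>v v)"
        using assoc_mult_mat_vec[OF U U v(1), of x y] assoc_mult_mat_vec[OF U U v(1), of y x] comm[of x y] by simp
      also have "\<dots> = c \<cdot>\<^sub>v (U x *\<^sub>v v)" unfolding c by (rule smult_mat_vec[OF U v(1)])
      also have "U y *\<^sub>v v + c \<cdot>\<^sub>v (U x *\<^sub>v v) = c \<cdot>\<^sub>v v'"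
        unfolding c v'_def using v(1) Uv by (simp add: smult_add_distrib_vec)
      finally show ?thesis .
    qed
    have "U x *\<^sub>v v' = 1 \<cdot>\<^sub>v v'"
    proof -
      have "U x *\<^sub>v v' = U x *\<^sub>v v + U x *\<^sub>v (U x *\<^sub>v v)"
        unfolding v'_def by (rule mult_add_distrib_mat_vec[OF U v(1) Uv])
      also have "U x *\<^sub>v (U x *\<^sub>v v) = v"
        using assoc_mult_mat_vec[OF U U v(1), of x x] inv[of x] v(1) by simp
      also have "U x *\<^sub>v v + v = 1 \<cdot>\<^sub>v v'" unfolding v'_def using v(1) Uv by (intro eq_vecI) (auto simp: add.commute)
      finally show ?thesis .
    qed
    then show ?thesis using False v'c comm_eig[OF v(3)] comm_eig F by (intro bexI[of _ v']) blast+
  qed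
qed

text \<open>The upper unipotent matrices form a group of exponent two, so they have a joint eigenvector
  with an additive character \<open>\<psi>\<close> of values \<open>1\<close> and \<open>-1\<close>, and \<open>\<psi>\<close> can be chosen nontrivial on the ideal of
  \<open>t\<^sup>k\<^sup>-\<^sup>1\<close>.  Diagonal matrices move \<open>\<psi>\<close> to the characters \<open>x \<mapsto> \<psi> (a\<^sup>2 x)\<close> for units \<open>a\<close>.  Since squaring is
  additive, units that differ modulo \<open>t\<close> to the power \<open>k div 2\<close> have distinct squares modulo
  \<open>t\<^sup>k\<close> and give distinct characters, each of which needs its own dimension.\<close>

lemma dimension_bound:
  assumes \<rho>: "\<rho> \<in> hom G (GL n)" and triv: "\<And>g. g \<in> principal_congruence k \<Longrightarrow> \<rho> g = 1\<^sub>m n"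
    and k: "k \<ge> 2" and nontriv: "g0 \<in> principal_congruence (k - 1)" "\<rho> g0 \<noteq> 1\<^sub>m n"
  shows "q ^ (k div 2) \<le> 2 * n"
proof -
  define U where "U x = \<rho> (unip x)" for x
  have Uc: "U x \<in> carrier_mat n n" for x using rep_carrier[OF \<rho> unip_in_SL2[of x]] by (simp add: U_def)
  have Um: "U x * U y = U (x + y)" for x y
    using rep_mult[OF \<rho> unip_in_SL2[of x] unip_in_SL2[of y]] by (simp add: U_def unip_mult)
  have Ucong: "U x = U y" if "congruent k x y" for x y
    unfolding U_def by (rule rep_congruent[OF \<rho> triv]) (use that in \<open>auto simp: unip_congruent\<close>)
  have U0: "U 0 = 1\<^sub>m n" using rep_one[OF G.is_group \<rho>] by (simp add: U_def unip_0)
  obtain y0 where y0: "U (t ^ (k - 1) * y0) \<noteq> 1\<^sub>m n"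
    using principal_congruence_generated[OF \<rho> triv k _ nontriv(1)] nontriv(2) unfolding U_def by blast
  define s0 where "s0 = t ^ (k - 1) * y0"
  have "\<exists>v\<in>carrier_vec n. v \<noteq> 0\<^sub>v n \<and> U s0 *\<^sub>v v = (-1) \<cdot>\<^sub>v v \<and> (\<forall>x\<in>residues k. \<exists>c. U x *\<^sub>v v = c \<cdot>\<^sub>v v)"
    by (rule joint_eigenvector) (use Uc Um U0 y0 in \<open>auto simp: s0_def add.commute\<close>)
  then obtain v where v: "v \<in> carrier_vec n" "v \<noteq> 0\<^sub>v n" "U s0 *\<^sub>v v = (-1) \<cdot>\<^sub>v v"
    and eig: "\<And>x. x \<in> residues k \<Longrightarrow> \<exists>c. U x *\<^sub>v v = c \<cdot>\<^sub>v v" by blast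
  have "\<exists>c. U x *\<^sub>v v = c \<cdot>\<^sub>v v" for x
    using eig[of "red k x"] Ucong[OF congruent_red[of k x]] by simp
  then obtain \<psi> where \<psi>: "\<And>x. U x *\<^sub>v v = \<psi> x \<cdot>\<^sub>v v" by metis
  have s0v: "U s0 *\<^sub>v v \<noteq> v"
  proof
    assume e: "U s0 *\<^sub>v v = v"
    have "v = 0\<^sub>v n"
    proof (rule eq_vecI)
      fix i assume "i < dim_vec (0\<^sub>v n)"
      then have i: "i < n" by simp
      have "v $ i = ((-1) \<cdot>\<^sub>v v) $ i" using e v(3) by simp
      then have "v $ i = - (v $ i)" using i v(1) by simp
      then show "v $ i = 0\<^sub>v n $ i" using i by (simp add: eq_neg_iff_add_eq_0)
    qed (use v in simp)
    then show False using v by blast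
  qed
  define iv where "iv a = (SOME b. a * b = 1)" for a :: 'a
  have iv: "a * iv a = 1" if "a dvd 1" for a
    using that unfolding iv_def by (intro someI_ex[of "\<lambda>v. a * v = 1"]) (auto simp: dvd_def)
  define h where "h a = mat2 (iv a) 0 0 a" for a
  have hG: "h a \<in> carrier G" if "a dvd 1" for a
    using iv[OF that] by (simp add: h_def mat2_in_SL2 mult.commute)
  have hU: "unip x * h a = h a * unip (a * a * x)" if "a dvd 1" for a x
  proof -
    have "iv a * (a * a * x) = (a * iv a) * (x * a)" by (simp add: ac_simps)
    then have e: "iv a * (a * a * x) = x * a" using iv[OF that] by simp
    show ?thesis unfolding unip_def h_def mat2_mult e by simp
  qed
  define c where "c = k div 2"
  define w where "w a = \<rho> (h a) *\<^sub>v v" for a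
  define I where "I = unit_residues c"
  have unit: "a dvd 1" if "a \<in> I" for a using that by (simp add: I_def unit_residues_def)
  have weig: "U x *\<^sub>v w a = \<psi> (a * a * x) \<cdot>\<^sub>v w a" if a: "a \<in> I" for a x
  proof -
    note ha = hG[OF unit[OF a]]
    note c = rep_carrier[OF \<rho> ha]
    have "U x *\<^sub>v w a = (U x * \<rho> (h a)) *\<^sub>v v"
      unfolding w_def using assoc_mult_mat_vec[OF Uc c v(1)] by simp
    also have "U x * \<rho> (h a) = \<rho> (h a) * U (a * a * x)"
      unfolding U_def using rep_mult[OF \<rho> unip_in_SL2[of x] ha] rep_mult[OF \<rho> ha unip_in_SL2] hU[OF unit[OF a]] by simp
    also have "(\<rho> (h a) * U (a * a * x)) *\<^sub>v v = \<rho> (h a) *\<^sub>v (\<psi> (a * a * x) \<cdot>\<^sub>v v)"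
      using assoc_mult_mat_vec[OF c Uc v(1)] \<psi> by simp
    also have "\<dots> = \<psi> (a * a * x) \<cdot>\<^sub>v w a" unfolding w_def by (rule smult_mat_vec[OF c v(1)])
    finally show ?thesis .
  qed
  have wnz: "w a \<noteq> 0\<^sub>v n" if a: "a \<in> I" for a
  proof
    assume z: "w a = 0\<^sub>v n"
    note ha = hG[OF unit[OF a]]
    note c = rep_carrier[OF \<rho> ha] rep_carrier[OF \<rho> G.inv_closed[OF ha]]
    have "\<rho> (inv\<^bsub>G\<^esub> h a) * \<rho> (h a) = 1\<^sub>m n"
      using rep_mult[OF \<rho> G.inv_closed[OF ha] ha] G.l_inv[OF ha] rep_one[OF G.is_group \<rho>] by simp
    then have "v = \<rho> (inv\<^bsub>G\<^esub> h a) *\<^sub>v w a"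
      unfolding w_def using assoc_mult_mat_vec[OF c(2,1) v(1)] v(1) by simp
    also have "\<dots> = 0\<^sub>v n" unfolding z using c(2) by (intro eq_vecI) auto
    finally show False using v by blast
  qed
  have dist: "\<exists>x\<in>UNIV. \<psi> (a * a * x) \<noteq> \<psi> (b * b * x)" if a: "a \<in> I" and b: "b \<in> I" and ab: "a \<noteq> b" for a b
  proof (rule ccontr)
    assume "\<not> (\<exists>x\<in>UNIV. \<psi> (a * a * x) \<noteq> \<psi> (b * b * x))"
    then have e: "\<psi> (a * a * x) = \<psi> (b * b * x)" for x by blast
    \<comment> \<open>If the characters agree, \<open>\<psi>\<close> is trivial on the ideal generated by \<open>(a - b)\<^sup>2\<close>, which contains \<open>s0\<close> modulo \<open>t\<^sup>k\<close>.\<close>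
    define z where "z = (a - b) * (a - b)"
    have z: "z = a * a + b * b" by (simp add: z_def algebra_simps)
    have fixed: "U (z * x) *\<^sub>v v = v" for x
    proof -
      have "z * x = a * a * x + b * b * x" by (simp add: z distrib_right)
      then have "U (z * x) *\<^sub>v v = U (a * a * x) *\<^sub>v (U (b * b * x) *\<^sub>v v)"
        using assoc_mult_mat_vec[OF Uc Uc v(1), of "a * a * x" "b * b * x"] Um by simp
      also have "U (b * b * x) *\<^sub>v v = U (a * a * x) *\<^sub>v v" using \<psi> e by simp
      also have "U (a * a * x) *\<^sub>v (U (a * a * x) *\<^sub>v v) = U (a * a * x + a * a * x) *\<^sub>v v"
        using assoc_mult_mat_vec[OF Uc Uc v(1), of "a * a * x" "a * a * x"] Um by simp
      also have "\<dots> = v" using U0 v(1) by simp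
      finally show ?thesis .
    qed
    obtain e where e: "valuation_form k e z" using valuation_form_exists by blast
    then obtain u where u: "e \<le> k" "u dvd 1" "t ^ k dvd z - t ^ e * u" by (auto simp: valuation_form_def)
    have "e \<noteq> k"
    proof
      assume "e = k"
      then have "t ^ k dvd z" using valuation_form_dvd[OF e] by simp
      then have "t ^ c dvd a - b" unfolding z_def c_def by (rule dvd_square)
      then have "a = b" using a b residues_eqI[of a c b] by (simp add: I_def unit_residues_def)
      then show False using ab by blast
    qed
    then have ek: "e \<le> k - 1" using u(1) by simp
    \<comment> \<open>With this choice \<open>z x\<close> is congruent to \<open>s0\<close>.\<close>
    define x where "x = iv u * (t ^ (k - 1 - e) * y0)"
    have "t ^ e * u * x = (u * iv u) * (t ^ e * t ^ (k - 1 - e) * y0)" by (simp add: x_def ac_simps)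
    also have "t ^ e * t ^ (k - 1 - e) = t ^ (k - 1)"
      unfolding power_add[symmetric] using ek by (intro arg_cong[where f = "\<lambda>m. t ^ m"]) simp
    finally have tx: "t ^ e * u * x = s0" using iv[OF u(2)] by (simp add: s0_def)
    have "t ^ k dvd (z - t ^ e * u) * x" using u(3) by (rule dvd_mult2)
    also have "(z - t ^ e * u) * x = z * x - s0" unfolding tx[symmetric] by (simp add: algebra_simps)
    finally have "U (z * x) = U s0" by (intro Ucong) (simp only: congruent_def)
    then show False using fixed[of x] s0v by simp
  qed
  have "card I \<le> n"
  proof (rule simultaneous_eigenvectors_card_le[where T = U and w = w and D = UNIV and \<chi> = "\<lambda>a x. \<psi> (a * a * x)"])
    show "finite I" by (simp add: I_def unit_residues_def)
    show "w a \<in> carrier_vec n" if "a \<in> I" for a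
      unfolding w_def using rep_carrier[OF \<rho> hG[OF unit[OF that]]] v(1) by simp
  qed (use Uc wnz weig dist in blast)+
  moreover have "q ^ c \<le> 2 * card I"
    unfolding I_def by (rule card_unit_residues_ge) (use k in \<open>simp add: c_def\<close>)
  ultimately show ?thesis by (simp add: c_def)
qed

end

section \<open>Continuous representations\<close>

definition distance_from_one :: "nat \<Rightarrow> complex mat \<Rightarrow> real" where
  "distance_from_one n A = (\<Sum>i<n. \<Sum>j<n. cmod (A $$ (i, j) - 1\<^sub>m n $$ (i, j)))"

text \<open>For \<open>A = 1 + B\<close> one has \<open>A\<^sup>2 - 1 = 2 B + B\<^sup>2\<close>, and the sum of the absolute values of all entries is a
  submultiplicative norm.\<close>

lemma distance_from_one_square:
  assumes A: "A \<in> carrier_mat n n"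
  shows "distance_from_one n (A * A) \<ge> 2 * distance_from_one n A - (distance_from_one n A)\<^sup>2"
proof -
  define B where "B i j = A $$ (i, j) - 1\<^sub>m n $$ (i, j)" for i j
  define S where "S = distance_from_one n A"
  have S: "S = (\<Sum>i<n. \<Sum>j<n. cmod (B i j))" by (simp add: S_def distance_from_one_def B_def)
  have ent: "(A * A) $$ (i, j) - 1\<^sub>m n $$ (i, j) = 2 * B i j + (\<Sum>l<n. B i l * B l j)" if "i < n" "j < n" for i j
  proof -
    have A': "A $$ (i, j) = B i j + (if i = j then 1 else 0)" if "i < n" "j < n" for i j
      using that by (simp add: B_def)
    have "(A * A) $$ (i, j) = (\<Sum>l<n. A $$ (i, l) * A $$ (l, j))"
      using A that by (simp add: scalar_prod_def atLeast0LessThan)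
    also have "\<dots> = (\<Sum>l<n. B i l * B l j + (if l = j then B i l else 0) + (if l = i then B l j else 0) +
        (if l = i then (if i = j then 1 else 0) else 0))"
      by (rule sum.cong) (use A' that in \<open>auto simp: algebra_simps\<close>)
    also have "\<dots> = (\<Sum>l<n. B i l * B l j) + B i j + B i j + (if i = j then 1 else 0)"
      using that by (simp add: sum.distrib)
    finally show ?thesis using that by simp
  qed
  have "(\<Sum>i<n. \<Sum>j<n. cmod (\<Sum>l<n. B i l * B l j)) \<le> (\<Sum>i<n. \<Sum>j<n. \<Sum>l<n. cmod (B i l) * cmod (B l j))"
    by (intro sum_mono order_trans[OF norm_sum]) (simp add: norm_mult)
  also have "\<dots> = (\<Sum>i<n. \<Sum>l<n. cmod (B i l) * (\<Sum>j<n. cmod (B l j)))"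
    by (rule sum.cong[OF refl]) (subst sum.swap, simp add: sum_distrib_left)
  also have "\<dots> \<le> (\<Sum>i<n. \<Sum>l<n. cmod (B i l) * S)"
  proof (intro sum_mono mult_left_mono)
    fix l assume "l \<in> {..<n}"
    then show "(\<Sum>j<n. cmod (B l j)) \<le> S"
      unfolding S by (intro member_le_sum[of l "{..<n}" "\<lambda>l. \<Sum>j<n. cmod (B l j)"]) (auto intro: sum_nonneg)
  qed auto
  also have "\<dots> = S * S" unfolding S by (simp add: sum_distrib_right)
  finally have 1: "(\<Sum>i<n. \<Sum>j<n. cmod (\<Sum>l<n. B i l * B l j)) \<le> S * S" .
  have "2 * S - (\<Sum>i<n. \<Sum>j<n. cmod (\<Sum>l<n. B i l * B l j)) = 
      (\<Sum>i<n. \<Sum>j<n. cmod (2 * B i j) - cmod (\<Sum>l<n. B i l * B l j))"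
    unfolding S by (simp add: sum_subtractf sum_distrib_left norm_mult)
  also have "\<dots> \<le> (\<Sum>i<n. \<Sum>j<n. cmod ((A * A) $$ (i, j) - 1\<^sub>m n $$ (i, j)))"
  proof (intro sum_mono)
    fix i j assume "i \<in> {..<n}" "j \<in> {..<n}"
    then have e: "(A * A) $$ (i, j) - 1\<^sub>m n $$ (i, j) = 2 * B i j + (\<Sum>l<n. B i l * B l j)" using ent by simp
    show "cmod (2 * B i j) - cmod (\<Sum>l<n. B i l * B l j) \<le> cmod ((A * A) $$ (i, j) - 1\<^sub>m n $$ (i, j))"
      unfolding e by (rule norm_diff_ineq)
  qed
  also have "\<dots> = distance_from_one n (A * A)" by (simp add: distance_from_one_def)
  finally show ?thesis using 1 by (simp add: S_def power2_eq_square)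
qed

text \<open>Squaring an element within distance \<open>1 / 2\<close> of the identity multiplies the distance by at least
  \<open>3 / 2\<close>, so the powers of a nontrivial element leave every small neighbourhood.\<close>

lemma no_small_subgroups:
  assumes \<rho>: "\<rho> \<in> hom G (GL n)" and N: "subgroup N G"
    and small: "\<And>g. g \<in> N \<Longrightarrow> distance_from_one n (\<rho> g) \<le> 1 / 2" and g: "g \<in> N"
  shows "\<rho> g = 1\<^sub>m n"
proof -
  have NG: "g \<in> carrier G" if "g \<in> N" for g using subgroup.mem_carrier[OF N that] .
  define S where "S g = distance_from_one n (\<rho> g)" for g
  have nonneg: "S g \<ge> 0" for g by (simp add: S_def distance_from_one_def sum_nonneg)
  have step: "S (g \<otimes>\<^bsub>G\<^esub> g) \<ge> 3 / 2 * S g" if "g \<in> N" for g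
  proof -
    have "S g * S g \<le> 1 / 2 * S g" using small[OF that] nonneg[of g] unfolding S_def[symmetric] by (intro mult_right_mono)
    moreover have "S (g \<otimes>\<^bsub>G\<^esub> g) \<ge> 2 * S g - (S g)\<^sup>2"
      unfolding S_def rep_mult[OF \<rho> NG[OF that] NG[OF that]]
      by (rule distance_from_one_square[OF rep_carrier[OF \<rho> NG[OF that]]])
    ultimately show ?thesis by (simp add: power2_eq_square)
  qed
  have pow: "\<exists>h\<in>N. S h \<ge> (3 / 2) ^ m * S g" for m
  proof (induction m)
    case 0
    then show ?case using g by auto
  next
    case (Suc m)
    then obtain h where h: "h \<in> N" "S h \<ge> (3 / 2) ^ m * S g" by blast
    have "(3 / 2) ^ Suc m * S g = 3 / 2 * ((3 / 2) ^ m * S g)" by simp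
    also have "\<dots> \<le> 3 / 2 * S h" by (rule mult_left_mono[OF h(2)]) simp
    also have "\<dots> \<le> S (h \<otimes>\<^bsub>G\<^esub> h)" by (rule step[OF h(1)])
    finally show ?case using subgroup.m_closed[OF N h(1) h(1)] by blast
  qed
  have "S g = 0"
  proof (rule ccontr)
    assume "S g \<noteq> 0"
    then have pos: "S g > 0" using nonneg[of g] by simp
    obtain m where m: "1 / S g < (3 / 2) ^ m" using real_arch_pow[of "3 / 2" "1 / S g"] by auto
    obtain h where h: "h \<in> N" "S h \<ge> (3 / 2) ^ m * S g" using pow by blast
    have "1 < (3 / 2) ^ m * S g" using m pos by (simp add: pos_divide_less_eq)
    then show False using h(2) small[OF h(1)] by (simp add: S_def)
  qed
  then have "(\<Sum>i<n. \<Sum>j<n. cmod (\<rho> g $$ (i, j) - 1\<^sub>m n $$ (i, j))) = 0" by (simp add: S_def distance_from_one_def)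
  then have "\<forall>i\<in>{..<n}. (\<Sum>j<n. cmod (\<rho> g $$ (i, j) - 1\<^sub>m n $$ (i, j))) = 0"
    by (subst (asm) sum_nonneg_eq_0_iff) (auto intro: sum_nonneg)
  then have z: "\<forall>i\<in>{..<n}. \<forall>j\<in>{..<n}. cmod (\<rho> g $$ (i, j) - 1\<^sub>m n $$ (i, j)) = 0"
    by (subst (asm) sum_nonneg_eq_0_iff) auto
  show ?thesis
  proof (rule eq_matI)
    fix i j assume "i < dim_row (1\<^sub>m n)" "j < dim_col (1\<^sub>m n)"
    then have "cmod (\<rho> g $$ (i, j) - 1\<^sub>m n $$ (i, j)) = 0" using z by simp
    then show "\<rho> g $$ (i, j) = 1\<^sub>m n $$ (i, j)" by simp
  qed (use rep_carrier[OF \<rho> NG[OF g]] in auto)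
qed

context char_two_uniformizer
begin

interpretation G: Group.group G by (rule group_SL)

lemma mat_congruent_mono: "mat_congruent k A B \<Longrightarrow> l \<le> k \<Longrightarrow> mat_congruent l A B"
  unfolding mat_congruent_def congruent_def by (meson dvd_trans le_imp_power_dvd)

abbreviation T :: "'a mat topology" where "T \<equiv> SL_topology 2"

lemma SL_topology_eq:
  assumes P: "dvr_ideal (class_ring :: 'a ring) = {x. t dvd x}"
  shows "T = topology_generated_by {{B \<in> carrier G. mat_congruent k B A} | A k. A \<in> carrier G}"
  unfolding SL_topology_def power_dvr_ideal_eq[OF P] mat_congruent_def congruent_def mem_Collect_eq ..

lemma open_contains_coset:
  assumes P: "dvr_ideal (class_ring :: 'a ring) = {x. t dvd x}"
    and V: "openin T V" and A: "A \<in> V"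
  shows "\<exists>k. \<forall>B\<in>carrier G. mat_congruent k B A \<longrightarrow> B \<in> V"
proof -
  have "generate_topology_on {{B \<in> carrier G. mat_congruent k B A} | A k. A \<in> carrier G} V"
    using V unfolding SL_topology_eq[OF P] by (rule openin_topology_generated_by)
  then show ?thesis using A
  proof (induction arbitrary: A rule: generate_topology_on.induct)
    case Empty
    then show ?case by simp
  next
    case (Int U W)
    then obtain k l where kl: "\<forall>B\<in>carrier G. mat_congruent k B A \<longrightarrow> B \<in> U" "\<forall>B\<in>carrier G. mat_congruent l B A \<longrightarrow> B \<in> W"
      by (metis IntE)
    have "B \<in> U \<inter> W" if B: "B \<in> carrier G" "mat_congruent (max k l) B A" for B
      using kl B mat_congruent_mono[OF B(2), of k] mat_congruent_mono[OF B(2), of l] by simp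
    then show ?case by blast
  next
    case (UN K)
    then obtain U where U: "U \<in> K" "A \<in> U" by blast
    obtain k where "\<forall>B\<in>carrier G. mat_congruent k B A \<longrightarrow> B \<in> U" using UN.IH[OF U] by blast
    then show ?case using U by blast
  next
    case (Basis W)
    then obtain C k where "W = {B \<in> carrier G. mat_congruent k B C}" by blast
    then show ?case using Basis.prems mat_congruent_trans by blast
  qed
qed

lemma coset_open:
  assumes P: "dvr_ideal (class_ring :: 'a ring) = {x. t dvd x}" and A: "A \<in> carrier G"
  shows "openin T {B \<in> carrier G. mat_congruent k B A}"
  unfolding SL_topology_eq[OF P] by (rule topology_generated_by_Basis) (use A in blast)

text \<open>Continuity at the identity makes the image of a congruence subgroup a small subgroup.\<close>

lemma continuous_rep_trivial:
  assumes P: "dvr_ideal (class_ring :: 'a ring) = {x. t dvd x}"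
    and \<rho>: "\<rho> \<in> continuous_reps G T n"
  shows "\<exists>k. \<forall>g\<in>principal_congruence k. \<rho> g = 1\<^sub>m n"
proof -
  have h: "\<rho> \<in> hom G (GL n)" using \<rho> by (simp add: continuous_reps_def)
  \<comment> \<open>Small enough for the sum of \<open>n\<^sup>2\<close> such terms to stay below \<open>1 / 2\<close>.\<close>
  define \<epsilon> where "\<epsilon> = 1 / (2 * (real n * real n + 1))"
  have \<epsilon>: "\<epsilon> > 0" by (simp add: \<epsilon>_def add_nonneg_pos)
  have one: "1\<^sub>m 2 \<in> carrier G" using G.one_closed by simp
  have "\<exists>k. \<forall>B\<in>carrier G. mat_congruent k B (1\<^sub>m 2) \<longrightarrow> cmod (\<rho> B $$ (i, j) - 1\<^sub>m n $$ (i, j)) < \<epsilon>"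
    if "i < n" "j < n" for i j
  proof -
    have "continuous_map T euclidean (\<lambda>g. \<rho> g $$ (i, j))" using \<rho> that by (simp add: continuous_reps_def)
    then have "openin T {g \<in> topspace T. \<rho> g $$ (i, j) \<in> ball (1\<^sub>m n $$ (i, j)) \<epsilon>}"
      by (rule openin_continuous_map_preimage) simp
    moreover have "1\<^sub>m 2 \<in> {g \<in> topspace T. \<rho> g $$ (i, j) \<in> ball (1\<^sub>m n $$ (i, j)) \<epsilon>}"
      using one \<epsilon> rep_one[OF G.is_group h] by (simp add: topspace_SL_topology)
    ultimately obtain k where k: "\<forall>B\<in>carrier G. mat_congruent k B (1\<^sub>m 2) \<longrightarrow> 
       B \<in> {g \<in> topspace T. \<rho> g $$ (i, j) \<in> ball (1\<^sub>m n $$ (i, j)) \<epsilon>}"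
      using open_contains_coset[OF P] by blast
    then show ?thesis by (intro exI[of _ k]) (auto simp: dist_norm norm_minus_commute)
  qed
  then obtain kk where kk: "\<And>i j B. i < n \<Longrightarrow> j < n \<Longrightarrow> B \<in> carrier G \<Longrightarrow> mat_congruent (kk i j) B (1\<^sub>m 2) \<Longrightarrow> 
      cmod (\<rho> B $$ (i, j) - 1\<^sub>m n $$ (i, j)) < \<epsilon>" by metis
  \<comment> \<open>A common upper bound of the levels that the matrix entries require.\<close>
  define k where "k = (\<Sum>i<n. \<Sum>j<n. kk i j)"
  have kle: "kk i j \<le> k" if "i < n" "j < n" for i j
  proof -
    have "kk i j \<le> (\<Sum>j<n. kk i j)" using that by (intro member_le_sum) auto
    also have "\<dots> \<le> k" unfolding k_def using that by (intro member_le_sum[of i _ "\<lambda>i. \<Sum>j<n. kk i j"]) auto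
    finally show ?thesis .
  qed
  have "\<rho> g = 1\<^sub>m n" if g: "g \<in> principal_congruence k" for g
  proof (rule no_small_subgroups[OF h principal_congruence_subgroup _ g])
    fix g assume "g \<in> principal_congruence k"
    then have g: "g \<in> carrier G" "mat_congruent k g (1\<^sub>m 2)" by (auto simp: principal_congruence_def)
    have "distance_from_one n (\<rho> g) \<le> (\<Sum>i<n. \<Sum>j<n. \<epsilon>)"
      unfolding distance_from_one_def
    proof (intro sum_mono)
      fix i j assume "i \<in> {..<n}" "j \<in> {..<n}"
      then show "cmod (\<rho> g $$ (i, j) - 1\<^sub>m n $$ (i, j)) \<le> \<epsilon>"
        using kk[of i j g] kle[of i j] g mat_congruent_mono[OF g(2)] by (simp add: less_imp_le)
    qed
    also have "\<dots> = real n * real n * \<epsilon>" by simp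
    also have "\<dots> \<le> 1 / 2"
    proof -
      have "2 * (real n * real n + 1) > 0" by (simp add: add_nonneg_pos)
      then show ?thesis unfolding \<epsilon>_def by (simp add: pos_divide_le_eq)
    qed
    finally show "distance_from_one n (\<rho> g) \<le> 1 / 2" .
  qed
  then show ?thesis by blast
qed

lemma locally_constant_continuous:
  assumes P: "dvr_ideal (class_ring :: 'a ring) = {x. t dvd x}"
    and \<rho>: "\<rho> \<in> hom G (GL n)"
    and const: "\<And>g g'. g \<in> carrier G \<Longrightarrow> g' \<in> principal_congruence k #>\<^bsub>G\<^esub> g \<Longrightarrow> \<rho> g' = \<rho> g"
  shows "\<rho> \<in> continuous_reps G T n"
proof -
  have "continuous_map T euclidean (\<lambda>g. \<rho> g $$ (i, j))" for i j
    unfolding continuous_map_def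
  proof (intro conjI allI impI)
    fix W :: "complex set"
    let ?V = "{g \<in> topspace T. \<rho> g $$ (i, j) \<in> W}"
    show "openin T ?V"
    proof (subst openin_subopen, intro ballI)
      fix A assume "A \<in> ?V"
      then have A: "A \<in> carrier G" "\<rho> A $$ (i, j) \<in> W" by (auto simp: topspace_SL_topology)
      have "{B \<in> carrier G. mat_congruent k B A} \<subseteq> ?V"
      proof
        fix B assume "B \<in> {B \<in> carrier G. mat_congruent k B A}"
        then have B: "B \<in> carrier G" "mat_congruent k B A" by auto
        then have "\<rho> B = \<rho> A" using const[OF A(1)] coset_mem_iff[OF B(1) A(1)] by blast
        then show "B \<in> ?V" using A B by (simp add: topspace_SL_topology)
      qed
      then show "\<exists>U. openin T U \<and> A \<in> U \<and> U \<subseteq> ?V"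
        using coset_open[OF P A(1), of k] A(1) by (intro exI[of _ "{B \<in> carrier G. mat_congruent k B A}"]) simp
    qed
  qed simp
  then show ?thesis using \<rho> by (simp add: continuous_reps_def)
qed

section \<open>Convergence at 5/2 and divergence below 1\<close>

lemma summable_cube_geometric: "summable (\<lambda>k. real (Suc k) ^ 3 * 2 powr (- (real k / 4)))"
proof (rule summable_comparison_test_bigo)
  have "norm (2 powr (- (real k / 8))) = (2 powr (- 1 / 8)) ^ k" for k
    by (simp add: powr_power)
  moreover have "(2::real) powr (- 1 / 8) < 2 powr 0" by (rule powr_less_mono) auto
  ultimately show "summable (\<lambda>k. norm (2 powr (- (real k / 8))))"
    by (simp add: summable_geometric)
  show "(\<lambda>k. real (Suc k) ^ 3 * 2 powr (- (real k / 4))) \<in> O(\<lambda>k. 2 powr (- (real k / 8)))"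
    by real_asymp
qed

lemma irrep_level_bound:
  assumes irr: "irrep G n \<rho>" and triv: "\<And>g. g \<in> principal_congruence k \<Longrightarrow> \<rho> g = 1\<^sub>m n"
    and min: "\<And>l. l < k \<Longrightarrow> \<exists>g\<in>principal_congruence l. \<rho> g \<noteq> 1\<^sub>m n"
  shows "q ^ (k div 2) \<le> 2 * n"
proof (cases "k \<ge> 2")
  case True
  then obtain g where "g \<in> principal_congruence (k - 1)" "\<rho> g \<noteq> 1\<^sub>m n" using min[of "k - 1"] by auto
  moreover have "\<rho> \<in> hom G (GL n)" using irr by (simp add: irrep_def)
  ultimately show ?thesis using dimension_bound triv True by blast
next
  case False
  then have "k div 2 = 0" by simp
  moreover have "n > 0" using irr by (simp add: irrep_def irreducible_rep_def)
  ultimately show ?thesis by simp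
qed

lemma level_term_le:
  assumes "q ^ (k div 2) \<le> 2 * n"
  shows "real n powr - (5 / 2) \<le> (2 powr (5 / 2)) * (real (q ^ (k div 2))) powr - (5 / 2)"
proof -
  have qp: "real (q ^ (k div 2)) > 0" using q_ge_2 by simp
  have "real (q ^ (k div 2)) \<le> real (2 * n)" using assms by (simp only: of_nat_le_iff)
  then have "real (q ^ (k div 2)) / 2 \<le> real n" by simp
  then have "real n powr - (5 / 2) \<le> (real (q ^ (k div 2)) / 2) powr - (5 / 2)"
    using qp by (intro powr_mono2') auto
  also have "\<dots> = (real (q ^ (k div 2))) powr - (5 / 2) / 2 powr - (5 / 2)" using qp by (subst powr_divide) auto
  also have "\<dots> = (2 powr (5 / 2)) * (real (q ^ (k div 2))) powr - (5 / 2)" by (simp add: powr_minus_divide)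
  finally show ?thesis .
qed

text \<open>With \<open>x\<close> the power of \<open>q\<close> in the dimension bound, the class number is of order \<open>x\<^sup>2\<close>, up to the factor
  \<open>(k + 1)\<^sup>3\<close>, and the exponent \<open>-5/2\<close> leaves the decay \<open>x\<close> to the power \<open>-1/2\<close>.\<close>

lemma level_sum_le:
  "real (class_number k) * ((2 powr (5 / 2)) * (real (q ^ (k div 2))) powr - (5 / 2)) \<le>
     (24 * real q * 2 powr (5 / 2) * 2 powr (1 / 4)) * (real (Suc k) ^ 3 * 2 powr (- (real k / 4)))"
proof -
  define c where "c = k div 2"
  define x where "x = real (q ^ c)"
  have x2: "x \<ge> 2 ^ c" unfolding x_def using q_ge_2 by (simp add: power_mono)
  then have x0: "x > 0" using zero_less_power[of "2::real" c] by linarith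
  have "k \<le> Suc (2 * c)" by (simp add: c_def)
  then have "q ^ k \<le> q ^ Suc (2 * c)" using q_ge_2 by (intro power_increasing) auto
  then have "real (q ^ k) \<le> real (q ^ Suc (2 * c))" by (simp only: of_nat_le_iff)
  also have "\<dots> = real q * (x * x)" by (simp add: x_def power_mult power2_eq_square power_mult_distrib mult_2 power_add)
  finally have qk: "real (q ^ k) \<le> real q * (x * x)" .
  have "real (class_number k) \<le> real (24 * Suc k ^ 3 * q ^ k)" by (simp only: of_nat_le_iff class_number_le)
  also have "\<dots> = 24 * real (Suc k) ^ 3 * real (q ^ k)" by (simp only: of_nat_mult of_nat_power of_nat_numeral)
  also have "\<dots> \<le> 24 * real (Suc k) ^ 3 * (real q * (x * x))" by (intro mult_left_mono qk) simp
  finally have "real (class_number k) * (2 powr (5 / 2) * x powr - (5 / 2)) \<le>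
      24 * real (Suc k) ^ 3 * (real q * (x * x)) * (2 powr (5 / 2) * x powr - (5 / 2))"
    by (rule mult_right_mono) simp
  also have "\<dots> = 24 * real q * 2 powr (5 / 2) * real (Suc k) ^ 3 * ((x * x) * x powr - (5 / 2))"
    by (simp only: mult_ac)
  also have "(x * x) * x powr - (5 / 2) = x powr - (1 / 2)"
  proof -
    have "x * x = x powr 2" using x0 by (simp add: power2_eq_square)
    then show ?thesis by (simp flip: powr_add)
  qed
  also have "x powr - (1 / 2) \<le> (2 ^ c) powr - (1 / 2)" using x2 by (intro powr_mono2') auto
  also have "(2 ^ c :: real) powr - (1 / 2) = 2 powr (- real c / 2)"
    by (simp add: powr_powr flip: powr_realpow)
  also have "\<dots> \<le> 2 powr (1 / 4 + - (real k / 4))"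
  proof -
    have "real k \<le> 1 + 2 * real c" using \<open>k \<le> Suc (2 * c)\<close> by (simp flip: of_nat_le_iff)
    then show ?thesis by (intro powr_mono) auto
  qed
  also have "\<dots> = 2 powr (1 / 4) * 2 powr (- (real k / 4))" by (simp only: powr_add)
  finally have "real (class_number k) * (2 powr (5 / 2) * x powr - (5 / 2)) \<le> 
      24 * real q * 2 powr (5 / 2) * real (Suc k) ^ 3 * (2 powr (1 / 4) * 2 powr (- (real k / 4)))"
    by (simp add: mult_left_mono)
  then show ?thesis unfolding x_def c_def by (simp only: mult_ac)
qed

text \<open>The representations are grouped by their level, the least \<open>k\<close> such that they are trivial on the
  congruence subgroup modulo \<open>t\<^sup>k\<close>.\<close>

lemma rep_zeta_finite:
  assumes P: "dvr_ideal (class_ring :: 'a ring) = {x. t dvd x}"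
  shows "rep_zeta G T (5 / 2) < \<infinity>"
proof -
  define b where "b k = (24 * real q * 2 powr (5 / 2) * 2 powr (1 / 4)) * (real (Suc k) ^ 3 * 2 powr (- (real k / 4)))" for k
  have sb: "summable b" unfolding b_def by (intro summable_mult summable_cube_geometric)
  have b0: "b k \<ge> 0" for k by (simp add: b_def)
  have "rep_zeta G T (5 / 2) \<le> ennreal (suminf b)"
  proof (rule rep_zeta_le)
    fix R assume R: "continuous_noniso G T R" and fin: "finite R"
    have ci: "snd r \<in> continuous_irreps G T (fst r)" if "r \<in> R" for r
      using R that by (simp add: continuous_noniso_def)
    define lev where "lev r = (LEAST k. \<forall>g\<in>principal_congruence k. snd r g = 1\<^sub>m (fst r))" for r :: "nat \<times> ('a mat \<Rightarrow> complex mat)"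
    have lev: "\<forall>g\<in>principal_congruence (lev r). snd r g = 1\<^sub>m (fst r)" if "r \<in> R" for r
    proof -
      have "snd r \<in> continuous_reps G T (fst r)" using ci[OF that] by (simp add: continuous_irreps_def)
      from continuous_rep_trivial[OF P this] show ?thesis unfolding lev_def by (rule LeastI_ex)
    qed
    have lev_min: "\<exists>g\<in>principal_congruence l. snd r g \<noteq> 1\<^sub>m (fst r)" if "l < lev r" for l r
      using not_less_Least[OF that[unfolded lev_def]] by blast
    have bound: "q ^ (lev r div 2) \<le> 2 * fst r" if "r \<in> R" for r
      using irrep_level_bound[OF continuous_irreps_irrep[OF ci[OF that]]] lev[OF that] lev_min by blast
    define M where "M = Max (insert 0 (lev ` R))"
    have "(\<Sum>r\<in>R. real (fst r) powr - (5 / 2)) = (\<Sum>k\<le>M. \<Sum>r\<in>{r \<in> R. lev r = k}. real (fst r) powr - (5 / 2))"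
      by (rule sum.group[symmetric]) (use fin in \<open>auto simp: M_def\<close>)
    also have "\<dots> \<le> (\<Sum>k\<le>M. b k)"
    proof (rule sum_mono)
      fix k
      let ?Rk = "{r \<in> R. lev r = k}"
      interpret N: normal "principal_congruence k" G by (rule principal_congruence_normal)
      have "noniso G ?Rk" using R unfolding continuous_noniso_def by (blast intro: noniso_subset)
      moreover have "\<rho> g = 1\<^sub>m n" if "(n, \<rho>) \<in> ?Rk" "g \<in> principal_congruence k" for n \<rho> g
        using lev[of "(n, \<rho>)"] that by auto
      ultimately have card: "card ?Rk \<le> class_number k"
        using N.noniso_trivial_card_le[of ?Rk] card_quotient_le[of k] by blast
      have "(\<Sum>r\<in>?Rk. real (fst r) powr - (5 / 2)) \<le> (\<Sum>r\<in>?Rk. (2 powr (5 / 2)) * (real (q ^ (k div 2))) powr - (5 / 2))"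
        by (rule sum_mono, rule level_term_le) (use bound in auto)
      also have "\<dots> = real (card ?Rk) * ((2 powr (5 / 2)) * (real (q ^ (k div 2))) powr - (5 / 2))" by simp
      also have "\<dots> \<le> real (class_number k) * ((2 powr (5 / 2)) * (real (q ^ (k div 2))) powr - (5 / 2))"
        using card by (intro mult_right_mono) auto
      also have "\<dots> \<le> b k" unfolding b_def by (rule level_sum_le)
      finally show "(\<Sum>r\<in>?Rk. real (fst r) powr - (5 / 2)) \<le> b k" .
    qed
    also have "\<dots> \<le> suminf b" by (rule sum_le_suminf[OF sb]) (use b0 in auto)
    finally show "(\<Sum>r\<in>R. real (fst r) powr - (5 / 2)) \<le> suminf b" .
  qed
  also have "ennreal (suminf b) < \<infinity>" by simp
  finally show ?thesis .
qed

text \<open>At least \<open>Q = q\<^sup>k\<close> representations factor through the quotient modulo \<open>t\<^sup>k\<close>, while their squared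
  dimensions sum to at most \<open>2 Q\<^sup>3\<close>.  At most half as many as \<open>Q\<close> can have dimension above \<open>2 Q\<close>.  The
  exponent \<open>s'\<close> serves to treat negative \<open>s\<close> like \<open>s = 0\<close>.\<close>

lemma rep_zeta_ge:
  assumes P: "dvr_ideal (class_ring :: 'a ring) = {x. t dvd x}" and s: "0 \<le> s'" "s \<le> s'"
  shows "ennreal (real (q ^ k) / 2 * (2 * real (q ^ k)) powr - s') \<le> rep_zeta G T s"
proof -
  interpret N: normal "principal_congruence k" G by (rule principal_congruence_normal)
  have fin: "finite (carrier (quotient k))" using card_quotient_le by blast
  obtain R where R: "noniso G R" "finite R" "card R = class_number k"
    "(\<Sum>r\<in>R. fst r ^ 2) \<le> order (quotient k)"
    "\<And>n \<rho> g. (n, \<rho>) \<in> R \<Longrightarrow> g \<in> principal_congruence k \<Longrightarrow> \<rho> g = 1\<^sub>m n"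
    "\<And>n \<rho> g g'. (n, \<rho>) \<in> R \<Longrightarrow> g \<in> carrier G \<Longrightarrow> g' \<in> principal_congruence k #>\<^bsub>G\<^esub> g \<Longrightarrow> \<rho> g' = \<rho> g"
    by (rule N.exists_noniso_trivial[OF fin]) (rule that)
  have irr: "irrep G (fst r) (snd r)" if "r \<in> R" for r using R(1) that by (simp add: noniso_iff)
  define Q where "Q = q ^ k"
  have Q: "Q > 0" using q_ge_2 by (simp add: Q_def)
  define B where "B = {r \<in> R. fst r > 2 * Q}"
  define A where "A = {r \<in> R. fst r \<le> 2 * Q}"
  have finAB: "finite A" "finite B" using R(2) by (auto simp: A_def B_def)
  have "card B * (4 * Q * Q) = (\<Sum>r\<in>B. 4 * Q * Q)" by simp
  also have "\<dots> \<le> (\<Sum>r\<in>B. fst r ^ 2)"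
  proof (rule sum_mono)
    fix r assume "r \<in> B"
    then have "2 * Q \<le> fst r" by (simp add: B_def)
    then have "(2 * Q) * (2 * Q) \<le> fst r * fst r" by (intro mult_mono) auto
    then show "4 * Q * Q \<le> fst r ^ 2" by (simp add: power2_eq_square)
  qed
  also have "\<dots> \<le> (\<Sum>r\<in>R. fst r ^ 2)" by (rule sum_mono2) (use R(2) in \<open>auto simp: B_def\<close>)
  also have "\<dots> \<le> 2 * q ^ (3 * k)" using R(4) card_quotient_le[of k] by (simp add: order_def)
  also have "q ^ (3 * k) = Q * (Q * Q)"
  proof -
    have "Q * (Q * Q) = q ^ (k + (k + k))" by (simp only: Q_def power_add)
    also have "k + (k + k) = 3 * k" by simp
    finally show ?thesis by simp
  qed
  finally have "(2 * card B) * (2 * Q * Q) \<le> Q * (2 * Q * Q)" by (simp add: mult_ac)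
  then have cB: "2 * card B \<le> Q" using Q by (simp only: mult_le_cancel2) simp
  have "card R \<le> card A + card B"
  proof -
    have "R = A \<union> B" by (auto simp: A_def B_def)
    then show ?thesis by (metis card_Un_le)
  qed
  moreover have "Q \<le> card R" unfolding R(3) Q_def by (rule class_number_ge)
  ultimately have cA: "real Q / 2 \<le> real (card A)" using cB by linarith
  have "continuous_noniso G T A"
    unfolding continuous_noniso_def
  proof (intro conjI ballI)
    show "noniso G A" using R(1) by (rule noniso_subset) (auto simp: A_def)
    fix r assume "r \<in> A"
    then have r: "r \<in> R" by (simp add: A_def)
    have "snd r \<in> continuous_reps G T (fst r)"
    proof (rule locally_constant_continuous[OF P])
      show "snd r \<in> hom G (GL (fst r))" using irr[OF r] by (simp add: irrep_def)
      show "snd r g' = snd r g" if "g \<in> carrier G" "g' \<in> principal_congruence k #>\<^bsub>G\<^esub> g" for g g'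
        using R(6)[of "fst r" "snd r"] r that by simp
    qed
    then show "snd r \<in> continuous_irreps G T (fst r)" using irr[OF r] by (simp add: continuous_irreps_def irrep_def)
  qed
  then have "ennreal (\<Sum>r\<in>A. real (fst r) powr - s) \<le> rep_zeta G T s" using finAB(1) by (rule sum_le_rep_zeta)
  moreover have "real Q / 2 * (2 * real Q) powr - s' \<le> (\<Sum>r\<in>A. real (fst r) powr - s)"
  proof -
    have "real Q / 2 * (2 * real Q) powr - s' \<le> real (card A) * (2 * real Q) powr - s'"
      by (rule mult_right_mono[OF cA]) simp
    also have "\<dots> = (\<Sum>r\<in>A. (2 * real Q) powr - s')" by simp
    also have "\<dots> \<le> (\<Sum>r\<in>A. real (fst r) powr - s)"
    proof (rule sum_mono)
      fix r assume r: "r \<in> A"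
      then have "fst r > 0" using irr by (auto simp: A_def irrep_def irreducible_rep_def)
      then have 1: "real (fst r) \<ge> 1" by simp
      have "real (fst r) \<le> real (2 * Q)" using r unfolding of_nat_le_iff by (simp add: A_def)
      then have "(2 * real Q) powr - s' \<le> real (fst r) powr - s'" using s 1 by (intro powr_mono2') auto
      also have "\<dots> \<le> real (fst r) powr - s" using s 1 by (intro powr_mono) auto
      finally show "(2 * real Q) powr - s' \<le> real (fst r) powr - s" .
    qed
    finally show ?thesis .
  qed
  ultimately show ?thesis unfolding Q_def by (meson ennreal_leI order_trans)
qed

lemma rep_zeta_infinite:
  assumes P: "dvr_ideal (class_ring :: 'a ring) = {x. t dvd x}" and s: "s < 1"
  shows "rep_zeta G T s = \<infinity>"
proof (rule ccontr)
  assume "rep_zeta G T s \<noteq> \<infinity>"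
  then obtain B where B: "B \<ge> 0" "rep_zeta G T s = ennreal B"
    by (metis ennreal_cases infinity_ennreal_def)
  define s' where "s' = max 0 s"
  have s': "0 \<le> s'" "s \<le> s'" "s' < 1" using s by (auto simp: s'_def)
  define C where "C = 2 powr - s' / 2"
  have C: "C > 0" by (simp add: C_def)
  define y where "y = 2 powr (1 - s')"
  have y: "y > 1" using s' by (simp add: y_def)
  obtain k where k: "B / C < y ^ k" using real_arch_pow[OF y] by blast
  have "real (q ^ k) / 2 * (2 * real (q ^ k)) powr - s' \<le> B"
    using rep_zeta_ge[OF P s'(1,2), of k] B by (simp add: ennreal_le_iff)
  moreover have "real (q ^ k) / 2 * (2 * real (q ^ k)) powr - s' = C * real (q ^ k) powr (1 - s')"
  proof -
    have p: "real (q ^ k) > 0" using q_ge_2 by simp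
    have "(2 * real (q ^ k)) powr - s' = 2 powr - s' * real (q ^ k) powr - s'" using p by (intro powr_mult)
    moreover have "real (q ^ k) powr (1 - s') = real (q ^ k) * real (q ^ k) powr - s'"
      using p powr_add[of "real (q ^ k)" 1 "- s'"] by simp
    ultimately show ?thesis by (simp add: C_def)
  qed
  moreover have "y ^ k \<le> real (q ^ k) powr (1 - s')"
  proof -
    have "y ^ k = (2 ^ k) powr (1 - s')" unfolding y_def by (simp add: powr_powr mult.commute flip: powr_realpow)
    also have "\<dots> \<le> real (q ^ k) powr (1 - s')" using q_ge_2 s' by (intro powr_mono2) (auto simp: power_mono)
    finally show ?thesis .
  qed
  ultimately have "C * y ^ k \<le> B" using C by (metis mult_left_mono less_imp_le order_trans)
  then show False using k C by (simp add: pos_divide_less_eq mult.commute)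
qed

end

theorem theorem5p9:
  assumes "complete_discrete_valuation_ring (class_ring :: 'a::idom ring)"
    and "finite (carrier (residue_field (class_ring :: 'a ring)))"
    and "CHAR('a) = 2"
  shows "rep_zeta_abscissa (SL 2 :: 'a mat monoid) (SL_topology 2) \<in> {1..5/2}"
proof -
  have dvr: "discrete_valuation_ring (class_ring :: 'a ring)"
    using assms(1) by (rule complete_discrete_valuation_ring.axioms(1))
  obtain t :: 'a where t: "char_two_uniformizer t" "dvr_ideal (class_ring :: 'a ring) = {x. t dvd x}"
    by (rule exists_uniformizer[OF dvr assms(2,3)])
  interpret char_two_uniformizer t by (rule t(1))
  have "rep_zeta_abscissa G T \<le> ereal (5 / 2)"
    unfolding rep_zeta_abscissa_def by (rule Inf_lower) (use rep_zeta_finite[OF t(2)] in blast)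
  moreover have "ereal 1 \<le> rep_zeta_abscissa G T"
    unfolding rep_zeta_abscissa_def
  proof (rule Inf_greatest)
    fix z assume "z \<in> ereal ` {s. rep_zeta G T s < \<infinity>}"
    then obtain s where s: "z = ereal s" "rep_zeta G T s < \<infinity>" by blast
    then have "\<not> s < 1" using rep_zeta_infinite[OF t(2), of s] by auto
    then show "ereal 1 \<le> z" using s(1) by simp
  qed
  ultimately show ?thesis by (simp add: one_ereal_def)
qed

end
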